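(* Let $N\ge 1$ and let $p_1,\dots,p_N$ be real numbers such that $$2<p_i<\bar p\,\Big(1+\frac1N\Big)\quad\text{for all } i=1,\dots,N,\qquad \bar p:=\Big(\frac1N\sum_{i=1}^N\frac1{p_i}\Big)^{-1}<N .$$ Let $w\in X_{1,1}$ be a nontrivial stationary solution of the Fokker-Planck equation $$\partial_s w=\sum_{i=1}^N\partial_i\big[\,|\partial_iw|^{p_i-2}\partial_iw+\alpha_i\,y_i\,w\,\big],$$ and let $\mathcal B(x,t)=t^{-\alpha}\,w(t^{-\alpha_1}x_1,\dots,t^{-\alpha_N}x_N)$, $t>0$, be the corresponding Barenblatt solution of $\partial_tu=\sum_{i=1}^N\partial_i(|\partial_iu|^{p_i-2}\partial_iu)$. Then there exists $\bar\eta>0$, depending on $w$, $N$ and $p_1,\dots,p_N$, such that $$\mathcal B(x,t)\ge\bar\eta\,t^{-\alpha}\qquad\text{if } |x_i|<\bar\eta\,t^{\alpha_i}\ \text{ for } i=1,\dots,N .$$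
   Context: Exponents: $\sigma=N(\bar p-2)+\bar p$, $\alpha=N/\sigma$, $\alpha_i=\dfrac{N(\bar p-p_i)+\bar p}{\sigma p_i}$. $X_{1,1}=\{g\in L^\infty(\mathbb R^N):0\le g\le1,\ \operatorname{supp}g\subseteq K_1\}$, where $K_1=\{|x_i|\le1/2,\ i=1,\dots,N\}$. A function $w$ on $\mathbb R^N$ is a stationary solution of the Fokker-Planck equation if the time-independent function $(y,s)\mapsto w(y)$ is a local weak solution of it in $\mathbb R^N\times\mathbb R$. Here a local weak solution in $\mathbb R^N\times(s_1,s_2)$ is a function $w\in L^\infty_{loc}(s_1,s_2;L^2_{loc}(\mathbb R^N))\cap L^1_{loc}(s_1,s_2;W^{1,1}_{loc}(\mathbb R^N))$ with $\partial_iw\in L^{p_i}_{loc}(\mathbb R^N\times(s_1,s_2))$ such that for a.e. $s_1<t_1<t_2<s_2$ and all $\varphi\in C^\infty_{loc}(s_1,s_2;C^\infty_c(\mathbb R^N))$ $$\int w(\cdot,t_2)\varphi(\cdot,t_2)\,dy-\int w(\cdot,t_1)\varphi(\cdot,t_1)\,dy+\int_{t_1}^{t_2}\!\!\int\Big(-w\,\partial_s\varphi+\sum_i\big(|\partial_iw|^{p_i-2}\partial_iw+\alpha_iy_iw\big)\partial_i\varphi\Big)dy\,ds=0 .$$ Pointwise inequalities are understood almost everywhere (equivalently, for a lower semicontinuous representative of $w$). *)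

theory Defs
  imports "HOL-Analysis.Analysis"
begin

subsection \<open>Exponents\<close>

text \<open>\<open>N = CARD('n)\<close>; \<open>pbar\<close> is the harmonic mean of the \<open>p\<^sub>i\<close>.\<close>

definition pbar :: "real ^ 'n::finite \<Rightarrow> real" where
  "pbar p = inverse ((1 / real CARD('n)) * (\<Sum>i\<in>UNIV. 1 / p $ i))"

definition fp_sigma :: "real ^ 'n::finite \<Rightarrow> real" where
  "fp_sigma p = real CARD('n) * (pbar p - 2) + pbar p"

definition fp_alpha :: "real ^ 'n::finite \<Rightarrow> real" where
  "fp_alpha p = real CARD('n) / fp_sigma p"

definition fp_alpha_i :: "real ^ 'n::finite \<Rightarrow> 'n \<Rightarrow> real" where
  "fp_alpha_i p i = (real CARD('n) * (pbar p - p $ i) + pbar p) / (fp_sigma p * p $ i)"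


subsection \<open>Smooth functions and weak derivatives\<close>

text \<open>The sets \<open>S\<close> below are meant to be open.\<close>

fun Ck_on :: "nat \<Rightarrow> 'a::euclidean_space set \<Rightarrow> ('a \<Rightarrow> real) \<Rightarrow> bool" where
  "Ck_on 0 S f \<longleftrightarrow> continuous_on S f"
| "Ck_on (Suc k) S f \<longleftrightarrow>
     (\<forall>x\<in>S. f differentiable (at x)) \<and> (\<forall>v. Ck_on k S (\<lambda>x. frechet_derivative f (at x) v))"

definition smooth_on :: "'a::euclidean_space set \<Rightarrow> ('a \<Rightarrow> real) \<Rightarrow> bool" where
  "smooth_on S f \<longleftrightarrow> (\<forall>k. Ck_on k S f)"

definition Cc_infinity :: "('a::euclidean_space \<Rightarrow> real) set" where
  "Cc_infinity = {\<phi>. smooth_on UNIV \<phi> \<and> compact (closure {x. \<phi> x \<noteq> 0})}"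

definition Lp_loc :: "real \<Rightarrow> 'a::euclidean_space set \<Rightarrow> ('a \<Rightarrow> real) \<Rightarrow> bool" where
  "Lp_loc q S f \<longleftrightarrow> set_borel_measurable lebesgue S f \<and>
     (\<forall>K. compact K \<and> K \<subseteq> S \<longrightarrow> set_integrable lebesgue K (\<lambda>x. \<bar>f x\<bar> powr q))"

definition has_weak_partial :: "'n::finite \<Rightarrow> (real ^ 'n \<Rightarrow> real) \<Rightarrow> (real ^ 'n \<Rightarrow> real) \<Rightarrow> bool" where
  "has_weak_partial i u g \<longleftrightarrow> Lp_loc 1 UNIV u \<and> Lp_loc 1 UNIV g \<and>
     (\<forall>\<phi>\<in>Cc_infinity.
        (LINT y|lebesgue. u y * frechet_derivative \<phi> (at y) (axis i 1)) =
        - (LINT y|lebesgue. g y * \<phi> y))"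


subsection \<open>Local weak solutions of the Fokker-Planck equation\<close>

text \<open>\<open>I\<close> is an open interval of times, possibly all of \<open>\<real>\<close>; functions live on
  \<open>\<real>\<^sup>N \<times> I\<close>. The Bochner spaces are rendered through jointly measurable functions,
  and \<open>L\<^sup>1(a, b; L\<^sup>1(K))\<close> is identified with \<open>L\<^sup>1(K \<times> (a, b))\<close>.\<close>

definition Linf_loc_L2_loc :: "real set \<Rightarrow> ((real ^ 'n::finite) \<times> real \<Rightarrow> real) \<Rightarrow> bool" where
  "Linf_loc_L2_loc I w \<longleftrightarrow> set_borel_measurable lebesgue (UNIV \<times> I) w \<and>
     (\<forall>a b K. {a..b} \<subseteq> I \<and> compact K \<longrightarrow>
        (\<exists>C. AE s in lebesgue. s \<in> {a..b} \<longrightarrow>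
           set_integrable lebesgue K (\<lambda>y. (w (y, s))\<^sup>2) \<and>
           (LINT y:K|lebesgue. (w (y, s))\<^sup>2) \<le> C))"

text \<open>\<open>w \<in> L\<^sup>1\<^sub>l\<^sub>o\<^sub>c(I; W\<^sup>1\<^sup>,\<^sup>1\<^sub>l\<^sub>o\<^sub>c)\<close> with weak spatial partial derivatives \<open>g i\<close>,
  which are determined by \<open>w\<close> up to null sets.\<close>

definition L1_loc_W11_loc ::
  "real set \<Rightarrow> ((real ^ 'n::finite) \<times> real \<Rightarrow> real) \<Rightarrow> ('n \<Rightarrow> (real ^ 'n) \<times> real \<Rightarrow> real) \<Rightarrow> bool" where
  "L1_loc_W11_loc I w g \<longleftrightarrow>
     Lp_loc 1 (UNIV \<times> I) w \<and> (\<forall>i. Lp_loc 1 (UNIV \<times> I) (g i)) \<and>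
     (AE s in lebesgue. s \<in> I \<longrightarrow> (\<forall>i. has_weak_partial i (\<lambda>y. w (y, s)) (\<lambda>y. g i (y, s))))"

text \<open>\<open>C\<^sup>\<infinity>\<^sub>l\<^sub>o\<^sub>c(I; C\<^sub>c\<^sup>\<infinity>(\<real>\<^sup>N))\<close>: the spatial supports stay in one compact set for times in
  a compact subinterval of \<open>I\<close>.\<close>

definition test_functions :: "real set \<Rightarrow> ((real ^ 'n::finite) \<times> real \<Rightarrow> real) set" where
  "test_functions I = {\<phi>. smooth_on (UNIV \<times> I) \<phi> \<and>
     (\<forall>a b. {a..b} \<subseteq> I \<longrightarrow> (\<exists>K. compact K \<and> (\<forall>s\<in>{a..b}. \<forall>y. y \<notin> K \<longrightarrow> \<phi> (y, s) = 0)))}"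

definition fp_local_weak_solution ::
  "real ^ 'n::finite \<Rightarrow> real set \<Rightarrow> ((real ^ 'n) \<times> real \<Rightarrow> real) \<Rightarrow> bool" where
  "fp_local_weak_solution p I w \<longleftrightarrow>
     Linf_loc_L2_loc I w \<and>
     (\<exists>g. L1_loc_W11_loc I w g \<and>
        (\<forall>i. Lp_loc (p $ i) (UNIV \<times> I) (g i)) \<and>
        (AE (t1, t2) in lebesgue. t1 \<in> I \<and> t2 \<in> I \<and> t1 < t2 \<longrightarrow>
           (\<forall>\<phi>\<in>test_functions I.
              (LINT y|lebesgue. w (y, t2) * \<phi> (y, t2))
              - (LINT y|lebesgue. w (y, t1) * \<phi> (y, t1))
              + (LINT s:{t1..t2}|lebesgue. (LINT y|lebesgue.
                   - w (y, s) * frechet_derivative \<phi> (at (y, s)) (0, 1)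
                   + (\<Sum>i\<in>UNIV.
                        (\<bar>g i (y, s)\<bar> powr (p $ i - 2) * g i (y, s)
                          + fp_alpha_i p i * y $ i * w (y, s))
                        * frechet_derivative \<phi> (at (y, s)) (axis i 1, 0))))
              = 0)))"

definition fp_stationary_solution :: "real ^ 'n::finite \<Rightarrow> (real ^ 'n \<Rightarrow> real) \<Rightarrow> bool" where
  "fp_stationary_solution p w \<longleftrightarrow> fp_local_weak_solution p UNIV (\<lambda>(y, s). w y)"


subsection \<open>The class \<open>X\<^sub>1\<^sub>,\<^sub>1\<close> and Barenblatt solutions\<close>

text \<open>The support of a function defined up to null sets: the complement of the largest open
  set on which it vanishes almost everywhere.\<close>

definition ess_support :: "('a::euclidean_space \<Rightarrow> real) \<Rightarrow> 'a set" where
  "ess_support g = - \<Union> {U. open U \<and> (AE y in lebesgue. y \<in> U \<longrightarrow> g y = 0)}"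

definition K1 :: "(real ^ 'n::finite) set" where
  "K1 = {x. \<forall>i. \<bar>x $ i\<bar> \<le> 1 / 2}"

text \<open>Essential boundedness is implied by \<open>0 \<le> g \<le> 1\<close>.\<close>

definition X11 :: "(real ^ 'n::finite \<Rightarrow> real) set" where
  "X11 = {g. g \<in> borel_measurable lebesgue \<and>
             (AE y in lebesgue. 0 \<le> g y \<and> g y \<le> 1) \<and> ess_support g \<subseteq> K1}"

definition barenblatt :: "real ^ 'n::finite \<Rightarrow> (real ^ 'n \<Rightarrow> real) \<Rightarrow> real ^ 'n \<Rightarrow> real \<Rightarrow> real" where
  "barenblatt p w x t =
     t powr (- fp_alpha p) * w (\<chi> i. t powr (- fp_alpha_i p i) * x $ i)"

end

(* The theorem follows from: a stationary solution w is, up to null sets, even and nonincreasing in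
   each |y_i|, so that it exceeds a positive constant near 0 unless it vanishes; the Barenblatt
   solution is obtained from w by a diagonal scaling.

   Monotonicity is a moving plane argument. Let R be the reflection in y_i = t with t > 0, and
   H = {y_i < t}. Subtract the equation from its reflection and test with 1_H J'(w o R - w),
   where J is a smooth version of the positive part, zero below a small e > 0. The flux
   terms are nonnegative by monotonicity and the drift terms cancel as e -> 0 (J'(z) z is close to J(z)), apart from the contribution
   2 t alpha_i INT_H (d_i w)(R y) J'(w o R - w) caused by R moving the centre of the drift. This
   integral is half the t-derivative of M(t) = INT_H J(w o R - w), so that M is nondecreasing. As M
   vanishes at t = 1/2 by the support condition, M = 0, i.e. w o R <= w on H, for every t > 0.
   Since 1_H J'(w o R - w) is not an admissible test function, w is replaced by a mollification
   in it; the errors are controlled by the L^1 continuity of translations. *)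

theory Submission
  imports Defs "HOL-Computational_Algebra.Polynomial"
begin

subsection \<open>Smooth functions\<close>

text \<open>The order of the limits is forced. The threshold \<open>e\<close> of the smooth positive
  part is fixed first, then a bound \<open>L\<close> of its second derivative on [-1, 1], then the
  mollification error \<open>c\<close>, which \<open>L\<close> multiplies; the scale
  \<open>d\<close> comes last and has to serve all positions t at once. The delicate error is that
  of the flux: a power p - 1 of one gradient times the mollification error of another. L^1
  continuity of translations alone does not control it, because the power is unbounded; the integral
  is split by the size of the gradient, and the large part is absorbed by the integrability of its
  p-th power. The zero zone below \<open>e\<close> also makes the test function smooth: the
  reflected difference vanishes on the hyperplane, so the cut with 1_H happens where everything is
  already 0. Since w has no pointwise values, monotonicity is transferred to its mollification.
  There each point of a small box around 0 dominates all points that lie farther out in every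
  coordinate, hence the average of w over such points, and this average is positive for a suitable
  box.\<close>

lemma Ck_SucI:
  assumes "\<And>x. (f has_derivative D x) (at x)" and "\<And>v. Ck_on k UNIV (\<lambda>x. D x v)"
  shows "Ck_on (Suc k) UNIV f"
proof -
  have "frechet_derivative f (at x) = D x" for x
    using frechet_derivative_at[OF assms(1)] by simp
  then show ?thesis using assms by (auto simp: differentiable_def)
qed

lemma Ck_SucD:
  assumes "Ck_on (Suc k) UNIV f"
  shows "(f has_derivative frechet_derivative f (at x)) (at x)"
    and "Ck_on k UNIV (\<lambda>x. frechet_derivative f (at x) v)"
  using assms unfolding Ck_on.simps frechet_derivative_works by simp_all

lemma Ck_Suc_imp_continuous: "Ck_on (Suc k) UNIV f \<Longrightarrow> continuous_on UNIV f"
  by (intro continuous_at_imp_continuous_on ballI has_derivative_continuous[OF Ck_SucD(1)])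

lemma Ck_Suc_imp: "Ck_on (Suc k) UNIV f \<Longrightarrow> Ck_on k UNIV f"
proof (induction k arbitrary: f)
  case 0
  then show ?case using Ck_Suc_imp_continuous by (metis Ck_on.simps(1))
next
  case (Suc k)
  show ?case
    by (rule Ck_SucI[OF Ck_SucD(1)[OF Suc.prems] Suc.IH[OF Ck_SucD(2)[OF Suc.prems]]])
qed

lemma Ck_const: "Ck_on k UNIV (\<lambda>x. c)"
proof (induction k arbitrary: c)
  case (Suc k)
  show ?case by (rule Ck_SucI[where D = "\<lambda>x v. 0"]) (auto intro: Suc)
qed auto

lemma Ck_add: "Ck_on k UNIV f \<Longrightarrow> Ck_on k UNIV g \<Longrightarrow> Ck_on k UNIV (\<lambda>x. f x + g x)"
proof (induction k arbitrary: f g)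
  case (Suc k)
  show ?case
    by (rule Ck_SucI[OF has_derivative_add[OF Ck_SucD(1)[OF Suc.prems(1)] Ck_SucD(1)[OF Suc.prems(2)]]])
      (intro Suc.IH Ck_SucD(2) Suc.prems)
qed (simp add: continuous_on_add)

lemma Ck_mult: "Ck_on k UNIV f \<Longrightarrow> Ck_on k UNIV g \<Longrightarrow> Ck_on k UNIV (\<lambda>x. f x * g x)"
proof (induction k arbitrary: f g)
  case (Suc k)
  show ?case
    by (rule Ck_SucI[OF has_derivative_mult[OF Ck_SucD(1)[OF Suc.prems(1)] Ck_SucD(1)[OF Suc.prems(2)]]])
      (intro Ck_add Suc.IH Ck_SucD(2)[OF Suc.prems(1)] Ck_SucD(2)[OF Suc.prems(2)]
        Ck_Suc_imp[OF Suc.prems(1)] Ck_Suc_imp[OF Suc.prems(2)])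
qed (simp add: continuous_on_mult)

lemma Ck_prod: "finite I \<Longrightarrow> (\<And>i. i \<in> I \<Longrightarrow> Ck_on k UNIV (f i)) \<Longrightarrow> Ck_on k UNIV (\<lambda>x. \<Prod>i\<in>I. f i x)"
  by (induction I rule: finite_induct) (auto intro: Ck_const Ck_mult)

lemma Ck_linear:
  assumes "bounded_linear L"
  shows "Ck_on k UNIV L"
proof (cases k)
  case 0
  then show ?thesis using bounded_linear.continuous_on[OF assms continuous_on_id] by simp
next
  case (Suc k)
  then show ?thesis
    using Ck_SucI[OF bounded_linear_imp_has_derivative[OF assms] Ck_const] by blast
qed

lemma Ck_affine_comp:
  assumes "bounded_linear L"
  shows "Ck_on k UNIV f \<Longrightarrow> Ck_on k UNIV (\<lambda>x. f (L x + b))"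
proof (induction k arbitrary: f)
  case 0
  have "continuous_on UNIV (\<lambda>x. L x + b)"
    by (intro continuous_on_add bounded_linear.continuous_on[OF assms] continuous_on_id continuous_on_const)
  with 0 show ?case
    using continuous_on_compose2[of UNIV f UNIV "\<lambda>x. L x + b"] by simp
next
  case (Suc k)
  have "((\<lambda>x. f (L x + b)) has_derivative (\<lambda>v. frechet_derivative f (at (L x + b)) (L v))) (at x)" for x
    using has_derivative_compose[OF has_derivative_add_const[OF bounded_linear_imp_has_derivative[OF assms]]
        Ck_SucD(1)[OF Suc.prems]] by simp
  then show ?case by (rule Ck_SucI) (intro Suc.IH Ck_SucD(2) Suc.prems)
qed

lemma Ck_component: "Ck_on k UNIV (\<lambda>x. x $ i :: real)"
  by (intro Ck_linear bounded_linear_vec_nth)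

subsection \<open>The flat function\<close>

text \<open>With q = 1 this is the classical flat function exp(-1/x). The polynomial factor makes
  the class closed under differentiation, so that smoothness is a single induction over all
  q.\<close>

definition flat :: "real poly \<Rightarrow> real \<Rightarrow> real" where
  "flat q x = (if x > 0 then exp (- (1 / x)) * poly q (1 / x) else 0)"

lemma exp_minus_poly_tendsto_0: "((\<lambda>u. exp (- u) * poly q u) \<longlongrightarrow> (0::real)) at_top"
proof -
  have "((\<lambda>u. \<Sum>i\<le>degree q. coeff q i * (u ^ i / exp u)) \<longlongrightarrow> (\<Sum>i\<le>degree q. coeff q i * (0::real))) at_top"
    by (intro tendsto_intros tendsto_power_div_exp_0)
  then show ?thesis
    by (simp add: poly_altdef exp_minus sum_distrib_left divide_simps mult_ac)
qed

text \<open>With u = 1/x, du/dx = -u^2 turns exp(-u) q(u) into exp(-u) u^2 (q - q')(u). At 0 the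
  right difference quotient is exp(-u) u q(u), which tends to 0 as u grows; u q(u) is
  \<open>pCons 0 q\<close>.\<close>

lemma flat_DERIV: "(flat q has_real_derivative flat ([:0, 0, 1:] * (q - pderiv q)) x) (at x)"
proof (cases "x = 0")
  case False
  show ?thesis
  proof (cases "x > 0")
    case True
    have inv: "((\<lambda>x. 1 / x) has_real_derivative - ((1 / x) * (1 / x))) (at x)"
      using DERIV_inverse[of x] True by (simp add: inverse_eq_divide power2_eq_square)
    have "((\<lambda>x. exp (- (1 / x)) * poly q (1 / x)) has_real_derivative
        exp (- (1 / x)) * (1 / x * (1 / x)) * poly q (1 / x)
        + poly (pderiv q) (1 / x) * - ((1 / x) * (1 / x)) * exp (- (1 / x))) (at x)"
      by (rule DERIV_mult[OF _ DERIV_chain2[OF poly_DERIV inv]])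
        (use DERIV_chain2[OF DERIV_exp DERIV_minus[OF inv]] in simp)
    moreover have "exp (- (1 / x)) * (1 / x * (1 / x)) * poly q (1 / x)
        + poly (pderiv q) (1 / x) * - ((1 / x) * (1 / x)) * exp (- (1 / x))
        = flat ([:0, 0, 1:] * (q - pderiv q)) x"
      using True unfolding flat_def poly_mult poly_diff by (simp add: algebra_simps)
    ultimately have "((\<lambda>x. exp (- (1 / x)) * poly q (1 / x)) has_real_derivative
            flat ([:0, 0, 1:] * (q - pderiv q)) x) (at x)" by simp
    then show ?thesis
      by (rule has_field_derivative_transform_within_open[where S = "{0<..}"])
        (use True in \<open>auto simp: flat_def\<close>)
  next
    case neg: False
    have "flat ([:0, 0, 1:] * (q - pderiv q)) x = 0"
      using neg by (simp add: flat_def)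
    moreover have "(flat q has_real_derivative 0) (at x)"
      by (rule has_field_derivative_transform_within_open[where S = "{..<0}" and f = "\<lambda>_. 0"])
        (use neg False in \<open>auto simp: flat_def\<close>)
    ultimately show ?thesis by simp
  qed
next
  case True
  have "((\<lambda>h. flat q h / h) \<longlongrightarrow> 0) (at_right 0)"
  proof -
    have "((\<lambda>h. exp (- inverse h) * poly (pCons 0 q) (inverse h)) \<longlongrightarrow> 0) (at_right (0::real))"
      by (rule filterlim_compose[OF exp_minus_poly_tendsto_0 filterlim_inverse_at_top_right])
    then show ?thesis
      by (rule Lim_transform_eventually)
        (auto simp: flat_def eventually_at_filter inverse_eq_divide)
  qed
  moreover have "((\<lambda>h. flat q h / h) \<longlongrightarrow> 0) (at_left 0)"
    by (rule tendsto_eventually) (auto simp: flat_def eventually_at_filter)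
  ultimately have "((\<lambda>h. flat q h / h) \<longlongrightarrow> 0) (at 0)"
    by (simp add: filterlim_at_split)
  then show ?thesis
    using True by (simp add: DERIV_def flat_def[of _ 0])
qed

lemma flat_nonpos [simp]: "x \<le> 0 \<Longrightarrow> flat q x = 0"
  by (simp add: flat_def)

lemma flat_continuous: "continuous_on S (flat q)"
  by (intro continuous_at_imp_continuous_on ballI DERIV_isCont[OF flat_DERIV])

lemma Ck_flat: "Ck_on k UNIV g \<Longrightarrow> Ck_on k UNIV (\<lambda>x. flat q (g x))"
proof (induction k arbitrary: q)
  case 0
  then show ?case
    by (auto intro!: continuous_on_compose2[OF flat_continuous])
next
  case (Suc k)
  let ?q = "[:0, 0, 1:] * (q - pderiv q)"
  have "((\<lambda>x. flat q (g x)) has_derivative (\<lambda>v. flat ?q (g x) * frechet_derivative g (at x) v)) (at x)" for x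
    using has_derivative_compose[OF Ck_SucD(1)[OF Suc.prems]
        flat_DERIV[unfolded has_field_derivative_def]] .
  then show ?case by (rule Ck_SucI) (intro Ck_mult Suc.IH Ck_SucD(2)[OF Suc.prems] Ck_Suc_imp[OF Suc.prems])
qed

text \<open>Near the hyperplane f vanishes identically, so the jump of the indicator is never seen;
  elsewhere the function is locally f or 0.\<close>

lemma has_derivative_cutoff_halfspace:
  fixes f :: "real ^ 'n::finite \<Rightarrow> real"
  assumes "open U" and "{x. x $ i = t} \<subseteq> U" and "\<And>x. x \<in> U \<Longrightarrow> f x = 0" and f: "(f has_derivative f') (at x)"
  shows "((\<lambda>x. if x $ i < t then f x else 0) has_derivative (\<lambda>v. if x $ i < t then f' v else 0)) (at x)"
    (is "(?f has_derivative _) _")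
proof -
  consider "x $ i < t" | "x $ i > t" | "x $ i = t" by linarith
  then show ?thesis
  proof cases
    case 1
    have "(?f has_derivative f') (at x)"
      by (rule has_derivative_transform_within_open[of f _ _ _ "{x. x $ i < t}"])
        (use 1 f in \<open>auto intro!: open_Collect_less continuous_intros\<close>)
    then show ?thesis using 1 by simp
  next
    case 2
    have "(?f has_derivative (\<lambda>v. 0)) (at x)"
      by (rule has_derivative_transform_within_open[of "\<lambda>x. 0" _ _ _ "{x. t < x $ i}"])
        (use 2 in \<open>auto intro!: open_Collect_less continuous_intros\<close>)
    then show ?thesis using 2 by simp
  next
    case 3
    have "(?f has_derivative (\<lambda>v. 0)) (at x)"
      by (rule has_derivative_transform_within_open[of "\<lambda>x. 0" _ _ _ U])
        (use 3 assms in auto)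
    then show ?thesis using 3 by simp
  qed
qed

lemma Ck_cutoff_halfspace:
  fixes f :: "real ^ 'n::finite \<Rightarrow> real"
  assumes "open U" and "{x. x $ i = t} \<subseteq> U"
  shows "Ck_on k UNIV f \<Longrightarrow> (\<And>x. x \<in> U \<Longrightarrow> f x = 0) \<Longrightarrow> Ck_on k UNIV (\<lambda>x. if x $ i < t then f x else 0)"
proof (induction k arbitrary: f)
  case 0
  have "continuous_on ({x. x $ i \<le> t} \<union> {x. x $ i \<ge> t}) (\<lambda>x. if x $ i < t then f x else 0)"
  proof (rule continuous_on_closed_Un)
    show "continuous_on {x. x $ i \<le> t} (\<lambda>x. if x $ i < t then f x else 0)"
      by (rule continuous_on_eq[of _ f])
        (use 0 assms in \<open>auto intro: continuous_on_subset\<close>)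
    show "continuous_on {x. x $ i \<ge> t} (\<lambda>x. if x $ i < t then f x else 0)"
      by (rule continuous_on_eq[of _ "\<lambda>x. 0"]) auto
  qed (auto intro!: closed_Collect_le continuous_intros)
  moreover have "{x. x $ i \<le> t} \<union> {x. x $ i \<ge> t} = UNIV" by auto
  ultimately show ?case by simp
next
  case (Suc k)
  \<comment> \<open>The derivative vanishes on the same open set U, so the induction hypothesis
    applies to it.\<close>
  have fU: "frechet_derivative f (at x) = (\<lambda>v. 0)" if "x \<in> U" for x
  proof -
    have "(f has_derivative (\<lambda>v. 0)) (at x)"
      by (rule has_derivative_transform_within_open[of "\<lambda>x. 0" _ _ _ U])
        (use that assms Suc.prems in auto)
    from frechet_derivative_at[OF this] show ?thesis by simp
  qed
  have "Ck_on k UNIV (\<lambda>x. if x $ i < t then frechet_derivative f (at x) v else 0)" for v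
    by (rule Suc.IH[OF Ck_SucD(2)[OF Suc.prems(1)]]) (simp add: fU)
  with has_derivative_cutoff_halfspace[OF assms Suc.prems(2) Ck_SucD(1)[OF Suc.prems(1)]]
  show ?case by (rule Ck_SucI)
qed

subsection \<open>Compactly supported smooth functions\<close>

lemma Cc_infinityI:
  assumes "\<And>k. Ck_on k UNIV \<phi>" and "bounded S" and "\<And>x. x \<notin> S \<Longrightarrow> \<phi> x = 0"
  shows "\<phi> \<in> Cc_infinity"
proof -
  have "bounded {x. \<phi> x \<noteq> 0}" using assms(2,3) by (auto intro: bounded_subset)
  then show ?thesis using assms(1) by (simp add: Cc_infinity_def smooth_on_def compact_closure)
qed

lemma Cc_infinity_Ck: "\<phi> \<in> Cc_infinity \<Longrightarrow> Ck_on k UNIV \<phi>"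
  by (simp add: Cc_infinity_def smooth_on_def)

lemma Cc_infinity_bounded_support: "\<phi> \<in> Cc_infinity \<Longrightarrow> bounded {x. \<phi> x \<noteq> 0}"
  by (simp add: Cc_infinity_def compact_closure)

lemma Cc_infinity_has_derivative:
  "\<phi> \<in> Cc_infinity \<Longrightarrow> (\<phi> has_derivative frechet_derivative \<phi> (at x)) (at x)"
  by (rule Ck_SucD(1)[OF Cc_infinity_Ck])

lemma Cc_infinity_continuous: "\<phi> \<in> Cc_infinity \<Longrightarrow> continuous_on S \<phi>"
  by (rule continuous_on_subset[OF Ck_Suc_imp_continuous[OF Cc_infinity_Ck]]) auto

lemma frechet_derivative_outside_support:
  assumes "x \<notin> closure {x. \<phi> x \<noteq> 0}"
  shows "frechet_derivative \<phi> (at x) = (\<lambda>v. 0)"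
proof -
  have "(\<phi> has_derivative (\<lambda>v. 0)) (at x)"
    by (rule has_derivative_transform_within_open[of "\<lambda>x. 0" _ _ _ "- closure {x. \<phi> x \<noteq> 0}"])
      (use assms closure_subset[of "{x. \<phi> x \<noteq> 0}"] in auto)
  from frechet_derivative_at[OF this] show ?thesis by simp
qed

lemma Cc_infinity_derivative:
  assumes "\<phi> \<in> Cc_infinity"
  shows "(\<lambda>x. frechet_derivative \<phi> (at x) v) \<in> Cc_infinity"
proof (rule Cc_infinityI)
  show "Ck_on k UNIV (\<lambda>x. frechet_derivative \<phi> (at x) v)" for k
    by (rule Ck_SucD(2)[OF Cc_infinity_Ck[OF assms]])
  show "bounded (closure {x. \<phi> x \<noteq> 0})"
    using Cc_infinity_bounded_support[OF assms] by (rule bounded_closure)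
qed (simp add: frechet_derivative_outside_support)

lemma bounded_support_bounded_range:
  fixes \<phi> :: "'a::euclidean_space \<Rightarrow> real"
  assumes "continuous_on UNIV \<phi>" and "bounded S" and "\<And>x. x \<notin> S \<Longrightarrow> \<phi> x = 0"
  obtains B where "B \<ge> 0" and "\<And>x. \<bar>\<phi> x\<bar> \<le> B"
proof -
  have "compact (\<phi> ` closure S)"
    using assms by (intro compact_continuous_image) (auto intro: continuous_on_subset simp: compact_closure)
  then obtain B where B: "\<forall>y\<in>\<phi> ` closure S. \<bar>y\<bar> \<le> B"
    using compact_imp_bounded[THEN iffD1[OF bounded_real]] by blast
  have "\<bar>\<phi> x\<bar> \<le> max B 0" for x
  proof (cases "x \<in> S")
    case True
    then have "\<phi> x \<in> \<phi> ` closure S" using closure_subset[of S] by blast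
    from bspec[OF B this] show ?thesis by simp
  qed (simp add: assms(3))
  then show ?thesis using that[of "max B 0"] by simp
qed

lemma bounded_support_integrable:
  fixes \<phi> :: "'a::euclidean_space \<Rightarrow> real"
  assumes "\<phi> \<in> borel_measurable borel" and "\<And>x. \<bar>\<phi> x\<bar> \<le> B" and "bounded S" and "\<And>x. x \<notin> S \<Longrightarrow> \<phi> x = 0"
  shows "integrable lborel \<phi>"
proof -
  obtain a b where ab: "S \<subseteq> cbox a b"
    using bounded_subset_cbox_symmetric[OF assms(3)] by blast
  have "integrable lborel (\<lambda>x. indicator (cbox a b) x *\<^sub>R B)"
    by (intro integrable_real_indicator integrable_scaleR_left) (auto simp: emeasure_lborel_cbox_eq)
  then show ?thesis
    by (rule Bochner_Integration.integrable_bound)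
      (use assms(1,4) ab order.trans[OF assms(2) abs_ge_self] in \<open>auto simp: indicator_def intro!: AE_I2\<close>)
qed

lemma continuous_bounded_support_integrable:
  fixes \<phi> :: "'a::euclidean_space \<Rightarrow> real"
  assumes "continuous_on UNIV \<phi>" and "bounded S" and "\<And>x. x \<notin> S \<Longrightarrow> \<phi> x = 0"
  shows "integrable lborel \<phi>"
proof -
  obtain B where "\<And>x. \<bar>\<phi> x\<bar> \<le> B"
    using bounded_support_bounded_range[OF assms] by metis
  then show ?thesis
    using assms by (intro bounded_support_integrable[of \<phi> B S] borel_measurable_continuous_onI)
qed

lemma Cc_infinity_bounded:
  assumes "\<phi> \<in> Cc_infinity"
  obtains B where "B \<ge> 0" and "\<And>x. \<bar>\<phi> x\<bar> \<le> B"
  by (rule bounded_support_bounded_range[OF Cc_infinity_continuous[OF assms] Cc_infinity_bounded_support[OF assms]])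
    auto

lemma Cc_infinity_measurable [measurable_dest]: "\<phi> \<in> Cc_infinity \<Longrightarrow> \<phi> \<in> borel_measurable borel"
  by (intro borel_measurable_continuous_onI Cc_infinity_continuous)

lemma Cc_infinity_integrable: "\<phi> \<in> Cc_infinity \<Longrightarrow> integrable lborel \<phi>"
  by (rule continuous_bounded_support_integrable[OF Cc_infinity_continuous Cc_infinity_bounded_support]) auto

lemma integrable_mult_Cc_infinity:
  assumes "integrable lborel u" and "\<phi> \<in> Cc_infinity"
  shows "integrable lborel (\<lambda>y. u y * \<phi> y)"
proof -
  obtain B where B: "B \<ge> 0" "\<And>x. \<bar>\<phi> x\<bar> \<le> B"
    using Cc_infinity_bounded[OF assms(2)] by metis
  have "integrable lborel (\<lambda>y. B * u y)" using assms(1) by simp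
  then show ?thesis
  proof (rule Bochner_Integration.integrable_bound)
    show "(\<lambda>y. u y * \<phi> y) \<in> borel_measurable lborel"
      using assms Cc_infinity_measurable[OF assms(2)] by (simp add: borel_measurable_integrable)
    have "norm (u y * \<phi> y) \<le> norm (B * u y)" for y
      using mult_right_mono[OF B(2)[of y] abs_ge_zero[of "u y"]] B(1) by (simp add: abs_mult mult.commute)
    then show "AE y in lborel. norm (u y * \<phi> y) \<le> norm (B * u y)" by simp
  qed
qed

lemma Cc_infinity_uniformly_continuous:
  fixes \<phi> :: "'a::euclidean_space \<Rightarrow> real"
  assumes "\<phi> \<in> Cc_infinity" and "e > 0"
  obtains d where "d > 0" and "\<And>x y. dist x y < d \<Longrightarrow> \<bar>\<phi> x - \<phi> y\<bar> < e"
proof -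
  obtain B where B: "{x. \<phi> x \<noteq> 0} \<subseteq> cball 0 B"
    using Cc_infinity_bounded_support[OF assms(1)] unfolding bounded_any_center[of _ 0]
    by (metis mem_cball subsetI)
  have "uniformly_continuous_on (cball 0 (B + 1)) \<phi>"
    by (intro compact_uniformly_continuous Cc_infinity_continuous assms compact_cball)
  then obtain d where d: "d > 0"
    "\<And>x y. x \<in> cball 0 (B + 1) \<Longrightarrow> y \<in> cball 0 (B + 1) \<Longrightarrow> dist y x < d \<Longrightarrow> dist (\<phi> y) (\<phi> x) < e"
    unfolding uniformly_continuous_on_def using assms(2) by metis
  \<comment> \<open>The cap 1 on the distance: if one of the points leaves the ball of radius B + 1,
    both lie outside the support.\<close>
  have "\<bar>\<phi> x - \<phi> y\<bar> < e" if xy: "dist x y < min d 1" for x y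
  proof (cases "norm x \<le> B + 1 \<and> norm y \<le> B + 1")
    case True
    then show ?thesis using d(2)[of y x] xy by (simp add: dist_real_def)
  next
    case False
    have "\<bar>norm x - norm y\<bar> < 1" using xy norm_triangle_ineq3[of x y] by (simp add: dist_norm)
    then have "norm x > B" "norm y > B" using False by linarith+
    then have "\<phi> x = 0" "\<phi> y = 0" using B by force+
    then show ?thesis using assms by simp
  qed
  then show ?thesis using that[of "min d 1"] d(1) by simp
qed

text \<open>By the mean value theorem the remainder is a change of the derivative along a segment,
  applied to h; expanded in the basis, each coordinate contributes at most
  \<open>norm h * e'\<close>. The uniformity in x allows differentiating a convolution with a merely
  integrable function.\<close>

lemma Cc_infinity_uniformly_differentiable:
  fixes \<phi> :: "'a::euclidean_space \<Rightarrow> real"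
  assumes "\<phi> \<in> Cc_infinity" and "e > 0"
  obtains d where "d > 0"
    and "\<And>x h. norm h < d \<Longrightarrow> \<bar>\<phi> (x + h) - \<phi> x - frechet_derivative \<phi> (at x) h\<bar> \<le> e * norm h"
proof -
  let ?D = "\<lambda>x. frechet_derivative \<phi> (at x)"
  define e' where "e' = e / DIM('a)"
  have e': "e' > 0" using assms(2) by (simp add: e'_def)
  have "\<exists>d>0. \<forall>x y. dist x y < d \<longrightarrow> \<bar>?D x b - ?D y b\<bar> < e'" for b
    using Cc_infinity_uniformly_continuous[OF Cc_infinity_derivative[OF assms(1), of b] e'] by metis
  then obtain d where d: "\<And>b. d b > 0" "\<And>b x y. dist x y < d b \<Longrightarrow> \<bar>?D x b - ?D y b\<bar> < e'"
    by metis
  define r where "r = Min (d ` (Basis :: 'a set))"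
  have r: "r > 0" "\<And>b. b \<in> Basis \<Longrightarrow> r \<le> d b"
    using d(1) by (auto simp: r_def)
  have lin: "linear (?D x)" for x
    using Cc_infinity_has_derivative[OF assms(1)] has_derivative_linear by blast
  have "\<bar>\<phi> (x + h) - \<phi> x - ?D x h\<bar> \<le> e * norm h" if h: "norm h < r" for x h
  proof -
    have der: "((\<lambda>t. \<phi> (x + t *\<^sub>R h)) has_derivative (\<lambda>s. ?D (x + t *\<^sub>R h) (s *\<^sub>R h))) (at t)" for t
      by (rule has_derivative_compose[OF _ Cc_infinity_has_derivative[OF assms(1)]])
        (auto intro!: derivative_eq_intros)
    have "\<exists>t\<in>{0<..<1}. \<phi> (x + 1 *\<^sub>R h) - \<phi> (x + 0 *\<^sub>R h) = ?D (x + t *\<^sub>R h) ((1 - 0) *\<^sub>R h)"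
      by (rule mvt_simple[where f = "\<lambda>t. \<phi> (x + t *\<^sub>R h)" and f' = "\<lambda>t s. ?D (x + t *\<^sub>R h) (s *\<^sub>R h)"])
        (auto intro: has_derivative_at_withinI[OF der])
    then obtain t where t: "0 < t" "t < 1" "\<phi> (x + h) - \<phi> x = ?D (x + t *\<^sub>R h) h"
      by auto
    have rep: "?D y h = (\<Sum>b\<in>Basis. (h \<bullet> b) * ?D y b)" for y
    proof -
      have "?D y h = ?D y (\<Sum>b\<in>Basis. (h \<bullet> b) *\<^sub>R b)" by (simp add: euclidean_representation)
      also have "\<dots> = (\<Sum>b\<in>Basis. (h \<bullet> b) *\<^sub>R ?D y b)"
        using lin[of y] by (simp add: linear_sum linear_cmul)
      finally show ?thesis by simp
    qed
    have "\<bar>?D (x + t *\<^sub>R h) b - ?D x b\<bar> \<le> e'" if "b \<in> Basis" for b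
    proof -
      have "dist (x + t *\<^sub>R h) x < d b"
      proof -
        have "t * norm h \<le> 1 * norm h" using t by (intro mult_right_mono) auto
        then show ?thesis using h r(2)[OF that] t by (simp add: dist_norm)
      qed
      then show ?thesis using d(2) by (simp add: less_imp_le)
    qed
    then have "\<bar>(h \<bullet> b) * (?D (x + t *\<^sub>R h) b - ?D x b)\<bar> \<le> norm h * e'" if "b \<in> Basis" for b
      unfolding abs_mult using that Basis_le_norm[OF that, of h] by (intro mult_mono) auto
    then have "\<bar>\<Sum>b\<in>Basis. (h \<bullet> b) * (?D (x + t *\<^sub>R h) b - ?D x b)\<bar> \<le> (\<Sum>b\<in>(Basis::'a set). norm h * e')"
      by (intro order.trans[OF sum_abs] sum_mono) auto
    also have "\<dots> = e * norm h" by (simp add: e'_def)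
    finally show ?thesis
      by (simp add: t(3) rep sum_subtractf right_diff_distrib)
  qed
  then show ?thesis using that[OF r(1)] by blast
qed

subsection \<open>Convolution with a smooth kernel\<close>

definition mol :: "('a::euclidean_space \<Rightarrow> real) \<Rightarrow> ('a \<Rightarrow> real) \<Rightarrow> 'a \<Rightarrow> real" where
  "mol \<psi> u x = (\<integral>y. u y * \<psi> (x - y) \<partial>lborel)"

lemma Cc_infinity_reflect:
  assumes "\<psi> \<in> Cc_infinity"
  shows "(\<lambda>y. \<psi> (x - y)) \<in> Cc_infinity"
proof (rule Cc_infinityI)
  show "Ck_on k UNIV (\<lambda>y. \<psi> (x - y))" for k
    using Ck_affine_comp[OF bounded_linear_minus[OF bounded_linear_ident] Cc_infinity_Ck[OF assms], of k x]
    by simp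
  show "bounded ((\<lambda>y. x - y) ` {y. \<psi> y \<noteq> 0})"
    using bounded_translation[OF bounded_uminus[THEN iffD2, OF Cc_infinity_bounded_support[OF assms]], of x]
    by (simp add: image_image)
  show "\<psi> (x - y) = 0" if "y \<notin> (\<lambda>y. x - y) ` {y. \<psi> y \<noteq> 0}" for y
  proof (rule ccontr)
    assume "\<psi> (x - y) \<noteq> 0"
    then have "x - (x - y) \<in> (\<lambda>y. x - y) ` {y. \<psi> y \<noteq> 0}" by blast
    then show False using that by simp
  qed
qed

lemma mol_integrable:
  assumes "integrable lborel u" and "\<psi> \<in> Cc_infinity"
  shows "integrable lborel (\<lambda>y. u y * \<psi> (x - y))"
  by (rule integrable_mult_Cc_infinity[OF assms(1) Cc_infinity_reflect[OF assms(2)]])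

text \<open>The derivative falls on the kernel: its first-order remainder is small uniformly in the
  point, and integrating it against |u| costs the factor \<open>I\<close>, the L^1 norm of
  u.\<close>

lemma mol_has_derivative:
  assumes u: "integrable lborel u" and \<psi>: "\<psi> \<in> Cc_infinity"
  shows "(mol \<psi> u has_derivative (\<lambda>v. mol (\<lambda>z. frechet_derivative \<psi> (at z) v) u x)) (at x)"
proof -
  let ?D = "\<lambda>z. frechet_derivative \<psi> (at z)"
  have lin: "linear (?D x)" for x
    using Cc_infinity_has_derivative[OF \<psi>] has_derivative_linear by blast
  have int: "integrable lborel (\<lambda>y. u y * ?D (x - y) v)" for x v
    by (rule mol_integrable[OF u Cc_infinity_derivative[OF \<psi>]])
  have "linear (\<lambda>v. mol (\<lambda>z. ?D z v) u x)"
  proof (rule linearI)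
    show "mol (\<lambda>z. ?D z (a + b)) u x = mol (\<lambda>z. ?D z a) u x + mol (\<lambda>z. ?D z b) u x" for a b
      unfolding mol_def using int[of x a] int[of x b]
      by (subst Bochner_Integration.integral_add[symmetric])
        (auto simp: linear_add[OF lin] distrib_left)
    show "mol (\<lambda>z. ?D z (c *\<^sub>R a)) u x = c *\<^sub>R mol (\<lambda>z. ?D z a) u x" for c a
      unfolding mol_def by (simp add: linear_cmul[OF lin] mult.left_commute)
  qed
  then have bl: "bounded_linear (\<lambda>v. mol (\<lambda>z. ?D z v) u x)"
    by (simp add: linear_conv_bounded_linear)
  have "\<exists>d>0. \<forall>y. norm (y - x) < d \<longrightarrow>
      norm (mol \<psi> u y - mol \<psi> u x - mol (\<lambda>z. ?D z (y - x)) u x) \<le> e * norm (y - x)" if e: "e > 0" for e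
  proof -
    define I where "I = (\<integral>y. \<bar>u y\<bar> \<partial>lborel)"
    have I: "I \<ge> 0" by (simp add: I_def)
    \<comment> \<open>I + 1 rather than I, since u may vanish.\<close>
    define e' where "e' = e / (I + 1)"
    have e': "e' > 0" using e I by (simp add: e'_def)
    obtain d where d: "d > 0"
      "\<And>x h. norm h < d \<Longrightarrow> \<bar>\<psi> (x + h) - \<psi> x - ?D x h\<bar> \<le> e' * norm h"
      using Cc_infinity_uniformly_differentiable[OF \<psi> e'] by metis
    have "norm (mol \<psi> u y - mol \<psi> u x - mol (\<lambda>z. ?D z (y - x)) u x) \<le> e * norm (y - x)"
      if y: "norm (y - x) < d" for y
    proof -
      define h where "h = y - x"
      have y_eq: "y - z = (x - z) + h" for z by (simp add: h_def)
      have i1: "integrable lborel (\<lambda>z. u z * \<psi> (y - z) - u z * \<psi> (x - z))"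
        by (intro Bochner_Integration.integrable_diff mol_integrable u \<psi>)
      have "mol \<psi> u y - mol \<psi> u x - mol (\<lambda>z. ?D z h) u x
          = (\<integral>z. (u z * \<psi> (y - z) - u z * \<psi> (x - z)) - u z * ?D (x - z) h \<partial>lborel)"
        unfolding mol_def
        by (simp add: Bochner_Integration.integral_diff i1 int mol_integrable u \<psi>)
      also have "\<dots> = (\<integral>z. u z * (\<psi> (y - z) - \<psi> (x - z) - ?D (x - z) h) \<partial>lborel)"
        by (intro Bochner_Integration.integral_cong) (auto simp: algebra_simps)
      also have "norm \<dots> \<le> (\<integral>z. \<bar>u z\<bar> * (e' * norm h) \<partial>lborel)"
      proof (rule Bochner_Integration.integral_norm_bound_integral)
        show "integrable lborel (\<lambda>z. u z * (\<psi> (y - z) - \<psi> (x - z) - ?D (x - z) h))"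
          using Bochner_Integration.integrable_diff[OF i1 int[of x h]]
          by (rule Bochner_Integration.integrable_cong[THEN iffD1, rotated -1]) (auto simp: algebra_simps)
        show "integrable lborel (\<lambda>z. \<bar>u z\<bar> * (e' * norm h))" using u by auto
        show "norm (u z * (\<psi> (y - z) - \<psi> (x - z) - ?D (x - z) h)) \<le> \<bar>u z\<bar> * (e' * norm h)" for z
          unfolding real_norm_def abs_mult y_eq using d(2)[of h "x - z"] y
          by (intro mult_left_mono) (auto simp: h_def)
      qed
      also have "\<dots> = I * (e' * norm h)" by (simp add: I_def)
      also have "\<dots> = (I * e') * norm h" by simp
      also have "\<dots> \<le> e * norm h"
        using e I by (intro mult_right_mono) (auto simp: e'_def field_simps)
      finally show ?thesis by (simp add: h_def)
    qed
    then show ?thesis using d(1) by blast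
  qed
  then show ?thesis unfolding has_derivative_at_alt using bl by blast
qed

lemma mol_Ck:
  assumes u: "integrable lborel u"
  shows "\<psi> \<in> Cc_infinity \<Longrightarrow> Ck_on k UNIV (mol \<psi> u)"
proof (induction k arbitrary: \<psi>)
  case 0
  then show ?case
    using has_derivative_continuous[OF mol_has_derivative[OF u]]
    by (simp add: continuous_at_imp_continuous_on)
next
  case (Suc k)
  show ?case
    by (rule Ck_SucI[OF mol_has_derivative[OF u Suc.prems] Suc.IH[OF Cc_infinity_derivative[OF Suc.prems]]])
qed

subsection \<open>Measure-preserving maps and continuity of translations\<close>

text \<open>One predicate for translations, point reflections, hyperplane reflections and the
  identity, so that the weighted estimates below can be uniform over all such maps.\<close>

definition lborel_preserving :: "('a::euclidean_space \<Rightarrow> 'a) \<Rightarrow> bool" where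
  "lborel_preserving T \<longleftrightarrow> T \<in> borel_measurable borel \<and> distr lborel borel T = lborel"

lemma
  fixes f :: "'a::euclidean_space \<Rightarrow> real"
  assumes "lborel_preserving T" and f: "f \<in> borel_measurable borel"
  shows preserving_integrable: "integrable lborel (\<lambda>x. f (T x)) \<longleftrightarrow> integrable lborel f"
    and preserving_integral: "(\<integral>x. f (T x) \<partial>lborel) = (\<integral>x. f x \<partial>lborel)"
proof -
  have T: "T \<in> lborel \<rightarrow>\<^sub>M borel" "distr lborel borel T = lborel"
    using assms by (auto simp: lborel_preserving_def)
  show "integrable lborel (\<lambda>x. f (T x)) \<longleftrightarrow> integrable lborel f"
    using integrable_distr_eq[OF T(1) f] T(2) by simp
  show "(\<integral>x. f (T x) \<partial>lborel) = (\<integral>x. f x \<partial>lborel)"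
    using integral_distr[OF T(1) f] T(2) by simp
qed

lemma preserving_translation: "lborel_preserving (\<lambda>x::'a::euclidean_space. x - u)"
proof -
  have "((+) (- u)) = (\<lambda>x. x - u)" by auto
  then show ?thesis using lborel_distr_plus[of "- u"] by (simp add: lborel_preserving_def)
qed

lemma preserving_point_reflection: "lborel_preserving (\<lambda>x::'a::euclidean_space. u - x)"
  using lborel_affine[of "- 1" u]
  by (simp add: lborel_preserving_def density_1)

text \<open>A is squeezed between a compact K and an open U with U - K small. A shift shorter than
  the distance from K to the complement of U changes the indicator only on U - K and its
  translate.\<close>

lemma translation_L1_indicator:
  fixes A :: "'a::euclidean_space set"
  assumes A: "A \<in> sets borel" "emeasure lborel A < \<infinity>" and e: "e > 0"
  obtains d where "d > 0"
    and "\<And>u. norm u < d \<Longrightarrow> (\<integral>x. \<bar>indicator A (x - u) - indicator A x\<bar> \<partial>lborel) \<le> (e::real)"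
proof -
  obtain U where U: "open U" "A \<subseteq> U" "emeasure lebesgue (U - A) < ennreal (e / 4)"
    using sets_lebesgue_outer_open[of A "e / 4"] A e by auto
  have emU: "emeasure lborel (U - A) < ennreal (e / 4)"
    using U A by (simp add: emeasure_completion)
  \<comment> \<open>Restricting the measure to A makes it finite, as inner regularity
    requires.\<close>
  define M where "M = density lborel (indicator A)"
  have M: "emeasure M B = emeasure lborel (A \<inter> B)" if "B \<in> sets borel" for B
    unfolding M_def using emeasure_restricted[of A lborel B] A(1) that by simp
  have "emeasure M A = (SUP K\<in>{K. K \<subseteq> A \<and> compact K}. emeasure M K)"
  proof (rule inner_regular)
    show "sets M = sets borel" by (simp add: M_def)
    have "space M = UNIV" by (simp add: M_def)
    then show "emeasure M (space M) \<noteq> \<infinity>" using M[of UNIV] A(2) by simp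
  qed (rule A(1))
  then have sup: "emeasure lborel A = (SUP K\<in>{K. K \<subseteq> A \<and> compact K}. emeasure M K)"
    using M[OF A(1)] by simp
  have "\<exists>K\<in>{K. K \<subseteq> A \<and> compact K}. emeasure lborel A < emeasure M K + ennreal (e / 4)"
    by (rule SUP_approx_ennreal[OF _ _ sup]) (use A(2) e in auto)
  then obtain K where K: "K \<subseteq> A" "compact K" "emeasure lborel A < emeasure M K + ennreal (e / 4)"
    by blast
  have [measurable]: "K \<in> sets borel" "U \<in> sets borel" "A \<in> sets borel"
    using K U A by (auto intro: borel_compact)
  have MK: "emeasure M K = emeasure lborel K" using M[of K] K by (simp add: Int_absorb1)
  have fK: "emeasure lborel K < \<infinity>" using emeasure_mono[OF K(1), of lborel] A by auto
  have "emeasure lborel (A - K) = emeasure lborel A - emeasure lborel K"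
    using K fK by (intro emeasure_Diff) auto
  also have "\<dots> \<le> ennreal (e / 4)"
    using K(3) fK unfolding MK by (auto simp: ennreal_minus_le_iff less_imp_le add.commute)
  finally have "emeasure lborel (A - K) \<le> ennreal (e / 4)" .
  moreover have "emeasure lborel (U - K) \<le> emeasure lborel ((U - A) \<union> (A - K))"
    by (intro emeasure_mono) auto
  moreover have "\<dots> \<le> emeasure lborel (U - A) + emeasure lborel (A - K)"
    by (intro emeasure_subadditive) auto
  ultimately have "emeasure lborel (U - K) \<le> ennreal (e / 4) + ennreal (e / 4)"
    using emU by (meson add_mono less_imp_le order.trans)
  then have UK: "emeasure lborel (U - K) \<le> ennreal (e / 2)"
    using e by (simp add: ennreal_plus[symmetric] del: ennreal_plus)
  obtain d where d: "d > 0" "\<And>x y. x \<in> K \<Longrightarrow> y \<in> - U \<Longrightarrow> d \<le> dist x y"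
  proof -
    have "K \<inter> - U = {}" using K(1) U(2) by blast
    with separate_compact_closed[OF K(2) closed_Compl[OF U(1)]] show ?thesis using that by blast
  qed
  have iUK: "integrable lborel (indicator (U - K) :: 'a \<Rightarrow> real)"
    using UK by (intro integrable_real_indicator) (auto intro: le_less_trans)
  have mUK: "(\<integral>x. indicator (U - K) x \<partial>lborel) \<le> e / 2"
    using enn2real_leI[OF _ UK] e by (simp add: measure_def)
  have "(\<integral>x. \<bar>indicator A (x - u) - indicator A x\<bar> \<partial>lborel) \<le> e" if u: "norm u < d" for u
  proof -
    have pw: "\<bar>indicator A (x - u) - indicator A x\<bar>
        \<le> indicator (U - K) (x - u) + (indicator (U - K) x :: real)" for x
    proof -
      have "x \<in> K \<Longrightarrow> x - u \<in> U" "x - u \<in> K \<Longrightarrow> x \<in> U"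
        using d(2)[of x "x - u"] d(2)[of "x - u" x] u by (auto simp: dist_norm)
      then show ?thesis using K(1) U(2) by (auto simp: indicator_def)
    qed
    have i2: "integrable lborel (\<lambda>x. indicator (U - K) (x - u) + (indicator (U - K) x :: real))"
      using preserving_integrable[OF preserving_translation, of "indicator (U - K)" u] iUK by simp
    have "(\<integral>x. \<bar>indicator A (x - u) - indicator A x\<bar> \<partial>lborel)
        \<le> (\<integral>x. indicator (U - K) (x - u) + (indicator (U - K) x :: real) \<partial>lborel)"
      by (rule integral_mono'[OF i2]) (use pw in auto)
    also have "\<dots> = (\<integral>x. indicator (U - K) x \<partial>lborel) + (\<integral>x. indicator (U - K) x \<partial>lborel)"
      using preserving_integrable[OF preserving_translation, of "indicator (U - K)" u] iUK
        preserving_integral[OF preserving_translation, of "indicator (U - K)" u] by simp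
    finally show ?thesis using mUK by simp
  qed
  then show ?thesis using that d(1) by blast
qed

lemma translation_L1:
  fixes f :: "'a::euclidean_space \<Rightarrow> real"
  assumes "integrable lborel f"
  shows "\<forall>e>0. \<exists>d>0. \<forall>u. norm u < d \<longrightarrow> (\<integral>x. \<bar>f (x - u) - f x\<bar> \<partial>lborel) \<le> e"
  using assms
proof (induction f rule: integrable_induct)
  case (base A c)
  show ?case
  proof (intro allI impI)
    fix e :: real assume e: "e > 0"
    have e': "e / (\<bar>c\<bar> + 1) > 0" using e by simp
    obtain d where d: "d > 0" "\<And>u. norm u < d \<Longrightarrow>
        (\<integral>x. \<bar>indicator A (x - u) - indicator A x\<bar> \<partial>lborel) \<le> e / (\<bar>c\<bar> + 1)"
      using translation_L1_indicator[OF _ _ e', of A] base by auto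
    have "(\<integral>x. \<bar>indicator A (x - u) *\<^sub>R c - indicator A x *\<^sub>R c\<bar> \<partial>lborel) \<le> e" if "norm u < d" for u
    proof -
      have "(\<integral>x. \<bar>indicator A (x - u) *\<^sub>R c - indicator A x *\<^sub>R c\<bar> \<partial>lborel)
          = (\<integral>x. \<bar>c\<bar> * \<bar>indicator A (x - u) - indicator A x\<bar> \<partial>lborel)"
        by (intro Bochner_Integration.integral_cong)
          (auto simp: left_diff_distrib[symmetric] abs_mult)
      also have "\<dots> \<le> \<bar>c\<bar> * (e / (\<bar>c\<bar> + 1))"
        using mult_left_mono[OF d(2)[OF that] abs_ge_zero[of c]] by simp
      also have "\<dots> \<le> e" using e by (simp add: field_simps)
      finally show ?thesis .
    qed
    then show "\<exists>d>0. \<forall>u. norm u < d \<longrightarrow>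
        (\<integral>x. \<bar>indicator A (x - u) *\<^sub>R c - indicator A x *\<^sub>R c\<bar> \<partial>lborel) \<le> e"
      using d(1) by blast
  qed
next
  case (add f g)
  show ?case
  proof (intro allI impI)
    fix e :: real assume e: "e > 0"
    obtain d1 where d1: "d1 > 0" "\<And>u. norm u < d1 \<Longrightarrow> (\<integral>x. \<bar>f (x - u) - f x\<bar> \<partial>lborel) \<le> e / 2"
      using add.IH(1) e by (meson half_gt_zero)
    obtain d2 where d2: "d2 > 0" "\<And>u. norm u < d2 \<Longrightarrow> (\<integral>x. \<bar>g (x - u) - g x\<bar> \<partial>lborel) \<le> e / 2"
      using add.IH(2) e by (meson half_gt_zero)
    have "(\<integral>x. \<bar>(f (x - u) + g (x - u)) - (f x + g x)\<bar> \<partial>lborel) \<le> e" if u: "norm u < min d1 d2" for u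
    proof -
      have i: "integrable lborel (\<lambda>x. \<bar>f (x - u) - f x\<bar>)" "integrable lborel (\<lambda>x. \<bar>g (x - u) - g x\<bar>)"
        using preserving_integrable[OF preserving_translation, of _ u] add.hyps
        by (auto intro!: integrable_abs Bochner_Integration.integrable_diff simp: borel_measurable_integrable)
      have "(\<integral>x. \<bar>(f (x - u) + g (x - u)) - (f x + g x)\<bar> \<partial>lborel)
          \<le> (\<integral>x. \<bar>f (x - u) - f x\<bar> + \<bar>g (x - u) - g x\<bar> \<partial>lborel)"
        by (rule integral_mono'[OF Bochner_Integration.integrable_add[OF i]]) auto
      also have "\<dots> \<le> e" using i d1(2)[of u] d2(2)[of u] u by simp
      finally show ?thesis .
    qed
    then show "\<exists>d>0. \<forall>u. norm u < d \<longrightarrow> (\<integral>x. \<bar>(f (x - u) + g (x - u)) - (f x + g x)\<bar> \<partial>lborel) \<le> e"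
      using d1(1) d2(1) by (intro exI[of _ "min d1 d2"]) simp
  qed
next
  case (lim f s)
  show ?case
  proof (intro allI impI)
    fix e :: real assume e: "e > 0"
    have "(\<lambda>n. \<integral>x. \<bar>s n x - f x\<bar> \<partial>lborel) \<longlonglongrightarrow> (\<integral>x. 0 \<partial>(lborel :: 'a measure))"
    \<comment> \<open>The induction rule supplies approximations with |s n| <= 2 |f|, whence the
      majorant 3 |f|.\<close>
    proof (rule integral_dominated_convergence[where w = "\<lambda>x. 3 * \<bar>f x\<bar>"])
      show "AE x in lborel. (\<lambda>n. \<bar>s n x - f x\<bar>) \<longlonglongrightarrow> 0"
        using lim.hyps(2) by (auto intro!: AE_I2 tendsto_rabs_zero LIM_zero)
      show "AE x in lborel. norm \<bar>s n x - f x\<bar> \<le> 3 * \<bar>f x\<bar>" for n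
      proof (rule AE_I2)
        fix x :: 'a
        show "norm \<bar>s n x - f x\<bar> \<le> 3 * \<bar>f x\<bar>"
          using lim.hyps(3)[of x n] by simp
      qed
    qed (use lim.hyps in \<open>auto simp: borel_measurable_integrable\<close>)
    from order_tendstoD(2)[OF this, of "e / 3"]
    have "\<forall>\<^sub>F n in sequentially. (\<integral>x. \<bar>s n x - f x\<bar> \<partial>lborel) < e / 3"
      using e by simp
    then obtain n where n: "(\<integral>x. \<bar>s n x - f x\<bar> \<partial>lborel) < e / 3"
      using eventually_happens by fastforce
    obtain d where d: "d > 0" "\<And>u. norm u < d \<Longrightarrow> (\<integral>x. \<bar>s n (x - u) - s n x\<bar> \<partial>lborel) \<le> e / 3"
      using lim.IH[of n] e by (metis divide_pos_pos zero_less_numeral)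
    have "(\<integral>x. \<bar>f (x - u) - f x\<bar> \<partial>lborel) \<le> e" if u: "norm u < d" for u
    proof -
      define q where "q x = \<bar>s n x - f x\<bar>" for x
      have q: "integrable lborel q" "q \<in> borel_measurable borel"
        using lim.hyps borel_measurable_integrable[of lborel q] by (auto simp: q_def[abs_def] measurable_lborel1)
      have qu: "integrable lborel (\<lambda>x. q (x - u))"
        using preserving_integrable[OF preserving_translation q(2)] q(1) by simp
      have i: "integrable lborel (\<lambda>x. \<bar>s n (x - u) - s n x\<bar>)"
        using preserving_integrable[OF preserving_translation, of "s n" u] lim.hyps
        by (auto intro!: integrable_abs Bochner_Integration.integrable_diff simp: borel_measurable_integrable)
      have "(\<integral>x. \<bar>f (x - u) - f x\<bar> \<partial>lborel)
          \<le> (\<integral>x. q (x - u) + \<bar>s n (x - u) - s n x\<bar> + q x \<partial>lborel)"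
        by (rule integral_mono'[OF Bochner_Integration.integrable_add[OF
              Bochner_Integration.integrable_add[OF qu i] q(1)]]) (auto simp: q_def)
      also have "\<dots> \<le> e"
        using q qu i d(2)[OF u] n[folded q_def] preserving_integral[OF preserving_translation q(2), of u]
        by simp
      finally show ?thesis .
    qed
    then show "\<exists>d>0. \<forall>u. norm u < d \<longrightarrow> (\<integral>x. \<bar>f (x - u) - f x\<bar> \<partial>lborel) \<le> e"
      using d(1) by blast
  qed
qed

subsection \<open>A symmetric mollifier\<close>

text \<open>Even and decreasing in every |x_i|, with support in the cube |x_i| <= d; folding a
  mollification along a hyperplane relies on this monotonicity.\<close>

definition bump :: "real \<Rightarrow> real ^ 'n::finite \<Rightarrow> real" where
  "bump d x = (\<Prod>i\<in>UNIV. flat 1 (1 + x $ i / d) * flat 1 (1 - x $ i / d))"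

definition ker :: "real \<Rightarrow> real ^ 'n::finite \<Rightarrow> real" where
  "ker d x = bump d x / (\<integral>y. bump d (y :: real ^ 'n) \<partial>lborel)"

lemma flat_1: "flat 1 x = (if x > 0 then exp (- (1 / x)) else 0)"
  by (simp add: flat_def)

text \<open>For |z| < 1 the product is exp(-2 / (1 - z^2)), since 1/(1 + z) + 1/(1 - z) = 2/(1 -
  z^2); it depends on z^2 only and decreases.\<close>

lemma flat_bump_antimono:
  fixes x y :: real
  assumes "\<bar>x\<bar> \<le> \<bar>y\<bar>"
  shows "flat 1 (1 + y) * flat 1 (1 - y) \<le> flat 1 (1 + x) * flat 1 (1 - x)"
proof (cases "\<bar>y\<bar> < 1")
  case True
  have "flat 1 (1 + z) * flat 1 (1 - z) = exp (- (2 / (1 - z\<^sup>2)))" if "\<bar>z\<bar> < 1" for z :: real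
  proof -
    have "1 / (1 + z) + 1 / (1 - z) = 2 / ((1 + z) * (1 - z))"
      using that by (simp add: divide_simps) (simp add: abs_if split: if_splits)
    moreover have "0 < 1 + z" "0 < 1 - z" using that by auto
    ultimately show ?thesis
      by (simp add: flat_1 exp_add[symmetric] power2_eq_square algebra_simps)
  qed
  moreover have "x\<^sup>2 \<le> y\<^sup>2" using assms by (simp add: abs_le_square_iff)
  moreover have "y\<^sup>2 < 1" using True by (simp add: abs_square_less_1)
  ultimately show ?thesis using True assms by (simp add: frac_le)
next
  case False
  then have "flat 1 (1 + y) * flat 1 (1 - y) = 0" by (auto simp: flat_1)
  moreover have "0 \<le> flat 1 (1 + x) * flat 1 (1 - x)" by (simp add: flat_1)
  ultimately show ?thesis by linarith
qed

lemma bounded_coordinates: "bounded {x :: real ^ 'n::finite. \<forall>i. \<bar>x $ i\<bar> \<le> r}"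
proof -
  have "{x :: real ^ 'n. \<forall>i. \<bar>x $ i\<bar> \<le> r} = cbox (\<chi> i. - r) (\<chi> i. r)"
    by (auto simp: mem_box_cart abs_le_iff minus_le_iff)
  then show ?thesis by simp
qed

context
  fixes d :: real
  assumes d: "d > 0"
begin

lemma bump_nonneg: "bump d x \<ge> 0"
  unfolding bump_def by (intro prod_nonneg) (simp add: flat_1)

lemma bump_zero: "d \<le> \<bar>x $ i\<bar> \<Longrightarrow> bump d x = 0"
proof -
  assume "d \<le> \<bar>x $ i\<bar>"
  then have "x $ i / d \<le> - 1 \<or> x $ i / d \<ge> 1" using d by (auto simp: field_simps)
  then have "flat 1 (1 + x $ i / d) * flat 1 (1 - x $ i / d) = 0" by (auto simp: flat_1)
  then show ?thesis unfolding bump_def by (auto intro!: prod_zero)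
qed

lemma bump_antimono: "(\<And>i. \<bar>x $ i\<bar> \<le> \<bar>y $ i\<bar>) \<Longrightarrow> bump d y \<le> bump d x"
  unfolding bump_def
  by (intro prod_mono conjI flat_bump_antimono) (use d in \<open>auto simp: flat_1 divide_right_mono\<close>)

lemma bump_Cc_infinity: "(bump d :: real ^ 'n::finite \<Rightarrow> real) \<in> Cc_infinity"
proof (rule Cc_infinityI)
  have "Ck_on k UNIV (\<lambda>x :: real ^ 'n. flat 1 (1 + x $ i / d) * flat 1 (1 - x $ i / d))" for k i
  proof -
    have "Ck_on k UNIV (\<lambda>x :: real ^ 'n. c * x $ i + 1)" for c
      by (intro Ck_add Ck_mult Ck_const Ck_component)
    from this[of "1 / d"] this[of "- 1 / d"]
    have "Ck_on k UNIV (\<lambda>x :: real ^ 'n. 1 + x $ i / d)" "Ck_on k UNIV (\<lambda>x :: real ^ 'n. 1 - x $ i / d)"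
      by (simp_all add: add.commute)
    then show ?thesis by (intro Ck_mult Ck_flat)
  qed
  then show "Ck_on k UNIV (bump d :: real ^ 'n \<Rightarrow> real)" for k
    unfolding bump_def[abs_def] by (intro Ck_prod) auto
  show "bounded {x :: real ^ 'n. \<forall>i. \<bar>x $ i\<bar> \<le> d}" by (rule bounded_coordinates)
  show "bump d x = 0" if "x \<notin> {x :: real ^ 'n. \<forall>i. \<bar>x $ i\<bar> \<le> d}" for x
    using that bump_zero less_imp_le by (auto simp: not_le)
qed

lemma bump_integral_pos: "(\<integral>y. bump d (y :: real ^ 'n::finite) \<partial>lborel) > 0"
proof (rule ccontr)
  assume "\<not> ?thesis"
  moreover have int: "integrable lborel (bump d :: real ^ 'n \<Rightarrow> real)"
    by (rule Cc_infinity_integrable[OF bump_Cc_infinity])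
  moreover have "(\<integral>y. bump d (y :: real ^ 'n) \<partial>lborel) \<ge> 0" by (simp add: bump_nonneg)
  ultimately have "(\<integral>y. bump d (y :: real ^ 'n) \<partial>lborel) = 0" by simp
  then have "AE y in lborel. bump d (y :: real ^ 'n) = 0"
    using integral_nonneg_eq_0_iff_AE[OF int AE_I2[OF bump_nonneg]] by simp
  moreover have "bump d y > 0" if "y \<in> box (\<chi> i. - d) (\<chi> i. d)" for y :: "real ^ 'n"
    unfolding bump_def
  proof (intro prod_pos)
    fix i
    have "- d < y $ i" "y $ i < d" using that by (auto simp: mem_box_cart)
    then have "- 1 < y $ i / d" "y $ i / d < 1" using d by (auto simp: field_simps)
    then show "0 < flat 1 (1 + y $ i / d) * flat 1 (1 - y $ i / d)" by (simp add: flat_1)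
  qed
  ultimately have "AE y in lborel. y \<notin> box (\<chi> i. - d) ((\<chi> i. d) :: real ^ 'n)"
    by (elim eventually_mono) (metis less_irrefl)
  then have "emeasure lborel (box (\<chi> i. - d) ((\<chi> i. d) :: real ^ 'n)) = 0"
    by (subst (asm) AE_iff_measurable[OF _ refl]) auto
  moreover have "emeasure lborel (box (\<chi> i. - d) ((\<chi> i. d) :: real ^ 'n)) > 0"
    using d by (subst emeasure_lborel_box_eq) (auto simp: Basis_vec_def inner_axis inner_diff_left intro!: prod_pos)
  ultimately show False by simp
qed

lemma ker_nonneg: "ker d (x :: real ^ 'n::finite) \<ge> 0"
  using bump_integral_pos[where 'n = 'n] by (simp add: ker_def bump_nonneg)

lemma ker_zero: "d \<le> \<bar>x $ i\<bar> \<Longrightarrow> ker d (x :: real ^ 'n::finite) = 0"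
  by (simp add: ker_def bump_zero)

lemma ker_antimono: "(\<And>i. \<bar>x $ i\<bar> \<le> \<bar>y $ i\<bar>) \<Longrightarrow> ker d y \<le> ker d (x :: real ^ 'n::finite)"
  using bump_integral_pos[where 'n = 'n] by (auto simp: ker_def intro!: divide_right_mono bump_antimono)

lemma ker_integral: "(\<integral>y. ker d (y :: real ^ 'n::finite) \<partial>lborel) = 1"
  using bump_integral_pos[where 'n = 'n] by (simp add: ker_def)

lemma ker_Cc_infinity: "(ker d :: real ^ 'n::finite \<Rightarrow> real) \<in> Cc_infinity"
proof (rule Cc_infinityI)
  have "Ck_on k UNIV (\<lambda>x :: real ^ 'n. 1 / (\<integral>y. bump d (y :: real ^ 'n) \<partial>lborel) * bump d x)" for k
    by (intro Ck_mult Ck_const Cc_infinity_Ck[OF bump_Cc_infinity])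
  then show "Ck_on k UNIV (ker d :: real ^ 'n \<Rightarrow> real)" for k by (simp add: ker_def[abs_def])
  show "bounded {x :: real ^ 'n. bump d x \<noteq> 0}"
    by (rule Cc_infinity_bounded_support[OF bump_Cc_infinity])
qed (simp add: ker_def)

text \<open>As the kernel has mass 1, the error is an average of the differences u(x - s) - u(x)
  over small shifts s, and Tonelli puts the x-integral inside. The weight b depends on x alone and
  may be unbounded.\<close>

lemma mol_ker_error:
  fixes u b :: "real ^ 'n::finite \<Rightarrow> real"
  assumes u: "integrable lborel u" and b: "b \<in> borel_measurable borel" "\<And>x. b x \<ge> 0"
    and e: "\<And>s. (\<And>i. \<bar>s $ i\<bar> < d) \<Longrightarrow> (\<integral>\<^sup>+x. ennreal (b x * \<bar>u (x - s) - u x\<bar>) \<partial>lborel) \<le> e"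
  shows "(\<integral>\<^sup>+x. ennreal (b x * \<bar>mol (ker d) u x - u x\<bar>) \<partial>lborel) \<le> e"
proof -
  let ?k = "ker d :: real ^ 'n \<Rightarrow> real"
  have [measurable]: "u \<in> borel_measurable borel" "?k \<in> borel_measurable borel" "b \<in> borel_measurable borel"
    using u b Cc_infinity_measurable[OF ker_Cc_infinity]
    by (auto dest: borel_measurable_integrable)
  have pw: "ennreal (b x * \<bar>mol ?k u x - u x\<bar>) \<le> (\<integral>\<^sup>+s. ennreal (?k s * (b x * \<bar>u (x - s) - u x\<bar>)) \<partial>lborel)"
    for x
  proof -
    have i1: "integrable lborel (\<lambda>y. u y * ?k (x - y))"
      by (rule mol_integrable[OF u ker_Cc_infinity])
    have i2: "integrable lborel (\<lambda>s. u (x - s) * ?k s)"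
      using preserving_integrable[OF preserving_point_reflection[of x], of "\<lambda>y. u y * ?k (x - y)"] i1
      by simp
    have i3: "integrable lborel (\<lambda>s. u x * ?k s)"
      by (rule integrable_mult_right[OF Cc_infinity_integrable[OF ker_Cc_infinity]])
    have "mol ?k u x = (\<integral>s. u (x - s) * ?k s \<partial>lborel)"
      unfolding mol_def
      using preserving_integral[OF preserving_point_reflection[of x], of "\<lambda>y. u y * ?k (x - y)"] by simp
    then have "mol ?k u x - u x = (\<integral>s. u (x - s) * ?k s - u x * ?k s \<partial>lborel)"
      using i2 i3 ker_integral[where 'n = 'n] by simp
    then have "b x * \<bar>mol ?k u x - u x\<bar> = \<bar>\<integral>s. b x * (u (x - s) * ?k s - u x * ?k s) \<partial>lborel\<bar>"
      using b(2)[of x] by (simp add: abs_mult)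
    also have "ennreal \<dots> \<le> (\<integral>\<^sup>+s. ennreal (norm (b x * (u (x - s) * ?k s - u x * ?k s))) \<partial>lborel)"
      unfolding real_norm_def[symmetric] by (rule integral_norm_bound_ennreal) (use i2 i3 in auto)
    also have "\<dots> = (\<integral>\<^sup>+s. ennreal (?k s * (b x * \<bar>u (x - s) - u x\<bar>)) \<partial>lborel)"
    proof (intro nn_integral_cong arg_cong[of _ _ ennreal])
      fix s
      have "b x * (u (x - s) * ?k s - u x * ?k s) = ?k s * b x * (u (x - s) - u x)"
        by (simp add: algebra_simps)
      then have "norm (b x * (u (x - s) * ?k s - u x * ?k s)) = \<bar>?k s * b x * (u (x - s) - u x)\<bar>"
        by (simp only: real_norm_def)
      also have "\<dots> = ?k s * (b x * \<bar>u (x - s) - u x\<bar>)"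
        by (simp add: abs_mult b(2) ker_nonneg)
      finally show "norm (b x * (u (x - s) * ?k s - u x * ?k s)) = ?k s * (b x * \<bar>u (x - s) - u x\<bar>)" .
    qed
    finally show ?thesis .
  qed
  have "(\<integral>\<^sup>+x. ennreal (b x * \<bar>mol ?k u x - u x\<bar>) \<partial>lborel)
      \<le> (\<integral>\<^sup>+x. \<integral>\<^sup>+s. ennreal (?k s * (b x * \<bar>u (x - s) - u x\<bar>)) \<partial>lborel \<partial>lborel)"
    by (intro nn_integral_mono pw)
  also have "\<dots> = (\<integral>\<^sup>+s. \<integral>\<^sup>+x. ennreal (?k s * (b x * \<bar>u (x - s) - u x\<bar>)) \<partial>lborel \<partial>lborel)"
    by (rule lborel_pair.Fubini'[symmetric]) measurable
  also have "\<dots> \<le> (\<integral>\<^sup>+s. ennreal (?k s) * e \<partial>lborel)"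
  proof (rule nn_integral_mono)
    fix s :: "real ^ 'n"
    have "(\<integral>\<^sup>+x. ennreal (?k s * (b x * \<bar>u (x - s) - u x\<bar>)) \<partial>lborel)
        = ennreal (?k s) * (\<integral>\<^sup>+x. ennreal (b x * \<bar>u (x - s) - u x\<bar>) \<partial>lborel)"
      by (subst nn_integral_cmult[symmetric]) (auto simp: ennreal_mult' ker_nonneg)
    also have "\<dots> \<le> ennreal (?k s) * e"
    proof (cases "\<forall>i. \<bar>s $ i\<bar> < d")
      case True
      then show ?thesis using e[of s] by (intro mult_left_mono) auto
    next
      case False
      then have "?k s = 0" using ker_zero by (auto simp: not_less)
      then show ?thesis by simp
    qed
    finally show "(\<integral>\<^sup>+x. ennreal (?k s * (b x * \<bar>u (x - s) - u x\<bar>)) \<partial>lborel) \<le> ennreal (?k s) * e" .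
  qed
  also have "\<dots> = (\<integral>\<^sup>+s. ennreal (?k s) \<partial>lborel) * e"
    by (rule nn_integral_multc) simp
  also have "(\<integral>\<^sup>+s. ennreal (?k s) \<partial>lborel) = 1"
    using nn_integral_eq_integral[OF Cc_infinity_integrable[OF ker_Cc_infinity[where 'n = 'n]] AE_I2[OF ker_nonneg]]
      ker_integral[where 'n = 'n] by simp
  finally show ?thesis by simp
qed

end

section \<open>Mollification errors in L^1 and with gradient weights\<close>

lemma coordinates_less_imp_norm_less:
  fixes s :: "real ^ 'n::finite"
  assumes "\<And>i. \<bar>s $ i\<bar> < d"
  shows "norm s < real CARD('n) * d"
proof -
  have "norm s \<le> (\<Sum>i\<in>UNIV. \<bar>s $ i\<bar>)" by (rule norm_le_l1_cart)
  also have "\<dots> < (\<Sum>i\<in>(UNIV :: 'n set). d)" using assms by (intro sum_strict_mono) auto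
  finally show ?thesis by simp
qed

text \<open>The threshold \<open>d0\<close> serves the whole family of weights. It is r / N because
  a cube of half side d lies in the ball of radius N d.\<close>

lemma mol_ker_error_small:
  fixes u :: "real ^ 'n::finite \<Rightarrow> real" and b :: "'t \<Rightarrow> real ^ 'n \<Rightarrow> real"
  assumes u: "integrable lborel u" and r: "r > 0"
    and b: "\<And>t. t \<in> A \<Longrightarrow> b t \<in> borel_measurable borel" "\<And>t x. b t x \<ge> 0"
    and e: "\<And>t s. t \<in> A \<Longrightarrow> norm s < r \<Longrightarrow> (\<integral>\<^sup>+x. ennreal (b t x * \<bar>u (x - s) - u x\<bar>) \<partial>lborel) \<le> e"
  shows "\<exists>d0>0. \<forall>d t. 0 < d \<and> d < d0 \<and> t \<in> A \<longrightarrow>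
    (\<integral>\<^sup>+x. ennreal (b t x * \<bar>mol (ker d) u x - u x\<bar>) \<partial>lborel) \<le> e"
proof (intro exI[of _ "r / CARD('n)"] conjI allI impI)
  fix d t assume d: "0 < d \<and> d < r / real CARD('n) \<and> t \<in> A"
  show "(\<integral>\<^sup>+x. ennreal (b t x * \<bar>mol (ker d) u x - u x\<bar>) \<partial>lborel) \<le> e"
  proof (rule mol_ker_error[OF _ u b(1) b(2)])
    fix s :: "real ^ 'n" assume "\<And>i. \<bar>s $ i\<bar> < d"
    then have "norm s < real CARD('n) * d" by (rule coordinates_less_imp_norm_less)
    also have "\<dots> < r" using d by (simp add: field_simps)
    finally show "(\<integral>\<^sup>+x. ennreal (b t x * \<bar>u (x - s) - u x\<bar>) \<partial>lborel) \<le> e"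
      using e d by blast
  qed (use d in auto)
qed (use r in simp)

lemma mol_ker_L1:
  fixes u :: "real ^ 'n::finite \<Rightarrow> real"
  assumes u: "integrable lborel u" and e: "e > 0"
  shows "\<exists>d0>0. \<forall>d. 0 < d \<and> d < d0 \<longrightarrow>
    (\<integral>\<^sup>+x. ennreal \<bar>mol (ker d) u x - u x\<bar> \<partial>lborel) \<le> ennreal e"
proof -
  obtain r where r: "r > 0" "\<And>s. norm s < r \<Longrightarrow> (\<integral>x. \<bar>u (x - s) - u x\<bar> \<partial>lborel) \<le> e"
    using translation_L1[OF u] e by blast
  have ub: "u \<in> borel_measurable borel" using borel_measurable_integrable[OF u] by simp
  have "(\<integral>\<^sup>+x. ennreal (1 * \<bar>u (x - s) - u x\<bar>) \<partial>lborel) \<le> ennreal e" if "norm s < r" for s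
  proof -
    have "integrable lborel (\<lambda>x. \<bar>u (x - s) - u x\<bar>)"
      using preserving_integrable[OF preserving_translation ub, of s] u by auto
    then show ?thesis using r(2)[OF that] by (simp add: nn_integral_eq_integral ennreal_leI)
  qed
  then show ?thesis
    using mol_ker_error_small[OF u r(1), of "{()}" "\<lambda>_ _. 1" "ennreal e"] by simp
qed

text \<open>A Young inequality with an adjustable weight: if y <= l x the first term alone suffices,
  otherwise x < y / l and the second one does.\<close>

lemma powr_mult_split:
  fixes x y l p :: real
  assumes "x \<ge> 0" "y \<ge> 0" "l > 0" "p > 1"
  shows "x powr (p - 1) * y \<le> l * x powr p + l powr (1 - p) * y powr p"
proof (cases "y \<le> l * x")
  case True
  have "x powr (p - 1) * y \<le> x powr (p - 1) * (l * x)"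
    using True by (intro mult_left_mono) auto
  also have "\<dots> = l * x powr p"
    using assms by (cases "x = 0") (auto simp: powr_diff)
  finally show ?thesis by (simp add: add_increasing2)
next
  case False
  then have "x \<le> y / l" "y > 0" using assms by (auto simp: field_simps intro: le_less_trans[of 0 "l * x" y])
  then have "x powr (p - 1) * y \<le> (y / l) powr (p - 1) * y"
    using assms by (intro mult_right_mono powr_mono2) auto
  also have "\<dots> = l powr (1 - p) * y powr p"
    using assms \<open>y > 0\<close> by (simp add: powr_divide powr_diff field_simps)
  finally show ?thesis using assms by (simp add: add_increasing)
qed

text \<open>Where |G(T x)| is at most n the weight is bounded, and L^1 continuity of translations
  suffices. Elsewhere \<open>powr_mult_split\<close> yields l times the tail of |G|^p beyond n,
  composed with T, and c times full integrals of |G|^p. As T preserves the measure, none of these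
  bounds depends on T.\<close>

lemma weighted_translation:
  fixes G :: "'a::euclidean_space \<Rightarrow> real"
  assumes G: "integrable lborel G" and Gp: "integrable lborel (\<lambda>x. \<bar>G x\<bar> powr p)" and p: "p > 1" and e: "e > 0"
  shows "\<exists>r>0. \<forall>T u. lborel_preserving T \<and> norm u < r \<longrightarrow>
    (\<integral>\<^sup>+x. ennreal (\<bar>G (T x)\<bar> powr (p - 1) * \<bar>G (x - u) - G x\<bar>) \<partial>lborel) \<le> ennreal e"
proof -
  have Gb[measurable]: "G \<in> borel_measurable borel" using borel_measurable_integrable[OF G] by simp
  define I where "I = (\<integral>x. \<bar>G x\<bar> powr p \<partial>lborel)"
  have I: "I \<ge> 0" by (simp add: I_def)
  \<comment> \<open>The constants leave at most e / 3 for each of the three parts of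
    \<open>F\<close>: first c against the integral I, then l with \<open>l powr (1 - p) = c\<close>,
    then n for the tail, and r last.\<close>
  define c where "c = e / (3 * (2 * I + 1))"
  have c: "c > 0" "c * (2 * I) \<le> e / 3"
    using e I by (auto simp: c_def field_simps)
  define l where "l = c powr (1 / (1 - p))"
  have l: "l > 0" "l powr (1 - p) = c" using c p by (auto simp: l_def powr_powr)
  define q where "q M x = (if \<bar>G x\<bar> > M then \<bar>G x\<bar> powr p else 0)" for M x
  have qm[measurable]: "q M \<in> borel_measurable borel" for M unfolding q_def[abs_def] by measurable
  have q: "integrable lborel (q M)" for M
    by (rule Bochner_Integration.integrable_bound[OF Gp]) (auto simp: q_def)
  have "(\<lambda>n. \<integral>x. q (real n) x \<partial>lborel) \<longlonglongrightarrow> (\<integral>x. 0 \<partial>(lborel :: 'a measure))"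
  proof (rule integral_dominated_convergence[where w = "\<lambda>x. \<bar>G x\<bar> powr p"])
    have "(\<lambda>n. q (real n) x) \<longlonglongrightarrow> 0" for x
    proof (rule tendsto_eventually)
      obtain N where "\<bar>G x\<bar> \<le> real N" using real_arch_simple by blast
      then show "\<forall>\<^sub>F n in sequentially. q (real n) x = 0"
        by (auto simp: eventually_sequentially q_def intro!: exI[of _ N])
    qed
    then show "AE x in lborel. (\<lambda>n. q (real n) x) \<longlonglongrightarrow> 0" by simp
  qed (use Gp in \<open>auto simp: q_def\<close>)
  from order_tendstoD(2)[OF this, of "e / (6 * l)"] obtain n where n: "(\<integral>x. q (real n) x \<partial>lborel) < e / (6 * l)"
    using e l eventually_happens by fastforce
  define m where "m = real n powr (p - 1) + 1"
  have m: "m > 0" by (simp add: m_def add_nonneg_pos)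
  obtain r where r: "r > 0" "\<And>u. norm u < r \<Longrightarrow> (\<integral>x. \<bar>G (x - u) - G x\<bar> \<partial>lborel) \<le> e / (3 * m)"
    using translation_L1[OF G] e m by (metis divide_pos_pos mult_pos_pos zero_less_numeral)
  have "(\<integral>\<^sup>+x. ennreal (\<bar>G (T x)\<bar> powr (p - 1) * \<bar>G (x - u) - G x\<bar>) \<partial>lborel) \<le> ennreal e"
    if T: "lborel_preserving T" and u: "norm u < r" for T u
  proof -
    define F where "F x = m * \<bar>G (x - u) - G x\<bar> + 2 * l * q (real n) (T x)
      + c * (\<bar>G (x - u)\<bar> powr p + \<bar>G x\<bar> powr p)" for x
    have pw: "\<bar>G (T x)\<bar> powr (p - 1) * \<bar>G (x - u) - G x\<bar> \<le> F x" for x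
    proof (cases "\<bar>G (T x)\<bar> > real n")
      case False
      have "\<bar>G (T x)\<bar> powr (p - 1) * \<bar>G (x - u) - G x\<bar> \<le> m * \<bar>G (x - u) - G x\<bar>"
        using False p powr_mono2[of "p - 1" "\<bar>G (T x)\<bar>" "real n"]
        by (intro mult_right_mono) (auto simp: m_def)
      then show ?thesis using False c l by (simp add: F_def q_def add_increasing2)
    next
      case True
      have "\<bar>G (T x)\<bar> powr (p - 1) * \<bar>G (x - u) - G x\<bar>
          \<le> \<bar>G (T x)\<bar> powr (p - 1) * \<bar>G (x - u)\<bar> + \<bar>G (T x)\<bar> powr (p - 1) * \<bar>G x\<bar>"
        unfolding distrib_left[symmetric] by (intro mult_left_mono) auto
      also have "\<dots> \<le> (l * \<bar>G (T x)\<bar> powr p + c * \<bar>G (x - u)\<bar> powr p)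
          + (l * \<bar>G (T x)\<bar> powr p + c * \<bar>G x\<bar> powr p)"
        unfolding l(2)[symmetric] using l p by (intro add_mono powr_mult_split) auto
      also have "\<dots> \<le> F x" using True m by (simp add: F_def q_def algebra_simps)
      finally show ?thesis .
    qed
    have i1: "integrable lborel (\<lambda>x. \<bar>G (x - u) - G x\<bar>)"
      using preserving_integrable[OF preserving_translation Gb, of u] G by auto
    have i2: "integrable lborel (\<lambda>x. q (real n) (T x))"
      using preserving_integrable[OF T qm] q by simp
    have i3: "integrable lborel (\<lambda>x. \<bar>G (x - u)\<bar> powr p)"
      using preserving_integrable[OF preserving_translation, of "\<lambda>x. \<bar>G x\<bar> powr p" u] Gp by simp
    have F: "integrable lborel F"
      unfolding F_def[abs_def] using i1 i2 i3 Gp by auto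
    have "(\<integral>x. F x \<partial>lborel) = m * (\<integral>x. \<bar>G (x - u) - G x\<bar> \<partial>lborel) + 2 * l * (\<integral>x. q (real n) x \<partial>lborel)
        + c * (I + I)"
      unfolding F_def using i1 i2 i3 Gp
        preserving_integral[OF T qm[of "real n"]]
        preserving_integral[OF preserving_translation, of "\<lambda>x. \<bar>G x\<bar> powr p" u]
      by (simp add: I_def)
    also have "\<dots> \<le> e / 3 + e / 3 + e / 3"
    proof (intro add_mono)
      show "m * (\<integral>x. \<bar>G (x - u) - G x\<bar> \<partial>lborel) \<le> e / 3"
        using mult_left_mono[OF r(2)[OF u], of m] m by simp
      show "2 * l * (\<integral>x. q (real n) x \<partial>lborel) \<le> e / 3"
        using mult_left_mono[OF less_imp_le[OF n], of "2 * l"] l by simp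
      show "c * (I + I) \<le> e / 3" using c(2) by simp
    qed
    finally have Fe: "(\<integral>x. F x \<partial>lborel) \<le> e" by simp
    have F0: "F x \<ge> 0" for x using m l c by (auto simp: F_def q_def intro!: add_nonneg_nonneg mult_nonneg_nonneg)
    have "(\<integral>\<^sup>+x. ennreal (\<bar>G (T x)\<bar> powr (p - 1) * \<bar>G (x - u) - G x\<bar>) \<partial>lborel) \<le> (\<integral>\<^sup>+x. ennreal (F x) \<partial>lborel)"
      by (intro nn_integral_mono ennreal_leI pw)
    also have "\<dots> \<le> ennreal e" using Fe by (simp add: nn_integral_eq_integral F F0 ennreal_leI)
    finally show ?thesis .
  qed
  then show ?thesis using r(1) by blast
qed

text \<open>One scale d has to serve all positions t of the hyperplane, hence \<open>d0\<close> is
  found before T.\<close>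

lemma mol_ker_weighted:
  fixes G :: "real ^ 'n::finite \<Rightarrow> real"
  assumes G: "integrable lborel G" and Gp: "integrable lborel (\<lambda>x. \<bar>G x\<bar> powr p)" and p: "p > 1" and e: "e > 0"
  shows "\<exists>d0>0. \<forall>d T. 0 < d \<and> d < d0 \<and> lborel_preserving T \<longrightarrow>
    (\<integral>\<^sup>+x. ennreal (\<bar>G (T x)\<bar> powr (p - 1) * \<bar>mol (ker d) G x - G x\<bar>) \<partial>lborel) \<le> ennreal e"
proof -
  obtain r where r: "r > 0" "\<And>T u. lborel_preserving T \<Longrightarrow> norm u < r \<Longrightarrow>
    (\<integral>\<^sup>+x. ennreal (\<bar>G (T x)\<bar> powr (p - 1) * \<bar>G (x - u) - G x\<bar>) \<partial>lborel) \<le> ennreal e"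
    using weighted_translation[OF assms] by blast
  have "(\<lambda>x. \<bar>G (T x)\<bar> powr (p - 1)) \<in> borel_measurable borel" if "lborel_preserving T" for T
  proof -
    have [measurable]: "T \<in> borel_measurable borel" "G \<in> borel_measurable borel"
      using that borel_measurable_integrable[OF G] by (auto simp: lborel_preserving_def)
    show ?thesis by measurable
  qed
  then show ?thesis
    using mol_ker_error_small[OF G r(1), of "Collect lborel_preserving" "\<lambda>T x. \<bar>G (T x)\<bar> powr (p - 1)" "ennreal e"] r(2)
    by simp
qed

text \<open>The fundamental lemma of the calculus of variations. On a compact part of U the
  mollification of h is a pairing with an admissible test function, hence 0, while it converges to h
  in L^1; countably many boxes then cover U.\<close>

lemma weakly_zero_imp_AE_zero:
  fixes h :: "real ^ 'n::finite \<Rightarrow> real"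
  assumes h: "h \<in> borel_measurable borel" "\<And>K. compact K \<Longrightarrow> set_integrable lborel K h" and U: "open U"
    and zero: "\<And>\<phi>. \<phi> \<in> Cc_infinity \<Longrightarrow> closure {x. \<phi> x \<noteq> 0} \<subseteq> U \<Longrightarrow> (\<integral>x. h x * \<phi> x \<partial>lborel) = 0"
  shows "AE x in lborel. x \<in> U \<longrightarrow> h x = 0"
proof -
  have on_compact: "AE x in lborel. x \<in> K \<longrightarrow> h x = 0" if K: "compact K" "K \<subseteq> U" for K
  proof -
    obtain r where r: "r > 0" "\<And>x y. x \<in> K \<Longrightarrow> y \<in> - U \<Longrightarrow> r \<le> dist x y"
    proof -
      have "K \<inter> - U = {}" using K(2) by blast
      with separate_compact_closed[OF K(1) closed_Compl[OF U]] show ?thesis using that by blast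
    qed
    obtain R where R: "\<And>x. x \<in> K \<Longrightarrow> norm x \<le> R"
      using compact_imp_bounded[OF K(1)] unfolding bounded_iff by blast
    \<comment> \<open>h is only locally integrable. The cut at radius R + 1 goes unnoticed by
      kernels of radius below 1 centred in K.\<close>
    define h' where "h' x = indicator (cball 0 (R + 1)) x *\<^sub>R h x" for x
    have h': "integrable lborel h'"
      using h(2)[OF compact_cball] by (simp add: h'_def[abs_def] set_integrable_def)
    have "(\<integral>\<^sup>+x. ennreal (indicator K x * \<bar>h x\<bar>) \<partial>lborel) \<le> 0 + ennreal e" if e: "e > 0" for e
    proof -
      obtain d0 where d0: "d0 > 0" "\<And>d. 0 < d \<Longrightarrow> d < d0 \<Longrightarrow>
          (\<integral>\<^sup>+x. ennreal \<bar>mol (ker d) h' x - h' x\<bar> \<partial>lborel) \<le> ennreal e"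
        using mol_ker_L1[OF h' e] by blast
      define d where "d = min (d0 / 2) (min r 1 / (2 * CARD('n)))"
      have d: "d > 0" "d < d0" "CARD('n) * d < r" "CARD('n) * d < 1"
      proof -
        show "d > 0" "d < d0" using d0 r by (auto simp: d_def)
        have "CARD('n) * d \<le> CARD('n) * (min r 1 / (2 * CARD('n)))"
          unfolding d_def by (intro mult_left_mono) auto
        also have "\<dots> = min r 1 / 2" by simp
        finally show "CARD('n) * d < r" "CARD('n) * d < 1" using r(1) by (auto split: if_splits simp: min_def)
      qed
      have near: "norm (x - y) < r" "norm (x - y) < 1" if "\<And>i. \<bar>(x - y) $ i\<bar> \<le> d" for x y :: "real ^ 'n"
      proof -
        have "norm (x - y) \<le> (\<Sum>i\<in>UNIV. \<bar>(x - y) $ i\<bar>)" by (rule norm_le_l1_cart)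
        also have "\<dots> \<le> (\<Sum>i\<in>(UNIV :: 'n set). d)" using that by (intro sum_mono) auto
        finally show "norm (x - y) < r" "norm (x - y) < 1" using d(3,4) by auto
      qed
      have "mol (ker d) h' x = 0" if x: "x \<in> K" for x
      proof -
        define \<phi> where "\<phi> y = ker d (x - y)" for y
        have \<phi>: "\<phi> \<in> Cc_infinity"
          unfolding \<phi>_def[abs_def] by (rule Cc_infinity_reflect[OF ker_Cc_infinity[OF d(1)]])
        have supp: "{y. \<phi> y \<noteq> 0} \<subseteq> {y. \<forall>i. \<bar>(x - y) $ i\<bar> \<le> d}"
        proof (intro subsetI CollectI allI)
          fix y i assume "y \<in> {y. \<phi> y \<noteq> 0}"
          then show "\<bar>(x - y) $ i\<bar> \<le> d"
            using ker_zero[OF d(1), of "x - y" i] by (cases "d \<le> \<bar>(x - y) $ i\<bar>") (auto simp: \<phi>_def)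
        qed
        have "closed {y. \<forall>i. \<bar>(x - y) $ i\<bar> \<le> d}"
          by (intro closed_Collect_all closed_Collect_le continuous_intros)
        then have "closure {y. \<phi> y \<noteq> 0} \<subseteq> {y. \<forall>i. \<bar>(x - y) $ i\<bar> \<le> d}"
          using supp closure_minimal by blast
        also have "\<dots> \<subseteq> U"
          using near(1)[of x] r(2)[OF x] by (fastforce simp: dist_norm)
        finally have z: "(\<integral>y. h y * \<phi> y \<partial>lborel) = 0" using zero[OF \<phi>] by blast
        have "h' y * \<phi> y = h y * \<phi> y" for y
        proof (cases "\<phi> y = 0")
          case False
          then have "norm (x - y) < 1" using supp near(2) by blast
          then have "norm y \<le> R + 1" using R[OF x] norm_triangle_ineq2[of y x] by (simp add: norm_minus_commute)
          then show ?thesis by (simp add: h'_def)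
        qed simp
        then have "mol (ker d) h' x = (\<integral>y. h y * \<phi> y \<partial>lborel)"
          unfolding mol_def \<phi>_def by (intro Bochner_Integration.integral_cong) auto
        then show ?thesis using z by simp
      qed
      moreover have "h' x = h x" if "x \<in> K" for x
        using R[OF that] by (simp add: h'_def)
      ultimately have "indicator K x * \<bar>h x\<bar> \<le> \<bar>mol (ker d) h' x - h' x\<bar>" for x
        by (cases "x \<in> K") auto
      then have "(\<integral>\<^sup>+x. ennreal (indicator K x * \<bar>h x\<bar>) \<partial>lborel) \<le> (\<integral>\<^sup>+x. ennreal \<bar>mol (ker d) h' x - h' x\<bar> \<partial>lborel)"
        by (intro nn_integral_mono ennreal_leI)
      then show ?thesis using d0(2)[OF d(1,2)] by simp
    qed
    then have "(\<integral>\<^sup>+x. ennreal (indicator K x * \<bar>h x\<bar>) \<partial>lborel) \<le> 0"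
      by (rule ennreal_le_epsilon)
    moreover have [measurable]: "K \<in> sets borel" using K(1) by (rule borel_compact)
    ultimately have "AE x in lborel. ennreal (indicator K x * \<bar>h x\<bar>) = 0"
      using h(1) nn_integral_0_iff_AE[of "\<lambda>x. ennreal (indicator K x * \<bar>h x\<bar>)" lborel] by simp
    then show ?thesis by eventually_elim (auto simp: indicator_def ennreal_eq_0_iff)
  qed
  obtain D where D: "countable D" "D \<subseteq> Pow U" "\<And>X. X \<in> D \<Longrightarrow> \<exists>a b. X = cbox a b" "\<Union>D = U"
    using open_countable_Union_open_cbox[OF U] by metis
  have "AE x in lborel. \<forall>X\<in>D. x \<in> X \<longrightarrow> h x = 0"
    unfolding AE_ball_countable[OF D(1)]
    using on_compact D(2,3) by (metis PowD compact_cbox subsetD)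
  then show ?thesis by eventually_elim (use D(4) in blast)
qed

subsection \<open>Reflections in coordinate hyperplanes\<close>

abbreviation pd :: "(real ^ 'n::finite \<Rightarrow> real) \<Rightarrow> 'n \<Rightarrow> real ^ 'n \<Rightarrow> real" where
  "pd \<phi> j y \<equiv> frechet_derivative \<phi> (at y) (axis j 1)"

text \<open>The factor that the chain rule gives to the j-th partial derivative under the reflection
  of coordinate i.\<close>

definition sg :: "'n \<Rightarrow> 'n \<Rightarrow> real" where
  "sg i j = (if j = i then - 1 else 1)"

definition flip :: "'n::finite \<Rightarrow> real ^ 'n \<Rightarrow> real ^ 'n" where
  "flip i v = (\<chi> j. sg i j * v $ j)"

text \<open>The reflection in the hyperplane y_i = t, written as linear part plus translation to fit
  \<open>Ck_affine_comp\<close>.\<close>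

definition refl :: "'n::finite \<Rightarrow> real \<Rightarrow> real ^ 'n \<Rightarrow> real ^ 'n" where
  "refl i t y = flip i y + axis i (2 * t)"

lemma refl_nth: "refl i t y $ j = (if j = i then 2 * t - y $ j else y $ j)"
  by (simp add: refl_def flip_def sg_def axis_def)

lemma refl_refl [simp]: "refl i t (refl i t y) = y"
  by (simp add: vec_eq_iff refl_nth)

lemma bounded_linear_flip: "bounded_linear (flip i)"
  by (rule linear_conv_bounded_linear[THEN iffD1], rule linearI) (auto simp: flip_def vec_eq_iff algebra_simps)

lemma flip_axis: "flip i (axis j c) = sg i j *\<^sub>R axis j c"
  by (simp add: flip_def vec_eq_iff axis_def)

lemma continuous_on_refl: "continuous_on S (refl i t)"
  unfolding refl_def by (intro continuous_on_add continuous_on_const bounded_linear.continuous_on[OF bounded_linear_flip] continuous_on_id)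

lemma refl_measurable [measurable]: "refl i t \<in> borel_measurable borel"
  by (intro borel_measurable_continuous_onI continuous_on_refl)

text \<open>In the standard basis the reflection is a diagonal affine map with entries 1 and -1, so
  its Jacobian has modulus 1.\<close>

lemma refl_preserving: "lborel_preserving (refl i t)"
proof -
  define c :: "real ^ 'a \<Rightarrow> real" where "c b = (if b = axis i 1 then - 1 else 1)" for b
  have R: "axis i (2 * t) + (\<Sum>b\<in>Basis. (c b * (x \<bullet> b)) *\<^sub>R b) = refl i t x" for x
  proof -
    have "(\<Sum>b\<in>Basis. (c b * (x \<bullet> b)) *\<^sub>R b) = flip i x"
    proof (rule euclidean_eqI)
      fix b :: "real ^ 'a" assume b: "b \<in> Basis"
      then obtain j where j: "b = axis j 1" by (auto simp: Basis_vec_def)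
      have "(\<Sum>b\<in>Basis. (c b * (x \<bullet> b)) *\<^sub>R b) \<bullet> b = c b * (x \<bullet> b)"
        using b by (simp add: inner_sum_left_Basis)
      also have "\<dots> = flip i x \<bullet> b"
        by (auto simp: j c_def flip_def sg_def inner_axis axis_eq_axis)
      finally show "(\<Sum>b\<in>Basis. (c b * (x \<bullet> b)) *\<^sub>R b) \<bullet> b = flip i x \<bullet> b" .
    qed
    then show ?thesis by (simp add: refl_def)
  qed
  have "(\<Prod>b\<in>(Basis :: (real ^ 'a) set). ennreal \<bar>c b\<bar>) = 1"
    by (intro prod.neutral) (auto simp: c_def)
  then have "lborel = distr lborel borel (\<lambda>x. axis i (2 * t) + (\<Sum>b\<in>Basis. (c b * (x \<bullet> b)) *\<^sub>R b))"
    using lborel_affine_euclidean[of c "axis i (2 * t)"]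
    by (auto simp: c_def density_1 prod_ennreal)
  then show ?thesis unfolding R lborel_preserving_def using refl_measurable by simp
qed

lemma refl_has_derivative: "(refl i t has_derivative flip i) (at y)"
  unfolding refl_def by (intro has_derivative_add_const bounded_linear_imp_has_derivative bounded_linear_flip)

lemma Cc_infinity_refl:
  assumes "\<phi> \<in> Cc_infinity"
  shows "(\<lambda>y. \<phi> (refl i t y)) \<in> Cc_infinity"
proof (rule Cc_infinityI)
  show "Ck_on k UNIV (\<lambda>y. \<phi> (refl i t y))" for k
    unfolding refl_def by (rule Ck_affine_comp[OF bounded_linear_flip Cc_infinity_Ck[OF assms]])
  have "compact (refl i t ` closure {y. \<phi> y \<noteq> 0})"
    by (rule compact_continuous_image[OF continuous_on_refl
          compact_closure[THEN iffD2, OF Cc_infinity_bounded_support[OF assms]]])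
  then show "bounded (refl i t ` closure {y. \<phi> y \<noteq> 0})" by (rule compact_imp_bounded)
  show "\<phi> (refl i t y) = 0" if y: "y \<notin> refl i t ` closure {y. \<phi> y \<noteq> 0}" for y
  proof (rule ccontr)
    assume "\<phi> (refl i t y) \<noteq> 0"
    then have "refl i t y \<in> closure {y. \<phi> y \<noteq> 0}" by (intro subsetD[OF closure_subset]) simp
    then have "refl i t (refl i t y) \<in> refl i t ` closure {y. \<phi> y \<noteq> 0}" by (rule imageI)
    then show False using y by simp
  qed
qed

lemma pd_refl:
  assumes "\<phi> \<in> Cc_infinity"
  shows "pd (\<lambda>y. \<phi> (refl i t y)) j y = sg i j * pd \<phi> j (refl i t y)"
proof -
  have "((\<lambda>y. \<phi> (refl i t y)) has_derivative (\<lambda>v. frechet_derivative \<phi> (at (refl i t y)) (flip i v))) (at y)"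
    by (rule has_derivative_compose[OF refl_has_derivative Cc_infinity_has_derivative[OF assms]])
  from frechet_derivative_at[OF this, symmetric]
  show ?thesis
    using linear_cmul[OF has_derivative_linear[OF Cc_infinity_has_derivative[OF assms]]]
    by (simp add: flip_axis)
qed

text \<open>Convolving phi with the indicator of a large ball gives a function that near 0 is
  constantly the integral of phi; its derivative at 0 is the integral of the partial
  derivative.\<close>

lemma integral_pd_eq_0:
  assumes "\<phi> \<in> Cc_infinity"
  shows "(\<integral>y. pd \<phi> j y \<partial>lborel) = 0"
proof -
  obtain R where R: "\<And>y. \<phi> y \<noteq> 0 \<Longrightarrow> norm y \<le> R"
    using Cc_infinity_bounded_support[OF assms] unfolding bounded_iff by blast
  define u :: "real ^ 'a \<Rightarrow> real" where "u = indicator (cball 0 (R + 1))"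
  have u: "integrable lborel u"
    unfolding u_def using emeasure_bounded_finite[OF bounded_cball, of 0 "R + 1"]
    by (intro integrable_real_indicator) auto
  have near: "u y * \<phi> (x - y) = \<phi> (x - y)" if "x \<in> ball 0 1" for x y
  proof (cases "\<phi> (x - y) = 0")
    case False
    have "norm y \<le> norm x + norm (x - y)" using norm_triangle_sub[of y x] by (simp add: norm_minus_commute)
    then show ?thesis using R[OF False] that by (simp add: u_def)
  qed simp
  have const: "mol \<phi> u x = (\<integral>y. \<phi> y \<partial>lborel)" if "x \<in> ball 0 1" for x
    unfolding mol_def near[OF that]
    by (rule preserving_integral[OF preserving_point_reflection Cc_infinity_measurable[OF assms]])
  have "(mol \<phi> u has_derivative (\<lambda>v. 0)) (at 0)"
    by (rule has_derivative_transform_within_open[of "\<lambda>_. \<integral>y. \<phi> y \<partial>lborel" _ _ _ "ball 0 1"])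
      (auto simp: const)
  then have "(\<lambda>v. mol (\<lambda>z. frechet_derivative \<phi> (at z) v) u 0) = (\<lambda>v. 0)"
    by (rule has_derivative_unique[OF mol_has_derivative[OF u assms]])
  from fun_cong[OF this, of "axis j 1"] have z: "mol (pd \<phi> j) u 0 = 0" .
  have pd_near: "u y * pd \<phi> j (0 - y) = pd \<phi> j (0 - y)" for y
  proof (cases "norm y \<le> R + 1")
    case False
    have "0 - y \<notin> closure {y. \<phi> y \<noteq> 0}"
    proof
      assume "0 - y \<in> closure {y. \<phi> y \<noteq> 0}"
      moreover have "closure {y. \<phi> y \<noteq> 0} \<subseteq> cball 0 R"
        by (rule closure_minimal) (use R in auto)
      ultimately show False using False by auto
    qed
    then show ?thesis by (simp add: frechet_derivative_outside_support)
  qed (simp add: u_def)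
  have "mol (pd \<phi> j) u 0 = (\<integral>y. pd \<phi> j y \<partial>lborel)"
    unfolding mol_def pd_near
    by (rule preserving_integral[OF preserving_point_reflection Cc_infinity_measurable[OF Cc_infinity_derivative[OF assms]]])
  then show ?thesis using z by simp
qed

lemma Cc_infinity_mult_component:
  assumes "\<phi> \<in> Cc_infinity"
  shows "(\<lambda>y. y $ j * \<phi> y) \<in> Cc_infinity"
    and "pd (\<lambda>y. y $ j * \<phi> y) j y = \<phi> y + y $ j * pd \<phi> j y"
proof -
  show "(\<lambda>y. y $ j * \<phi> y) \<in> Cc_infinity"
    by (rule Cc_infinityI[OF Ck_mult[OF Ck_component Cc_infinity_Ck[OF assms]] Cc_infinity_bounded_support[OF assms]])
      simp
  have "((\<lambda>y. y $ j * \<phi> y) has_derivative (\<lambda>v. y $ j * frechet_derivative \<phi> (at y) v + v $ j * \<phi> y)) (at y)"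
    by (rule has_derivative_mult[OF bounded_linear_imp_has_derivative[OF bounded_linear_vec_nth] Cc_infinity_has_derivative[OF assms]])
  from frechet_derivative_at[OF this, symmetric]
  show "pd (\<lambda>y. y $ j * \<phi> y) j y = \<phi> y + y $ j * pd \<phi> j y" by simp
qed

lemma integral_component_pd:
  assumes "\<phi> \<in> Cc_infinity"
  shows "(\<integral>y. y $ j * pd \<phi> j y \<partial>lborel) = - (\<integral>y. \<phi> y \<partial>lborel)"
proof -
  have "integrable lborel (\<lambda>y. y $ j * pd \<phi> j y)"
    by (rule Cc_infinity_integrable[OF Cc_infinity_mult_component(1)[OF Cc_infinity_derivative[OF assms]]])
  then have "(\<integral>y. pd (\<lambda>y. y $ j * \<phi> y) j y \<partial>lborel) = (\<integral>y. \<phi> y \<partial>lborel) + (\<integral>y. y $ j * pd \<phi> j y \<partial>lborel)"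
    unfolding Cc_infinity_mult_component(2)[OF assms]
    using Cc_infinity_integrable[OF assms] by simp
  then show ?thesis using integral_pd_eq_0[OF Cc_infinity_mult_component(1)[OF assms]] by simp
qed

subsection \<open>The flux\<close>

definition flux :: "real \<Rightarrow> real \<Rightarrow> real" where
  "flux p x = \<bar>x\<bar> powr (p - 2) * x"

lemma flux_minus: "flux p (- x) = - flux p x"
  by (simp add: flux_def)

lemma flux_sg: "flux p (sg i j * x) = sg i j * flux p x"
  by (simp add: sg_def flux_minus)

lemma abs_flux: "\<bar>flux p x\<bar> = \<bar>x\<bar> powr (p - 1)"
proof (cases "x = 0")
  case False
  then have "\<bar>flux p x\<bar> = \<bar>x\<bar> powr (p - 2) * \<bar>x\<bar> powr 1" by (simp add: flux_def abs_mult)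
  also have "\<dots> = \<bar>x\<bar> powr (p - 1)" unfolding powr_add[symmetric] by simp
  finally show ?thesis .
qed (simp add: flux_def)

lemma flux_mono:
  assumes "p > 1" "x \<le> y"
  shows "flux p x \<le> flux p y"
proof -
  have pos: "flux p z = z powr (p - 1)" if "z \<ge> 0" for z
    using abs_flux[of p z] that by (simp add: flux_def)
  have mono: "flux p a \<le> flux p b" if "0 \<le> a" "a \<le> b" for a b
    using that assms(1) by (simp add: pos powr_mono2)
  show ?thesis
  proof (cases "0 \<le> x")
    case True
    then show ?thesis using mono assms(2) by simp
  next
    case False
    show ?thesis
    proof (cases "0 \<le> y")
      case True
      have "flux p x \<le> 0" using mono[of 0 "- x"] False by (simp add: flux_minus) (simp add: flux_def)
      also have "0 \<le> flux p y" using True by (simp add: pos)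
      finally show ?thesis .
    next
      case False
      then show ?thesis using mono[of "- y" "- x"] assms(2) by (simp add: flux_minus)
    qed
  qed
qed

lemma flux_diff_mult_nonneg: "p > 1 \<Longrightarrow> (flux p x - flux p y) * (x - y) \<ge> 0"
  using flux_mono[of p x y] flux_mono[of p y x] by (cases "x \<le> y") (auto simp: zero_le_mult_iff)

lemma flux_measurable [measurable]: "flux p \<in> borel_measurable borel"
  unfolding flux_def[abs_def] by measurable

subsection \<open>A smooth approximation of the positive part\<close>

text \<open>\<open>pospart e\<close> is \<open>(z - e)\<^sup>+\<close> multiplied by a factor \<open>exp (- e / (z - e))\<close>, so that it is smooth;
  \<open>pospart'\<close> and \<open>pospart''\<close> are its derivatives.\<close>

definition pospart :: "real \<Rightarrow> real \<Rightarrow> real" where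
  "pospart e z = (z - e) * flat 1 ((z - e) / e)"

definition pospart' :: "real \<Rightarrow> real \<Rightarrow> real" where
  "pospart' e z = flat [:1, 1:] ((z - e) / e)"

definition pospart'' :: "real \<Rightarrow> real \<Rightarrow> real" where
  "pospart'' e z = flat [:0, 0, 0, 1:] ((z - e) / e) / e"

lemma exp_minus_le: "exp (- x) * (1 + x) \<le> (1 :: real)"
  using exp_ge_add_one_self[of x] by (simp add: exp_minus field_simps)

context
  fixes e :: real
  assumes e: "e > 0"
begin

lemma pospart_eq_0:
  assumes "z \<le> e"
  shows "pospart e z = 0" and "pospart' e z = 0" and "pospart'' e z = 0"
proof -
  have "(z - e) / e \<le> 0" using assms e by (simp add: divide_nonpos_pos)
  then show "pospart e z = 0" "pospart' e z = 0" "pospart'' e z = 0"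
    by (simp_all add: pospart_def pospart'_def pospart''_def)
qed

lemma pospart_eq: "z > e \<Longrightarrow> pospart e z = (z - e) * exp (- (e / (z - e)))"
  using e by (simp add: pospart_def flat_1)

lemma pospart'_eq: "z > e \<Longrightarrow> pospart' e z = exp (- (e / (z - e))) * (1 + e / (z - e))"
  using e by (simp add: pospart'_def flat_def)

lemma pospart'_bounds: "0 \<le> pospart' e z" "pospart' e z \<le> 1"
  using e by (cases "z > e"; simp add: pospart'_eq pospart_eq_0 exp_minus_le)+

lemma pospart''_nonneg: "0 \<le> pospart'' e z"
proof -
  have "0 \<le> flat [:0, 0, 0, 1:] x" for x :: real
    by (auto simp: flat_def intro!: mult_nonneg_nonneg)
  then show ?thesis using e by (simp add: pospart''_def)
qed

lemma pospart_nonneg: "0 \<le> pospart e z"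
  by (cases "z > e") (simp_all add: pospart_eq pospart_eq_0)

text \<open>exp(-x) >= 1 - x with x = e / (z - e): the damping factor costs at most a further
  e.\<close>

lemma pospart_ge: "z - 2 * e \<le> pospart e z"
proof (cases "z > e")
  case True
  have "(z - e) * (1 - e / (z - e)) \<le> (z - e) * exp (- (e / (z - e)))"
    using exp_ge_add_one_self[of "- (e / (z - e))"] True by (intro mult_left_mono) auto
  moreover have "(z - e) * (1 - e / (z - e)) = z - 2 * e" using True by (simp add: field_simps)
  ultimately show ?thesis using True by (simp add: pospart_eq)
qed (use e in \<open>simp add: pospart_eq_0\<close>)

text \<open>The price of the drift terms in the moving plane estimate; it follows from J' <= 1 and
  J(z) >= z - 2 e.\<close>

lemma pospart'_mult_le: "z * pospart' e z - pospart e z \<le> 2 * e"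
proof (cases "z > e")
  case True
  have "z * pospart' e z \<le> z * 1"
    using True e pospart'_bounds(2)[of z] by (intro mult_left_mono) auto
  then show ?thesis using pospart_ge[of z] by linarith
qed (use e in \<open>simp add: pospart_eq_0\<close>)

lemma pospart_DERIV: "(pospart e has_real_derivative pospart' e z) (at z)"
proof -
  have aff: "((\<lambda>z. (z - e) / e) has_real_derivative 1 / e) (at z)"
    using e by (auto intro!: derivative_eq_intros)
  have "(pospart e has_real_derivative
      1 * flat 1 ((z - e) / e) + flat ([:0, 0, 1:] * (1 - pderiv 1)) ((z - e) / e) * (1 / e) * (z - e)) (at z)"
    unfolding pospart_def[abs_def]
    by (rule DERIV_mult[OF _ DERIV_chain2[OF flat_DERIV aff]]) (auto intro!: derivative_eq_intros)
  moreover have "1 * flat 1 ((z - e) / e) + flat ([:0, 0, 1:] * (1 - pderiv 1)) ((z - e) / e) * (1 / e) * (z - e)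
      = pospart' e z"
  proof (cases "z > e")
    case True
    \<comment> \<open>In this variable (z - e) / e is 1 / x, and the product rule gives exp(-x) +
      exp(-x) x^2 / x = exp(-x) (1 + x).\<close>
    define x where "x = e / (z - e)"
    have 1: "x * (1 / e * (z - e)) = 1" using True e by (simp add: x_def)
    have "exp (- x) * (x * x) * (1 / e) * (z - e) = exp (- x) * x * (x * (1 / e * (z - e)))"
      by (simp only: mult_ac)
    also have "\<dots> = exp (- x) * x" by (simp only: 1)
    finally have 2: "exp (- x) * (x * x) * (1 / e) * (z - e) = exp (- x) * x" .
    then show ?thesis
      using True e by (simp add: pospart'_def flat_def x_def[symmetric] 2[unfolded mult.assoc] distrib_left pderiv_1 mult.assoc)
  next
    case False
    then have "(z - e) / e \<le> 0" using e by (simp add: divide_nonpos_pos)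
    then show ?thesis by (simp add: pospart'_def)
  qed
  ultimately show ?thesis by metis
qed

lemma pospart'_DERIV: "(pospart' e has_real_derivative pospart'' e z) (at z)"
proof -
  have aff: "((\<lambda>z. (z - e) / e) has_real_derivative 1 / e) (at z)"
    using e by (auto intro!: derivative_eq_intros)
  \<comment> \<open>As polynomials in u this reads u^2 ((1 + u) - 1) = u^3.\<close>
  have "[:0, 0, 1:] * ([:1, 1:] - pderiv [:1, 1:]) = [:0, 0, 0, 1 :: real:]"
    by (simp add: pderiv_pCons)
  then show ?thesis
    using DERIV_chain2[OF flat_DERIV[of "[:1, 1:]"] aff]
    by (simp add: pospart'_def[abs_def] pospart''_def)
qed

lemma pospart_Lipschitz: "\<bar>pospart e x - pospart e y\<bar> \<le> \<bar>x - y\<bar>"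
  using field_differentiable_bound[of UNIV "pospart e" "pospart' e" 1 y x] pospart_DERIV pospart'_bounds
  by (simp add: norm_minus_commute)

lemma Ck_pospart:
  assumes "Ck_on k UNIV g"
  shows "Ck_on k UNIV (\<lambda>x. pospart e (g x))" and "Ck_on k UNIV (\<lambda>x. pospart' e (g x))"
proof -
  have "Ck_on k UNIV (\<lambda>x. 1 / e * (g x + - e))"
    by (intro Ck_mult Ck_add Ck_const assms)
  then have a: "Ck_on k UNIV (\<lambda>x. (g x - e) / e)" by simp
  have b: "Ck_on k UNIV (\<lambda>x. g x - e)" using Ck_add[OF assms Ck_const[of k "- e"]] by simp
  show "Ck_on k UNIV (\<lambda>x. pospart e (g x))" unfolding pospart_def by (intro Ck_mult b Ck_flat a)
  show "Ck_on k UNIV (\<lambda>x. pospart' e (g x))" unfolding pospart'_def by (intro Ck_flat a)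
qed

text \<open>Differences of functions with values in [0, 1] stay in |z| <= 1. The bound depends on e,
  so the mollification error has to be chosen after e.\<close>

lemma pospart''_bounded: obtains L where "L > 0" "\<And>z. \<bar>z\<bar> \<le> 1 \<Longrightarrow> pospart'' e z \<le> L"
proof -
  have "continuous_on {-1..1} (pospart'' e)"
    unfolding pospart''_def[abs_def] using e
    by (intro continuous_intros continuous_on_compose2[OF flat_continuous[of UNIV]]) auto
  then have "bounded (pospart'' e ` {-1..1})"
    by (intro compact_imp_bounded compact_continuous_image) auto
  then obtain L where L: "\<forall>y\<in>pospart'' e ` {-1..1}. \<bar>y\<bar> \<le> L" unfolding bounded_real by blast
  show ?thesis
  proof (rule that[of "max L 1"])
    fix z :: real assume "\<bar>z\<bar> \<le> 1"
    then have "pospart'' e z \<in> pospart'' e ` {-1..1}" by (intro imageI) auto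
    then show "pospart'' e z \<le> max L 1" using L by force
  qed simp
qed

end

subsection \<open>Stationary solutions and their mollification\<close>

text \<open>The elliptic problem without time: \<open>w\<close> and its weak gradient
  \<open>G\<close> are Borel representatives, with the bounds and the support of \<open>w\<close>
  holding everywhere, and \<open>a i\<close> stands for the drift coefficients. Global integrability
  can be asked of the gradient because it lives on \<open>K1\<close>.\<close>

locale stationary =
  fixes p :: "real ^ 'n::finite" and a :: "'n \<Rightarrow> real" and w :: "real ^ 'n \<Rightarrow> real" and G :: "'n \<Rightarrow> real ^ 'n \<Rightarrow> real"
  assumes p: "\<And>i. p $ i > 1" and a: "\<And>i. a i > 0"
    and w_measurable [measurable]: "w \<in> borel_measurable borel"
    and w_bounds: "\<And>y. 0 \<le> w y" "\<And>y. w y \<le> 1" and w_support: "\<And>y. y \<notin> K1 \<Longrightarrow> w y = 0"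
    and G_integrable: "\<And>i. integrable lborel (G i)"
    and G_powr_integrable: "\<And>i. integrable lborel (\<lambda>y. \<bar>G i y\<bar> powr (p $ i))"
    and weak: "\<And>i \<phi>. \<phi> \<in> Cc_infinity \<Longrightarrow> (\<integral>y. w y * pd \<phi> i y \<partial>lborel) = - (\<integral>y. G i y * \<phi> y \<partial>lborel)"
    and eq: "\<And>\<phi>. \<phi> \<in> Cc_infinity \<Longrightarrow>
      (\<integral>y. (\<Sum>i\<in>UNIV. (flux (p $ i) (G i y) + a i * y $ i * w y) * pd \<phi> i y) \<partial>lborel) = 0"
begin

lemma G_measurable [measurable]: "G i \<in> borel_measurable borel"
  using borel_measurable_integrable[OF G_integrable] by simp

lemma w_integrable: "integrable lborel w"
proof (rule bounded_support_integrable[OF w_measurable])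
  show "\<bar>w y\<bar> \<le> 1" for y using w_bounds[of y] by simp
  show "bounded (K1 :: (real ^ 'n) set)" unfolding K1_def by (rule bounded_coordinates)
qed (rule w_support)

text \<open>|G|^(p-1) is at most 1 where |G| <= 1, and at most |G|^p elsewhere.\<close>

lemma flux_mult_integrable:
  assumes "\<phi> \<in> Cc_infinity"
  shows "integrable lborel (\<lambda>y. flux (p $ i) (G i y) * \<phi> y)"
proof -
  obtain B where B: "B \<ge> 0" "\<And>x. \<bar>\<phi> x\<bar> \<le> B" using Cc_infinity_bounded[OF assms] by metis
  have [measurable]: "\<phi> \<in> borel_measurable borel" by (rule Cc_infinity_measurable[OF assms])
  have "integrable lborel (\<lambda>y. \<bar>\<phi> y\<bar> + B * \<bar>G i y\<bar> powr (p $ i))"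
    using Cc_infinity_integrable[OF assms] G_powr_integrable by auto
  then show ?thesis
  proof (rule Bochner_Integration.integrable_bound)
    have "\<bar>flux (p $ i) (G i y)\<bar> * \<bar>\<phi> y\<bar> \<le> \<bar>\<phi> y\<bar> + B * \<bar>G i y\<bar> powr (p $ i)" for y
    proof (cases "\<bar>G i y\<bar> \<le> 1")
      case True
      have "\<bar>flux (p $ i) (G i y)\<bar> \<le> 1"
        using True p[of i] powr_mono2[of "p $ i - 1" "\<bar>G i y\<bar>" 1] by (simp add: abs_flux)
      then have "\<bar>flux (p $ i) (G i y)\<bar> * \<bar>\<phi> y\<bar> \<le> 1 * \<bar>\<phi> y\<bar>" by (intro mult_right_mono) auto
      then show ?thesis using B by (simp add: add_increasing2)
    next
      case False
      have "\<bar>flux (p $ i) (G i y)\<bar> \<le> \<bar>G i y\<bar> powr (p $ i)"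
        using False by (simp add: abs_flux powr_mono)
      then have "\<bar>flux (p $ i) (G i y)\<bar> * \<bar>\<phi> y\<bar> \<le> \<bar>G i y\<bar> powr (p $ i) * B"
        using B by (intro mult_mono) auto
      then show ?thesis by (simp add: mult.commute)
    qed
    then show "AE y in lborel. norm (flux (p $ i) (G i y) * \<phi> y) \<le> norm (\<bar>\<phi> y\<bar> + B * \<bar>G i y\<bar> powr (p $ i))"
      using B by (auto simp: abs_mult)
  qed measurable
qed

text \<open>The distributional identity d_j(y_j w) = w + y_j d_j w, obtained by testing with y_j
  phi.\<close>

lemma weak_component:
  assumes "\<phi> \<in> Cc_infinity"
  shows "(\<integral>y. y $ j * w y * pd \<phi> j y \<partial>lborel) = - (\<integral>y. (y $ j * G j y + w y) * \<phi> y \<partial>lborel)"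
proof -
  note c = Cc_infinity_mult_component[OF assms, of j]
  have i1: "integrable lborel (\<lambda>y. w y * \<phi> y)" by (rule integrable_mult_Cc_infinity[OF w_integrable assms])
  have i2: "integrable lborel (\<lambda>y. w y * (y $ j * pd \<phi> j y))"
    by (rule integrable_mult_Cc_infinity[OF w_integrable Cc_infinity_mult_component(1)[OF Cc_infinity_derivative[OF assms]]])
  have i3: "integrable lborel (\<lambda>y. G j y * (y $ j * \<phi> y))"
    by (rule integrable_mult_Cc_infinity[OF G_integrable c(1)])
  have "(\<integral>y. w y * \<phi> y \<partial>lborel) + (\<integral>y. w y * (y $ j * pd \<phi> j y) \<partial>lborel)
      = (\<integral>y. w y * pd (\<lambda>y. y $ j * \<phi> y) j y \<partial>lborel)"
    unfolding c(2) using i1 i2 by (simp add: distrib_left)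
  also have "\<dots> = - (\<integral>y. G j y * (y $ j * \<phi> y) \<partial>lborel)" by (rule weak[OF c(1)])
  finally have "(\<integral>y. w y * (y $ j * pd \<phi> j y) \<partial>lborel)
      = - ((\<integral>y. G j y * (y $ j * \<phi> y) \<partial>lborel) + (\<integral>y. w y * \<phi> y \<partial>lborel))" by simp
  also have "\<dots> = - (\<integral>y. G j y * (y $ j * \<phi> y) + w y * \<phi> y \<partial>lborel)" using i1 i3 by simp
  finally show ?thesis by (simp add: algebra_simps)
qed

text \<open>In this nondivergence form the drift meets phi itself: with phi = J'(Z), a term y_j d_j
  Z times phi becomes y_j d_j J(Z).\<close>

lemma eq_split:
  assumes "\<phi> \<in> Cc_infinity"
  shows "(\<Sum>j\<in>UNIV. \<integral>y. flux (p $ j) (G j y) * pd \<phi> j y \<partial>lborel)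
    = (\<Sum>j\<in>UNIV. a j * (\<integral>y. (y $ j * G j y + w y) * \<phi> y \<partial>lborel))"
proof -
  note D = Cc_infinity_derivative[OF assms]
  have i1: "integrable lborel (\<lambda>y. flux (p $ j) (G j y) * pd \<phi> j y)" for j
    by (rule flux_mult_integrable[OF D])
  have i2: "integrable lborel (\<lambda>y. a j * (y $ j * w y * pd \<phi> j y))" for j
    using integrable_mult_Cc_infinity[OF w_integrable Cc_infinity_mult_component(1)[OF D], of j]
    by (simp add: mult_ac)
  have "0 = (\<integral>y. (\<Sum>j\<in>UNIV. flux (p $ j) (G j y) * pd \<phi> j y + a j * (y $ j * w y * pd \<phi> j y)) \<partial>lborel)"
    using eq[OF assms] by (simp add: distrib_right mult.assoc)
  also have "\<dots> = (\<Sum>j\<in>UNIV. (\<integral>y. flux (p $ j) (G j y) * pd \<phi> j y \<partial>lborel) + a j * (\<integral>y. y $ j * w y * pd \<phi> j y \<partial>lborel))"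
    using i1 i2 by simp
  finally show ?thesis
    unfolding weak_component[OF assms] by (simp add: sum.distrib sum_negf sum_subtractf)
qed

text \<open>The equation for \<open>w\<close> tested with \<open>\<phi> \<circ> R - \<phi>\<close>. Since the drift is centred at \<open>0\<close>,
  the reflection in \<open>y\<^sub>i = t\<close> leaves behind the term with the factor \<open>2 t\<close>, which becomes the
  \<open>t\<close>-derivative of a mass for the test function of the moving plane argument.\<close>

lemma reflected_equation:
  fixes i :: 'n and t :: real
  defines "R \<equiv> refl i t"
  assumes \<phi>: "\<phi> \<in> Cc_infinity"
  shows "(\<Sum>j\<in>UNIV. \<integral>y. (flux (p $ j) (sg i j * G j (R y)) - flux (p $ j) (G j y)) * pd \<phi> j y \<partial>lborel)
    = (\<Sum>j\<in>UNIV. a j * (\<integral>y. (y $ j * (sg i j * G j (R y) - G j y) + (w (R y) - w y)) * \<phi> y \<partial>lborel))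
      + 2 * t * a i * (\<integral>y. G i (R y) * \<phi> y \<partial>lborel)"
proof -
  have R: "lborel_preserving R" "\<And>y. R (R y) = y" by (simp_all add: R_def refl_preserving)
  have [measurable]: "R \<in> borel_measurable borel" by (simp add: R_def)
  define \<psi> where "\<psi> y = \<phi> (R y)" for y
  have \<psi>: "\<psi> \<in> Cc_infinity" unfolding \<psi>_def[abs_def] R_def by (rule Cc_infinity_refl[OF \<phi>])
  have pd\<psi>: "pd \<psi> j y = sg i j * pd \<phi> j (R y)" for j y
    unfolding \<psi>_def[abs_def] R_def by (rule pd_refl[OF \<phi>])
  have [measurable]: "\<phi> \<in> borel_measurable borel" "\<psi> \<in> borel_measurable borel"
      "pd \<phi> j \<in> borel_measurable borel" "pd \<psi> j \<in> borel_measurable borel" for j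
    using Cc_infinity_measurable \<phi> \<psi> Cc_infinity_derivative by blast+
  have int: "integrable lborel (\<lambda>y. flux (p $ j) (G j y) * pd \<phi> j y)"
      "integrable lborel (\<lambda>y. flux (p $ j) (G j y) * pd \<psi> j y)"
      "integrable lborel (\<lambda>y. (y $ j * G j y + w y) * \<phi> y)"
      "integrable lborel (\<lambda>y. (y $ j * G j y + w y) * \<psi> y)" for j
  proof -
    show "integrable lborel (\<lambda>y. flux (p $ j) (G j y) * pd \<phi> j y)"
      "integrable lborel (\<lambda>y. flux (p $ j) (G j y) * pd \<psi> j y)"
      by (intro flux_mult_integrable Cc_infinity_derivative \<phi> \<psi>)+
    have "integrable lborel (\<lambda>y. (y $ j * G j y + w y) * \<theta> y)" if "\<theta> \<in> Cc_infinity" for \<theta> :: "real ^ 'n \<Rightarrow> real"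
      using Bochner_Integration.integrable_add[OF
          integrable_mult_Cc_infinity[OF G_integrable[of j] Cc_infinity_mult_component(1)[OF that, of j]]
          integrable_mult_Cc_infinity[OF w_integrable that]]
      by (simp add: algebra_simps)
    then show "integrable lborel (\<lambda>y. (y $ j * G j y + w y) * \<phi> y)"
      "integrable lborel (\<lambda>y. (y $ j * G j y + w y) * \<psi> y)" using \<phi> \<psi> by blast+
  qed
  have f1: "flux (p $ j) (G j (R y)) * pd \<psi> j (R y) = flux (p $ j) (sg i j * G j (R y)) * pd \<phi> j y" for j y
    by (simp add: pd\<psi> R flux_sg mult_ac)
  have f2: "(R y $ j * G j (R y) + w (R y)) * \<psi> (R y) = (R y $ j * G j (R y) + w (R y)) * \<phi> y" for j y
    by (simp add: \<psi>_def R)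
  have int1: "integrable lborel (\<lambda>y. flux (p $ j) (sg i j * G j (R y)) * pd \<phi> j y)"
    and eq1: "(\<integral>y. flux (p $ j) (sg i j * G j (R y)) * pd \<phi> j y \<partial>lborel) = (\<integral>y. flux (p $ j) (G j y) * pd \<psi> j y \<partial>lborel)" for j
    using preserving_integrable[OF R(1), of "\<lambda>y. flux (p $ j) (G j y) * pd \<psi> j y"] int(2)[of j]
      preserving_integral[OF R(1), of "\<lambda>y. flux (p $ j) (G j y) * pd \<psi> j y"]
    unfolding f1 by simp_all
  have int2: "integrable lborel (\<lambda>y. (R y $ j * G j (R y) + w (R y)) * \<phi> y)"
    and eq2: "(\<integral>y. (R y $ j * G j (R y) + w (R y)) * \<phi> y \<partial>lborel) = (\<integral>y. (y $ j * G j y + w y) * \<psi> y \<partial>lborel)" for j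
    using preserving_integrable[OF R(1), of "\<lambda>y. (y $ j * G j y + w y) * \<psi> y"] int(4)[of j]
      preserving_integral[OF R(1), of "\<lambda>y. (y $ j * G j y + w y) * \<psi> y"]
    unfolding f2 by simp_all
  have int3: "integrable lborel (\<lambda>y. G i (R y) * \<phi> y)"
    using integrable_mult_Cc_infinity[OF _ \<phi>, of "\<lambda>y. G i (R y)"] preserving_integrable[OF R(1), of "G i"] G_integrable
    by simp
  have "(\<Sum>j\<in>UNIV. \<integral>y. (flux (p $ j) (sg i j * G j (R y)) - flux (p $ j) (G j y)) * pd \<phi> j y \<partial>lborel)
      = (\<Sum>j\<in>UNIV. \<integral>y. flux (p $ j) (G j y) * pd \<psi> j y \<partial>lborel) - (\<Sum>j\<in>UNIV. \<integral>y. flux (p $ j) (G j y) * pd \<phi> j y \<partial>lborel)"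
    unfolding left_diff_distrib sum_subtractf[symmetric] eq1[symmetric] using int1 int(1) by simp
  also have "\<dots> = (\<Sum>j\<in>UNIV. a j * (\<integral>y. (R y $ j * G j (R y) + w (R y)) * \<phi> y - (y $ j * G j y + w y) * \<phi> y \<partial>lborel))"
    unfolding eq_split[OF \<phi>] eq_split[OF \<psi>] eq2[symmetric] sum_subtractf[symmetric] right_diff_distrib[symmetric]
    using int2 int(3) by simp
  also have "\<dots> = (\<Sum>j\<in>UNIV. a j * ((\<integral>y. (y $ j * (sg i j * G j (R y) - G j y) + (w (R y) - w y)) * \<phi> y \<partial>lborel)
      + (if j = i then 2 * t * (\<integral>y. G i (R y) * \<phi> y \<partial>lborel) else 0)))"
  proof (intro sum.cong arg_cong[of _ _ "\<lambda>x. a _ * x"] refl)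
    fix j
    \<comment> \<open>The i-th coordinate of R y is 2 t - y_i: its sign is absorbed in
      \<open>sg i i\<close>, and 2 t remains.\<close>
    define c where "c = (if j = i then 2 * t else 0)"
    have pw: "(R y $ j * G j (R y) + w (R y)) * \<phi> y - (y $ j * G j y + w y) * \<phi> y
        = (y $ j * (sg i j * G j (R y) - G j y) + (w (R y) - w y)) * \<phi> y + c * (G i (R y) * \<phi> y)" for y
      by (simp add: R_def refl_nth sg_def c_def algebra_simps)
    have "integrable lborel (\<lambda>y. ((R y $ j * G j (R y) + w (R y)) * \<phi> y - (y $ j * G j y + w y) * \<phi> y) - c * (G i (R y) * \<phi> y))"
      using int2 int(3) int3 by simp
    then have "integrable lborel (\<lambda>y. (y $ j * (sg i j * G j (R y) - G j y) + (w (R y) - w y)) * \<phi> y)"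
      unfolding pw by simp
    then show "(\<integral>y. (R y $ j * G j (R y) + w (R y)) * \<phi> y - (y $ j * G j y + w y) * \<phi> y \<partial>lborel)
        = (\<integral>y. (y $ j * (sg i j * G j (R y) - G j y) + (w (R y) - w y)) * \<phi> y \<partial>lborel)
          + (if j = i then 2 * t * (\<integral>y. G i (R y) * \<phi> y \<partial>lborel) else 0)"
      unfolding pw using int3 by (simp add: c_def)
  qed
  also have "\<dots> = (\<Sum>j\<in>UNIV. a j * (\<integral>y. (y $ j * (sg i j * G j (R y) - G j y) + (w (R y) - w y)) * \<phi> y \<partial>lborel))
      + 2 * t * a i * (\<integral>y. G i (R y) * \<phi> y \<partial>lborel)"
    by (simp add: distrib_left sum.distrib if_distrib[of "\<lambda>x. a _ * x"] cong: if_cong)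
  finally show ?thesis .
qed

text \<open>Reflection at t = 0 leaves the drift, centred at 0, invariant. Thus comparisons proved
  for planes with t > 0 transfer to negative coordinates.\<close>

lemma stationary_flip: "stationary p a (\<lambda>y. w (refl i 0 y)) (\<lambda>j y. sg i j * G j (refl i 0 y))"
proof -
  let ?R = "refl i 0"
  note R = refl_preserving[of i 0]
  have Gint: "integrable lborel (\<lambda>y. G j (?R y))" for j
    using preserving_integrable[OF R, of "G j"] G_integrable by simp
  show ?thesis
  proof (rule stationary.intro)
    show "w (?R y) = 0" if "y \<notin> K1" for y
    proof -
      have "\<bar>?R y $ j\<bar> = \<bar>y $ j\<bar>" for j by (simp add: refl_nth)
      then show ?thesis using that w_support by (simp add: K1_def)
    qed
    show "integrable lborel (\<lambda>y. sg i j * G j (?R y))" for j using Gint by simp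
    have "\<bar>sg i j * x\<bar> = \<bar>x\<bar>" for j x by (simp add: sg_def)
    then show "integrable lborel (\<lambda>y. \<bar>sg i j * G j (?R y)\<bar> powr (p $ j))" for j
      using preserving_integrable[OF R, of "\<lambda>y. \<bar>G j y\<bar> powr (p $ j)"] G_powr_integrable by simp
  next
    fix j \<phi> assume \<phi>: "\<phi> \<in> (Cc_infinity :: (real ^ 'n \<Rightarrow> real) set)"
    let ?\<psi> = "\<lambda>y. \<phi> (?R y)"
    have \<psi>: "?\<psi> \<in> Cc_infinity" by (rule Cc_infinity_refl[OF \<phi>])
    have [measurable]: "\<phi> \<in> borel_measurable borel" "pd \<phi> j \<in> borel_measurable borel"
      using Cc_infinity_measurable \<phi> Cc_infinity_derivative by blast+
    have "(\<integral>y. w (?R y) * pd \<phi> j y \<partial>lborel) = (\<integral>y. w (?R (?R y)) * pd \<phi> j (?R y) \<partial>lborel)"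
      using preserving_integral[OF R, of "\<lambda>y. w (?R y) * pd \<phi> j y"] by simp
    also have "\<dots> = sg i j * (\<integral>y. w y * pd ?\<psi> j y \<partial>lborel)"
      unfolding pd_refl[OF \<phi>] by (simp add: sg_def)
    also have "\<dots> = - (\<integral>y. sg i j * G j (?R (?R y)) * \<phi> (?R y) \<partial>lborel)"
      unfolding weak[OF \<psi>] by (simp add: mult.assoc)
    also have "\<dots> = - (\<integral>y. sg i j * G j (?R y) * \<phi> y \<partial>lborel)"
      using preserving_integral[OF R, of "\<lambda>y. sg i j * G j (?R y) * \<phi> y"] by simp
    finally show "(\<integral>y. w (?R y) * pd \<phi> j y \<partial>lborel) = - (\<integral>y. sg i j * G j (?R y) * \<phi> y \<partial>lborel)" .
  next
    fix \<phi> assume \<phi>: "\<phi> \<in> (Cc_infinity :: (real ^ 'n \<Rightarrow> real) set)"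
    let ?\<psi> = "\<lambda>y. \<phi> (?R y)"
    have \<psi>: "?\<psi> \<in> Cc_infinity" by (rule Cc_infinity_refl[OF \<phi>])
    have [measurable]: "pd \<phi> j \<in> borel_measurable borel" for j
      using Cc_infinity_measurable \<phi> Cc_infinity_derivative by blast+
    have "(\<integral>y. (\<Sum>j\<in>UNIV. (flux (p $ j) (sg i j * G j (?R y)) + a j * y $ j * w (?R y)) * pd \<phi> j y) \<partial>lborel)
        = (\<integral>y. (\<Sum>j\<in>UNIV. (flux (p $ j) (sg i j * G j (?R (?R y))) + a j * ?R y $ j * w (?R (?R y))) * pd \<phi> j (?R y)) \<partial>lborel)"
      using preserving_integral[OF R, of "\<lambda>y. (\<Sum>j\<in>UNIV. (flux (p $ j) (sg i j * G j (?R y)) + a j * y $ j * w (?R y)) * pd \<phi> j y)"]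
      by simp
    also have "\<dots> = (\<integral>y. (\<Sum>j\<in>UNIV. (flux (p $ j) (G j y) + a j * y $ j * w y) * pd ?\<psi> j y) \<partial>lborel)"
      unfolding pd_refl[OF \<phi>] flux_sg
      by (intro Bochner_Integration.integral_cong sum.cong) (auto simp: refl_nth sg_def algebra_simps)
    also have "\<dots> = 0" by (rule eq[OF \<psi>])
    finally show "(\<integral>y. (\<Sum>j\<in>UNIV. (flux (p $ j) (sg i j * G j (?R y)) + a j * y $ j * w (?R y)) * pd \<phi> j y) \<partial>lborel) = 0" .
  qed (use p a w_bounds in \<open>auto\<close>)
qed

end

section \<open>The mollified reflected difference and the moving plane estimates\<close>

lemma integrable_if_nn_integral_le:
  fixes f :: "'a \<Rightarrow> real"
  assumes "f \<in> borel_measurable M" and "\<And>x. f x \<ge> 0" and "(\<integral>\<^sup>+x. ennreal (f x) \<partial>M) \<le> ennreal e" and "e \<ge> 0"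
  shows "integrable M f" and "(\<integral>x. f x \<partial>M) \<le> e"
proof -
  show i: "integrable M f"
    by (rule integrableI_nonneg) (use assms in \<open>auto intro: le_less_trans\<close>)
  have "ennreal (\<integral>x. f x \<partial>M) \<le> ennreal e"
    using assms(3) nn_integral_eq_integral[OF i] assms(2) by simp
  then show "(\<integral>x. f x \<partial>M) \<le> e" using assms(4) by simp
qed

context stationary
begin

definition wd :: "real \<Rightarrow> real ^ 'n \<Rightarrow> real" where
  "wd d = mol (ker d) w"

definition Gd :: "real \<Rightarrow> 'n \<Rightarrow> real ^ 'n \<Rightarrow> real" where
  "Gd d j = mol (ker d) (G j)"

definition Zd :: "real \<Rightarrow> 'n \<Rightarrow> real \<Rightarrow> real ^ 'n \<Rightarrow> real" where
  "Zd d i t y = wd d (refl i t y) - wd d y"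

text \<open>The j-th partial derivative of \<open>Zd d i t\<close>.\<close>

definition Yd :: "real \<Rightarrow> 'n \<Rightarrow> real \<Rightarrow> 'n \<Rightarrow> real ^ 'n \<Rightarrow> real" where
  "Yd d i t j y = sg i j * Gd d j (refl i t y) - Gd d j y"

text \<open>With f = \<open>pospart' e\<close> this is the test function, with f =
  \<open>pospart e\<close> the density of the mass M(t).\<close>

definition cut :: "real \<Rightarrow> 'n \<Rightarrow> real \<Rightarrow> (real \<Rightarrow> real) \<Rightarrow> real ^ 'n \<Rightarrow> real" where
  "cut d i t f y = (if y $ i < t then f (Zd d i t y) else 0)"

text \<open>Mollification at scale d <= 1 spreads \<open>K1\<close> to at most |y_k| < 3/2, and a
  reflection with 0 <= t <= 1/2 changes the modulus of a coordinate by at most 1; so Q contains the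
  supports of all reflected differences.\<close>

definition Q :: "(real ^ 'n) set" where
  "Q = {y. \<forall>k. \<bar>y $ k\<bar> \<le> 5 / 2}"

definition Ew :: "real \<Rightarrow> real ^ 'n \<Rightarrow> real" where
  "Ew d y = \<bar>wd d y - w y\<bar>"

definition EG :: "real \<Rightarrow> 'n \<Rightarrow> real ^ 'n \<Rightarrow> real" where
  "EG d j y = \<bar>Gd d j y - G j y\<bar>"

definition Kw :: "real \<Rightarrow> 'n \<Rightarrow> (real ^ 'n \<Rightarrow> real ^ 'n) \<Rightarrow> real ^ 'n \<Rightarrow> real" where
  "Kw d j T y = \<bar>G j (T y)\<bar> powr (p $ j - 1) * EG d j y"

lemma Q_bounded: "bounded Q"
  unfolding Q_def by (rule bounded_coordinates)

lemma Q_cbox: "Q = cbox (\<chi> k. - (5 / 2)) (\<chi> k. 5 / 2)"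
proof -
  have *: "\<bar>r\<bar> \<le> 5 / 2 \<longleftrightarrow> - (5 / 2) \<le> r \<and> r \<le> 5 / 2" for r :: real by linarith
  show ?thesis
    by (rule set_eqI) (simp only: Q_def mem_Collect_eq mem_box_cart vec_lambda_beta *)
qed

text \<open>The third clause ranges over all measure-preserving maps, so that one d controls the
  flux errors for every position of the plane at once.\<close>

definition good :: "real \<Rightarrow> real \<Rightarrow> bool" where
  "good e d \<longleftrightarrow> (\<integral>\<^sup>+x. ennreal \<bar>wd d x - w x\<bar> \<partial>lborel) \<le> ennreal e \<and>
     (\<forall>j. (\<integral>\<^sup>+x. ennreal \<bar>Gd d j x - G j x\<bar> \<partial>lborel) \<le> ennreal e) \<and>
     (\<forall>j T. lborel_preserving T \<longrightarrow>
        (\<integral>\<^sup>+x. ennreal (\<bar>G j (T x)\<bar> powr (p $ j - 1) * \<bar>Gd d j x - G j x\<bar>) \<partial>lborel) \<le> ennreal e)"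

lemma good_exists:
  assumes e: "e > 0"
  obtains d where "0 < d" "d \<le> 1" "good e d"
proof -
  have ev: "eventually P (at_right 0)" if "\<exists>d0>0. \<forall>d. 0 < d \<and> d < d0 \<longrightarrow> P d" for P :: "real \<Rightarrow> bool"
    using that unfolding eventually_at_right_field by auto
  have "eventually (\<lambda>d. \<forall>j T. lborel_preserving T \<longrightarrow>
        (\<integral>\<^sup>+x. ennreal (\<bar>G j (T x)\<bar> powr (p $ j - 1) * \<bar>Gd d j x - G j x\<bar>) \<partial>lborel) \<le> ennreal e) (at_right 0)"
  proof (rule eventually_all_finite)
    fix j
    show "eventually (\<lambda>d. \<forall>T. lborel_preserving T \<longrightarrow>
        (\<integral>\<^sup>+x. ennreal (\<bar>G j (T x)\<bar> powr (p $ j - 1) * \<bar>Gd d j x - G j x\<bar>) \<partial>lborel) \<le> ennreal e) (at_right 0)"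
      unfolding Gd_def using mol_ker_weighted[OF G_integrable G_powr_integrable p e] by (intro ev) blast
  qed
  moreover have "eventually (\<lambda>d. \<forall>j. (\<integral>\<^sup>+x. ennreal \<bar>Gd d j x - G j x\<bar> \<partial>lborel) \<le> ennreal e) (at_right 0)"
    unfolding Gd_def by (intro eventually_all_finite ev mol_ker_L1 G_integrable e)
  moreover have "eventually (\<lambda>d. (\<integral>\<^sup>+x. ennreal \<bar>wd d x - w x\<bar> \<partial>lborel) \<le> ennreal e) (at_right 0)"
    unfolding wd_def by (intro ev mol_ker_L1 w_integrable e)
  moreover have "eventually (\<lambda>d. 0 < d \<and> d \<le> 1) (at_right (0 :: real))"
    unfolding eventually_at_right_field by (intro exI[of _ 1]) auto
  ultimately have "eventually (\<lambda>d. 0 < d \<and> d \<le> 1 \<and> good e d) (at_right 0)"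
    unfolding good_def by eventually_elim blast
  then have "\<exists>d. 0 < d \<and> d \<le> 1 \<and> good e d"
    by (rule eventually_happens'[rotated]) (rule trivial_limit_at_right_real)
  then show ?thesis using that by blast
qed

context
  fixes d :: real
  assumes d: "0 < d" "d \<le> 1"
begin

lemma wd_Ck: "Ck_on k UNIV (wd d)"
  unfolding wd_def by (rule mol_Ck[OF w_integrable ker_Cc_infinity[OF d(1)]])

lemma Gd_Ck: "Ck_on k UNIV (Gd d j)"
  unfolding Gd_def by (rule mol_Ck[OF G_integrable ker_Cc_infinity[OF d(1)]])

lemma wd_continuous: "continuous_on S (wd d)"
  by (rule continuous_on_subset[OF Ck_Suc_imp_continuous[OF wd_Ck]]) simp

lemma Gd_continuous: "continuous_on S (Gd d j)"
  by (rule continuous_on_subset[OF Ck_Suc_imp_continuous[OF Gd_Ck]]) simp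

lemma wd_measurable [measurable]: "wd d \<in> borel_measurable borel"
  by (intro borel_measurable_continuous_onI wd_continuous)

lemma Gd_measurable [measurable]: "Gd d j \<in> borel_measurable borel"
  by (intro borel_measurable_continuous_onI Gd_continuous)

lemma wd_bounds: "0 \<le> wd d y" "wd d y \<le> 1"
proof -
  note k = ker_Cc_infinity[OF d(1), where 'n = 'n]
  show "0 \<le> wd d y"
    unfolding wd_def mol_def by (intro Bochner_Integration.integral_nonneg mult_nonneg_nonneg w_bounds ker_nonneg d)
  have "wd d y \<le> (\<integral>z. ker d (y - z) \<partial>lborel)"
    unfolding wd_def mol_def
  proof (rule integral_mono)
    show "integrable lborel (\<lambda>z. w z * ker d (y - z))" by (rule mol_integrable[OF w_integrable k])
    show "integrable lborel (\<lambda>z. ker d (y - z))"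
      by (rule Cc_infinity_integrable[OF Cc_infinity_reflect[OF k]])
    show "w z * ker d (y - z) \<le> ker d (y - z)" for z
      using mult_right_mono[OF w_bounds(2)[of z] ker_nonneg[OF d(1), of "y - z"]] by simp
  qed
  also have "\<dots> = 1"
    using preserving_integral[OF preserving_point_reflection Cc_infinity_measurable[OF k], of y] ker_integral[OF d(1), where 'n = 'n] by simp
  finally show "wd d y \<le> 1" .
qed

lemma wd_support:
  assumes "\<bar>y $ k\<bar> \<ge> 3 / 2"
  shows "wd d y = 0"
proof -
  have "w z * ker d (y - z) = 0" for z
  proof (cases "z \<in> K1")
    case True
    then have "\<bar>z $ k\<bar> \<le> 1 / 2" by (simp add: K1_def)
    then have "d \<le> \<bar>(y - z) $ k\<bar>" using assms d by simp
    from ker_zero[OF d(1) this] show ?thesis by simp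
  qed (simp add: w_support)
  then show ?thesis by (simp only: wd_def mol_def Bochner_Integration.integral_zero)
qed

lemma wd_has_derivative: "(wd d has_derivative frechet_derivative (wd d) (at y)) (at y)"
  by (rule Ck_SucD(1)[OF wd_Ck])

text \<open>The weak derivative is tested with the kernel centred at y; differentiating in y or in z
  differs by a sign, which cancels the one in \<open>weak\<close>.\<close>

lemma pd_wd: "pd (wd d) j y = Gd d j y"
proof -
  note k = ker_Cc_infinity[OF d(1), where 'n = 'n]
  define \<phi> :: "real ^ 'n \<Rightarrow> real" where "\<phi> z = ker d (y - z)" for z
  have \<phi>: "\<phi> \<in> Cc_infinity" unfolding \<phi>_def[abs_def] by (rule Cc_infinity_reflect[OF k])
  have "(\<phi> has_derivative (\<lambda>v. frechet_derivative (ker d) (at (y - z)) (- v))) (at z)" for z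
    unfolding \<phi>_def[abs_def]
    by (rule has_derivative_compose[OF _ Cc_infinity_has_derivative[OF k]]) (auto intro!: derivative_eq_intros)
  from frechet_derivative_at[OF this, symmetric]
  have pd\<phi>: "pd \<phi> j z = - pd (ker d) j (y - z)" for z
    using linear_neg[OF has_derivative_linear[OF Cc_infinity_has_derivative[OF k]]] by simp
  have "pd (wd d) j y = mol (pd (ker d) j) w y"
    unfolding wd_def using frechet_derivative_at[OF mol_has_derivative[OF w_integrable k], of y, symmetric] by simp
  also have "\<dots> = - (\<integral>z. w z * pd \<phi> j z \<partial>lborel)" unfolding pd\<phi> by (simp add: mol_def)
  also have "\<dots> = Gd d j y" unfolding weak[OF \<phi>] by (simp add: Gd_def mol_def \<phi>_def)
  finally show ?thesis .
qed

context
  fixes i :: 'n and t e :: real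
  assumes t: "0 \<le> t" "t \<le> 1 / 2" and e: "e > 0"
begin

abbreviation R where "R \<equiv> refl i t"

lemma Zd_Ck: "Ck_on k UNIV (Zd d i t)"
proof -
  have "Ck_on k UNIV (\<lambda>y. wd d (R y) + - 1 * wd d y)"
    unfolding refl_def by (intro Ck_add Ck_mult Ck_const Ck_affine_comp bounded_linear_flip wd_Ck)
  then show ?thesis by (simp add: Zd_def[abs_def])
qed

lemma Zd_continuous: "continuous_on S (Zd d i t)"
  by (rule continuous_on_subset[OF Ck_Suc_imp_continuous[OF Zd_Ck]]) simp

lemma Zd_has_derivative:
  "(Zd d i t has_derivative (\<lambda>v. frechet_derivative (wd d) (at (R y)) (flip i v) - frechet_derivative (wd d) (at y) v)) (at y)"
  unfolding Zd_def[abs_def]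
  by (intro has_derivative_diff wd_has_derivative has_derivative_compose[OF refl_has_derivative])

lemma Zd_bound: "\<bar>Zd d i t y\<bar> \<le> 1"
  using wd_bounds[of y] wd_bounds[of "R y"] by (simp add: Zd_def)

lemma Zd_hyperplane: "y $ i = t \<Longrightarrow> Zd d i t y = 0"
proof -
  assume "y $ i = t"
  then have "R y = y" by (simp add: vec_eq_iff refl_nth)
  then show ?thesis by (simp add: Zd_def)
qed

lemma Zd_support: "y \<notin> Q \<Longrightarrow> Zd d i t y = 0"
proof -
  assume "y \<notin> Q"
  then obtain k where "\<bar>y $ k\<bar> > 5 / 2" by (auto simp: Q_def not_le)
  moreover have "\<bar>2 * t - y $ k\<bar> \<ge> \<bar>y $ k\<bar> - 1" using t by linarith
  ultimately have "\<bar>y $ k\<bar> \<ge> 3 / 2" "\<bar>R y $ k\<bar> \<ge> 3 / 2" by (auto simp: refl_nth)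
  then show ?thesis using wd_support by (simp add: Zd_def)
qed

text \<open>Z vanishes on the hyperplane and f below e, so f(Z) vanishes on the open neighbourhood Z
  < e of the hyperplane, and the cut there stays smooth.\<close>

lemma cut_smooth:
  assumes f: "\<And>z. (f has_real_derivative f' z) (at z)" "\<And>z. z \<le> e \<Longrightarrow> f z = 0"
    and Ck: "\<And>k. Ck_on k UNIV (\<lambda>y. f (Zd d i t y))"
  shows "cut d i t f \<in> Cc_infinity" and "pd (cut d i t f) j y = cut d i t f' y * Yd d i t j y"
proof -
  define U where "U = {y. Zd d i t y < e}"
  have U: "open U" "{y. y $ i = t} \<subseteq> U"
    using Zd_hyperplane e by (auto simp: U_def intro!: open_Collect_less Zd_continuous continuous_on_const)
  have f0: "f (Zd d i t y) = 0" if "y \<in> U" for y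
    using that by (intro f(2)) (simp add: U_def)
  show "cut d i t f \<in> Cc_infinity"
  proof (rule Cc_infinityI[OF _ Q_bounded])
    show "Ck_on k UNIV (cut d i t f)" for k
      unfolding cut_def[abs_def] by (rule Ck_cutoff_halfspace[OF U Ck f0])
    show "cut d i t f y = 0" if "y \<notin> Q" for y
      using f(2)[of 0] e by (simp add: cut_def Zd_support[OF that])
  qed
  have "((\<lambda>y. f (Zd d i t y)) has_derivative (\<lambda>v. f' (Zd d i t y) *
      (frechet_derivative (wd d) (at (R y)) (flip i v) - frechet_derivative (wd d) (at y) v))) (at y)"
    using has_derivative_compose[OF Zd_has_derivative f(1)[unfolded has_field_derivative_def]] .
  note has_derivative_cutoff_halfspace[OF U f0 this]
  from frechet_derivative_at[OF this, symmetric]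
  have "pd (cut d i t f) j y = (if y $ i < t then f' (Zd d i t y) *
      (frechet_derivative (wd d) (at (R y)) (flip i (axis j 1)) - pd (wd d) j y) else 0)"
    by (simp add: cut_def[abs_def])
  also have "\<dots> = cut d i t f' y * Yd d i t j y"
    using linear_cmul[OF has_derivative_linear[OF wd_has_derivative[of "R y"]]]
    by (simp add: cut_def Yd_def flip_axis pd_wd)
  finally show "pd (cut d i t f) j y = cut d i t f' y * Yd d i t j y" .
qed

lemmas cut_pospart = cut_smooth[OF pospart_DERIV[OF e] pospart_eq_0(1)[OF e] Ck_pospart(1)[OF e Zd_Ck]]
lemmas cut_pospart' = cut_smooth[OF pospart'_DERIV[OF e] pospart_eq_0(2)[OF e] Ck_pospart(2)[OF e Zd_Ck]]

context
  fixes c :: real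
  assumes good: "good c d" and c: "c > 0"
begin

lemma E_measurable [measurable]: "(Ew d) \<in> borel_measurable borel" "EG d j \<in> borel_measurable borel"
  unfolding Ew_def[abs_def] EG_def[abs_def] by measurable

lemma Ew: "integrable lborel (Ew d)" "(\<integral>y. Ew d y \<partial>lborel) \<le> c"
    "integrable lborel (\<lambda>y. Ew d (R y))" "(\<integral>y. Ew d (R y) \<partial>lborel) \<le> c"
proof -
  show *: "integrable lborel (Ew d)" "(\<integral>y. Ew d y \<partial>lborel) \<le> c"
    by (rule integrable_if_nn_integral_le[of "Ew d" lborel c]; use good c in \<open>auto simp: good_def Ew_def\<close>)+
  show "integrable lborel (\<lambda>y. Ew d (R y))" "(\<integral>y. Ew d (R y) \<partial>lborel) \<le> c"
    using * preserving_integrable[OF refl_preserving E_measurable(1)] preserving_integral[OF refl_preserving E_measurable(1)]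
    by simp_all
qed

lemma EG: "integrable lborel (EG d j)" "(\<integral>y. EG d j y \<partial>lborel) \<le> c"
    "integrable lborel (\<lambda>y. EG d j (R y))" "(\<integral>y. EG d j (R y) \<partial>lborel) \<le> c"
proof -
  show *: "integrable lborel (EG d j)" "(\<integral>y. EG d j y \<partial>lborel) \<le> c"
    by (rule integrable_if_nn_integral_le[of "EG d j" lborel c]; use good c in \<open>auto simp: good_def EG_def\<close>)+
  show "integrable lborel (\<lambda>y. EG d j (R y))" "(\<integral>y. EG d j (R y) \<partial>lborel) \<le> c"
    using * preserving_integrable[OF refl_preserving E_measurable(2)] preserving_integral[OF refl_preserving E_measurable(2)]
    by simp_all
qed

lemma Kw:
  assumes T: "lborel_preserving T"
  shows "integrable lborel (Kw d j T)" "(\<integral>y. Kw d j T y \<partial>lborel) \<le> c"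
    "integrable lborel (\<lambda>y. Kw d j T (R y))" "(\<integral>y. Kw d j T (R y) \<partial>lborel) \<le> c"
proof -
  have [measurable]: "T \<in> borel_measurable borel" using T by (simp add: lborel_preserving_def)
  have m: "Kw d j T \<in> borel_measurable borel" unfolding Kw_def[abs_def] by measurable
  show *: "integrable lborel (Kw d j T)" "(\<integral>y. Kw d j T y \<partial>lborel) \<le> c"
    by (rule integrable_if_nn_integral_le[of "Kw d j T" lborel c]; use good c T m in \<open>auto simp: good_def Kw_def EG_def\<close>)+
  show "integrable lborel (\<lambda>y. Kw d j T (R y))" "(\<integral>y. Kw d j T (R y) \<partial>lborel) \<le> c"
    using * preserving_integrable[OF refl_preserving m] preserving_integral[OF refl_preserving m]
    by simp_all
qed

text \<open>The flux difference times the difference of the true gradients is nonnegative by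
  monotonicity. What is left is that gradient difference against its mollified version, bounded by
  two flux sizes times two gradient errors: four weighted errors, each with integral at most
  c.\<close>

lemma flux_term_bound:
  assumes L: "\<And>z. \<bar>z\<bar> \<le> 1 \<Longrightarrow> pospart'' e z \<le> L"
  shows "- (4 * L * c) \<le> (\<integral>y. (flux (p $ j) (sg i j * G j (R y)) - flux (p $ j) (G j y)) * pd (cut d i t (pospart' e)) j y \<partial>lborel)"
proof -
  have L0: "L \<ge> 0" using L[of 0] pospart''_nonneg[OF e, of 0] by simp
  define F where "F y = L * (Kw d j id (R y) + Kw d j R (R y) + Kw d j R y + Kw d j id y)" for y
  have id: "lborel_preserving (id :: real ^ 'n \<Rightarrow> _)" using preserving_translation[of 0] by (simp add: id_def)
  note K = Kw[OF id, of j] Kw[OF refl_preserving, of j]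
  have "integrable lborel F" unfolding F_def[abs_def] using K by auto
  moreover have "- ((flux (p $ j) (sg i j * G j (R y)) - flux (p $ j) (G j y)) * pd (cut d i t (pospart' e)) j y) \<le> F y" for y
  proof (cases "y $ i < t")
    case True
    define B where "B = flux (p $ j) (sg i j * G j (R y)) - flux (p $ j) (G j y)"
    define Z where "Z = sg i j * G j (R y) - G j y"
    define q where "q = pospart'' e (Zd d i t y)"
    have q: "0 \<le> q" "q \<le> L" unfolding q_def by (rule pospart''_nonneg[OF e]) (rule L[OF Zd_bound])
    have "B * Z \<ge> 0" unfolding B_def Z_def by (rule flux_diff_mult_nonneg[OF p])
    then have "q * (B * Z) \<ge> 0" using q by simp
    moreover have "- (q * (B * (Yd d i t j y - Z))) \<le> L * (\<bar>B\<bar> * \<bar>Yd d i t j y - Z\<bar>)"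
    proof -
      have "- (q * (B * (Yd d i t j y - Z))) \<le> q * (\<bar>B\<bar> * \<bar>Yd d i t j y - Z\<bar>)"
        using mult_left_mono[OF abs_ge_minus_self[of "B * (Yd d i t j y - Z)"] q(1)] by (simp add: abs_mult)
      also have "\<dots> \<le> L * (\<bar>B\<bar> * \<bar>Yd d i t j y - Z\<bar>)" using q by (intro mult_right_mono) auto
      finally show ?thesis .
    qed
    moreover have "\<bar>B\<bar> * \<bar>Yd d i t j y - Z\<bar>
        \<le> (\<bar>G j (R y)\<bar> powr (p $ j - 1) + \<bar>G j y\<bar> powr (p $ j - 1)) * (EG d j (R y) + EG d j y)"
    proof (intro mult_mono)
      have "\<bar>B\<bar> \<le> \<bar>flux (p $ j) (sg i j * G j (R y))\<bar> + \<bar>flux (p $ j) (G j y)\<bar>" unfolding B_def by (rule abs_triangle_ineq4)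
      also have "\<dots> = \<bar>G j (R y)\<bar> powr (p $ j - 1) + \<bar>G j y\<bar> powr (p $ j - 1)"
        unfolding abs_flux by (simp add: abs_mult sg_def)
      finally show "\<bar>B\<bar> \<le> \<bar>G j (R y)\<bar> powr (p $ j - 1) + \<bar>G j y\<bar> powr (p $ j - 1)" .
      show "\<bar>Yd d i t j y - Z\<bar> \<le> EG d j (R y) + EG d j y" by (auto simp: Yd_def Z_def EG_def sg_def)
    qed auto
    then have "L * (\<bar>B\<bar> * \<bar>Yd d i t j y - Z\<bar>) \<le> F y"
      unfolding F_def Kw_def using L0 by (intro mult_left_mono) (auto simp: algebra_simps)
    moreover have "B * pd (cut d i t (pospart' e)) j y = q * (B * Z) + q * (B * (Yd d i t j y - Z))"
      using True by (simp add: cut_pospart'(2) cut_def q_def algebra_simps)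
    ultimately show ?thesis unfolding B_def[symmetric] by linarith
  next
    case False
    then show ?thesis using L0 by (simp add: cut_pospart'(2) cut_def F_def Kw_def EG_def)
  qed
  moreover have "F y \<ge> 0" for y using L0 by (simp add: F_def Kw_def EG_def)
  ultimately have "(\<integral>y. - ((flux (p $ j) (sg i j * G j (R y)) - flux (p $ j) (G j y)) * pd (cut d i t (pospart' e)) j y) \<partial>lborel) \<le> (\<integral>y. F y \<partial>lborel)"
    by (rule integral_mono')
  also have "\<dots> = L * ((\<integral>y. Kw d j id (R y) \<partial>lborel) + (\<integral>y. Kw d j R (R y) \<partial>lborel) + (\<integral>y. Kw d j R y \<partial>lborel) + (\<integral>y. Kw d j id y \<partial>lborel))"
    unfolding F_def using K by simp
  also have "\<dots> \<le> L * (c + c + c + c)" using K L0 by (intro mult_left_mono add_mono) auto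
  finally show ?thesis by simp
qed

text \<open>After mollifying, y_j d_j J(Z) integrates to minus the integral of J(Z), which meets the
  integral of Z J'(Z) up to 2 e on Q. The error 7 c is 5/2 times two gradient errors, as |y_j| <=
  5/2 on Q, plus two errors of w.\<close>

lemma drift_term_bound:
  "(\<integral>y. (y $ j * (sg i j * G j (R y) - G j y) + (w (R y) - w y)) * cut d i t (pospart' e) y \<partial>lborel)
    \<le> 2 * e * measure lborel Q + 7 * c"
proof -
  let ?\<phi> = "cut d i t (pospart' e)"
  note \<phi> = cut_pospart'(1)
  have \<phi>01: "0 \<le> ?\<phi> y" "?\<phi> y \<le> 1" for y using pospart'_bounds[OF e] by (simp_all add: cut_def)
  have \<phi>Q: "?\<phi> y = 0" if "y \<notin> Q" for y
    using e by (simp add: cut_def Zd_support[OF that] pospart_eq_0[OF e])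
  have GR: "integrable lborel (\<lambda>y. G j (R y))" "integrable lborel (\<lambda>y. w (R y))"
    using preserving_integrable[OF refl_preserving[of i t], of "G j"] preserving_integrable[OF refl_preserving[of i t], of w]
      G_integrable w_integrable by simp_all
  have "integrable lborel (\<lambda>y. (sg i j * G j (R y) - G j y) * (y $ j * ?\<phi> y) + (w (R y) - w y) * ?\<phi> y)"
    using GR G_integrable w_integrable
    by (intro Bochner_Integration.integrable_add integrable_mult_Cc_infinity Cc_infinity_mult_component \<phi>) auto
  then have i0: "integrable lborel (\<lambda>y. (y $ j * (sg i j * G j (R y) - G j y) + (w (R y) - w y)) * ?\<phi> y)"
    by (simp add: algebra_simps)
  have Ycont: "continuous_on UNIV (Yd d i t j)"
    unfolding Yd_def[abs_def]
    by (intro continuous_intros Gd_continuous continuous_on_compose2[OF Gd_continuous[of UNIV] continuous_on_refl]) auto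
  have i1: "integrable lborel (\<lambda>y. y $ j * (?\<phi> y * Yd d i t j y))"
    by (rule continuous_bounded_support_integrable[OF _ Q_bounded])
      (auto intro!: continuous_intros Ycont Cc_infinity_continuous[OF \<phi>] simp: \<phi>Q)
  have i2: "integrable lborel (\<lambda>y. Zd d i t y * ?\<phi> y)"
    by (rule continuous_bounded_support_integrable[OF _ Q_bounded])
      (auto intro!: continuous_intros Zd_continuous Cc_infinity_continuous[OF \<phi>] simp: \<phi>Q)
  have "(\<integral>y. (y $ j * (sg i j * G j (R y) - G j y) + (w (R y) - w y)) * ?\<phi> y \<partial>lborel)
      \<le> (\<integral>y. (y $ j * (?\<phi> y * Yd d i t j y) + Zd d i t y * ?\<phi> y) + (5 / 2 * (EG d j (R y) + EG d j y) + (Ew d (R y) + Ew d y)) \<partial>lborel)"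
  proof (rule integral_mono[OF i0])
    show "integrable lborel (\<lambda>y. (y $ j * (?\<phi> y * Yd d i t j y) + Zd d i t y * ?\<phi> y) + (5 / 2 * (EG d j (R y) + EG d j y) + (Ew d (R y) + Ew d y)))"
      using i1 i2 EG Ew by auto
    fix y
    show "(y $ j * (sg i j * G j (R y) - G j y) + (w (R y) - w y)) * ?\<phi> y
        \<le> (y $ j * (?\<phi> y * Yd d i t j y) + Zd d i t y * ?\<phi> y) + (5 / 2 * (EG d j (R y) + EG d j y) + (Ew d (R y) + Ew d y))"
    proof (cases "y \<in> Q")
      case False
      then show ?thesis by (simp add: \<phi>Q EG_def Ew_def)
    next
      case True
      define A1 where "A1 = y $ j * (sg i j * G j (R y) - G j y - Yd d i t j y)"
      define A2 where "A2 = (w (R y) - w y) - Zd d i t y"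
      have "\<bar>sg i j * G j (R y) - G j y - Yd d i t j y\<bar> \<le> EG d j (R y) + EG d j y"
        by (auto simp: Yd_def EG_def sg_def)
      then have "\<bar>A1\<bar> \<le> 5 / 2 * (EG d j (R y) + EG d j y)"
        unfolding A1_def abs_mult using True by (intro mult_mono) (auto simp: Q_def)
      moreover have "\<bar>A2\<bar> \<le> Ew d (R y) + Ew d y" by (auto simp: A2_def Zd_def Ew_def)
      moreover define r where "r = 5 / 2 * (EG d j (R y) + EG d j y) + (Ew d (R y) + Ew d y)"
      ultimately have "A1 + A2 \<le> r" by linarith
      moreover have "r \<ge> 0" by (simp add: r_def EG_def Ew_def)
      ultimately have "(A1 + A2) * ?\<phi> y \<le> r * ?\<phi> y" "r * ?\<phi> y \<le> r * 1"
        using \<phi>01[of y] by (auto intro: mult_right_mono mult_left_le)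
      then have "(A1 + A2) * ?\<phi> y \<le> r" by simp
      moreover have "(y $ j * (sg i j * G j (R y) - G j y) + (w (R y) - w y)) * ?\<phi> y
          = (y $ j * (?\<phi> y * Yd d i t j y) + Zd d i t y * ?\<phi> y) + (A1 + A2) * ?\<phi> y"
        by (simp add: A1_def A2_def algebra_simps)
      ultimately show ?thesis unfolding r_def by linarith
    qed
  qed
  also have "\<dots> = (\<integral>y. y $ j * (?\<phi> y * Yd d i t j y) \<partial>lborel) + (\<integral>y. Zd d i t y * ?\<phi> y \<partial>lborel)
      + (5 / 2 * ((\<integral>y. EG d j (R y) \<partial>lborel) + (\<integral>y. EG d j y \<partial>lborel)) + ((\<integral>y. Ew d (R y) \<partial>lborel) + (\<integral>y. Ew d y \<partial>lborel)))"
    using i1 i2 EG[of j] Ew by simp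
  finally have 1: "(\<integral>y. (y $ j * (sg i j * G j (R y) - G j y) + (w (R y) - w y)) * ?\<phi> y \<partial>lborel) \<le> \<dots>" .
  have 2: "(\<integral>y. y $ j * (?\<phi> y * Yd d i t j y) \<partial>lborel) = - (\<integral>y. cut d i t (pospart e) y \<partial>lborel)"
    using integral_component_pd[OF cut_pospart(1), of j] by (simp add: cut_pospart(2))
  have "- (\<integral>y. cut d i t (pospart e) y \<partial>lborel) + (\<integral>y. Zd d i t y * ?\<phi> y \<partial>lborel) = (\<integral>y. Zd d i t y * ?\<phi> y - cut d i t (pospart e) y \<partial>lborel)"
    using i2 Cc_infinity_integrable[OF cut_pospart(1)] by simp
  also have "\<dots> \<le> (\<integral>y. indicator Q y *\<^sub>R (2 * e) \<partial>lborel)"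
  proof (rule integral_mono')
    show "integrable lborel (\<lambda>y. indicator Q y *\<^sub>R (2 * e))"
      unfolding Q_cbox by (intro integrable_scaleR_left integrable_real_indicator) (auto simp: emeasure_lborel_cbox_eq)
    show "Zd d i t y * ?\<phi> y - cut d i t (pospart e) y \<le> indicator Q y *\<^sub>R (2 * e)" for y
    proof (cases "y \<in> Q")
      case True
      then show ?thesis using pospart'_mult_le[OF e, of "Zd d i t y"] e by (simp add: cut_def)
    next
      case False
      then show ?thesis using e by (simp add: cut_def Zd_support pospart_eq_0)
    qed
  qed (use e in simp)
  also have "(\<integral>y. indicator Q y *\<^sub>R (2 * e) \<partial>lborel) = 2 * e * measure lborel Q"
    by (simp add: Q_cbox)
  finally have 3: "- (\<integral>y. cut d i t (pospart e) y \<partial>lborel) + (\<integral>y. Zd d i t y * ?\<phi> y \<partial>lborel) \<le> 2 * e * measure lborel Q" .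
  have arith: "X \<le> V + 7 * c" if "X \<le> A + B + (5 / 2 * (g + g') + (u + u'))" "A = - C" "- C + B \<le> V"
      "g \<le> c" "g' \<le> c" "u \<le> c" "u' \<le> c" for X V A B C g g' u u' :: real
  proof -
    have "5 / 2 * (g + g') \<le> 5 / 2 * (c + c)" using that by (intro mult_left_mono add_mono) auto
    also have "5 / 2 * (c + c) = 5 * c" by simp
    finally show ?thesis using that(1,2,3,6,7) by linarith
  qed
  show ?thesis by (rule arith[OF 1 2 3 EG(4,2) Ew(4,2)])
qed

text \<open>The right side is t a_i times the derivative of the mass M(t), see
  \<open>cut_mass_has_derivative\<close>, so this bounds M' from below by errors only. The last term
  on the left pays for replacing \<open>G i\<close> by \<open>Gd d i\<close>.\<close>

lemma reflected_mass_derivative_bound: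
  assumes L: "\<And>z. \<bar>z\<bar> \<le> 1 \<Longrightarrow> pospart'' e z \<le> L"
  shows "- (4 * L * c * real CARD('n)) - (\<Sum>j\<in>UNIV. a j) * (2 * e * measure lborel Q + 7 * c) - 2 * t * a i * c
    \<le> 2 * t * a i * (\<integral>y. Gd d i (R y) * cut d i t (pospart' e) y \<partial>lborel)"
proof -
  let ?\<phi> = "cut d i t (pospart' e)"
  note \<phi> = cut_pospart'(1)
  have \<phi>01: "0 \<le> ?\<phi> y" "?\<phi> y \<le> 1" for y using pospart'_bounds[OF e] by (simp_all add: cut_def)
  have \<phi>Q: "?\<phi> y = 0" if "y \<notin> Q" for y
    using e by (simp add: cut_def Zd_support[OF that] pospart_eq_0[OF e])
  have "(\<Sum>j\<in>(UNIV :: 'n set). - (4 * L * c))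
      \<le> (\<Sum>j\<in>UNIV. \<integral>y. (flux (p $ j) (sg i j * G j (R y)) - flux (p $ j) (G j y)) * pd ?\<phi> j y \<partial>lborel)"
    by (intro sum_mono flux_term_bound L)
  also have "\<dots> = (\<Sum>j\<in>UNIV. a j * (\<integral>y. (y $ j * (sg i j * G j (R y) - G j y) + (w (R y) - w y)) * ?\<phi> y \<partial>lborel))
      + 2 * t * a i * (\<integral>y. G i (R y) * ?\<phi> y \<partial>lborel)"
    by (rule reflected_equation[OF \<phi>])
  also have "\<dots> \<le> (\<Sum>j\<in>UNIV. a j * (2 * e * measure lborel Q + 7 * c))
      + 2 * t * a i * ((\<integral>y. Gd d i (R y) * ?\<phi> y \<partial>lborel) + c)"
  proof (intro add_mono sum_mono mult_left_mono drift_term_bound)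
    have i1: "integrable lborel (\<lambda>y. G i (R y) * ?\<phi> y)"
      using preserving_integrable[OF refl_preserving[of i t], of "G i"] G_integrable
      by (intro integrable_mult_Cc_infinity \<phi>) simp
    have i2: "integrable lborel (\<lambda>y. Gd d i (R y) * ?\<phi> y)"
      by (rule continuous_bounded_support_integrable[OF _ Q_bounded])
        (auto intro!: continuous_intros Cc_infinity_continuous[OF \<phi>]
          continuous_on_compose2[OF Gd_continuous[of UNIV] continuous_on_refl]
          simp: \<phi>Q)
    have "(\<integral>y. G i (R y) * ?\<phi> y \<partial>lborel) \<le> (\<integral>y. Gd d i (R y) * ?\<phi> y + EG d i (R y) \<partial>lborel)"
    proof (rule integral_mono[OF i1])
      fix y
      have "(G i (R y) - Gd d i (R y)) * ?\<phi> y \<le> EG d i (R y) * 1"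
        using \<phi>01[of y] by (intro mult_mono) (auto simp: EG_def)
      then show "G i (R y) * ?\<phi> y \<le> Gd d i (R y) * ?\<phi> y + EG d i (R y)" by (simp add: algebra_simps)
    qed (use i2 EG in auto)
    also have "\<dots> \<le> (\<integral>y. Gd d i (R y) * ?\<phi> y \<partial>lborel) + c" using i2 EG by simp
    finally show "(\<integral>y. G i (R y) * ?\<phi> y \<partial>lborel) \<le> (\<integral>y. Gd d i (R y) * ?\<phi> y \<partial>lborel) + c" .
  qed (use a t less_imp_le[OF a] in auto)
  also have "(\<Sum>j\<in>UNIV. a j * (2 * e * measure lborel Q + 7 * c)) = (\<Sum>j\<in>UNIV. a j) * (2 * e * measure lborel Q + 7 * c)"
    by (rule sum_distrib_right[symmetric])
  finally show ?thesis by (simp add: algebra_simps)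
qed

end

end

end

end

section \<open>The mass M(t), its derivative and the reflection comparison\<close>

lemma pospart_le: "e > 0 \<Longrightarrow> pospart e z \<le> max 0 z"
  using pospart_Lipschitz[of e z 0] pospart_eq_0(1)[of e 0] pospart_eq_0(1)[of e z] pospart_nonneg[of e z]
  by (cases "z \<le> e") auto

lemma refl_nth_continuous: "continuous_on S (\<lambda>(t, y). refl i t y)"
proof -
  have "continuous_on S (\<lambda>x. flip i (snd x) + (2 * fst x) *\<^sub>R axis i 1)"
    by (intro continuous_intros bounded_linear.continuous_on[OF bounded_linear_flip])
  moreover have "refl i t y = flip i y + (2 * t) *\<^sub>R axis i 1" for t y
    by (simp add: refl_def axis_def vec_eq_iff)
  ultimately show ?thesis by (simp add: case_prod_beta')
qed

context stationary
begin

text \<open>Moving t shifts R y along the i-th axis at speed 2, whence the factor 2. The moving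
  boundary contributes nothing, because the integrand vanishes near it. All integrands live on the
  fixed box Q, so the Leibniz rule for a fixed domain applies.\<close>

lemma cut_mass_has_derivative:
  assumes d: "0 < d" "d \<le> 1" and e: "e > 0" and t0: "t0 \<in> {0..1 / 2}"
  shows "((\<lambda>t. \<integral>y. cut d i t (pospart e) y \<partial>lborel) has_real_derivative
    2 * (\<integral>y. Gd d i (refl i t0 y) * cut d i t0 (pospart' e) y \<partial>lborel)) (at t0 within {0..1 / 2})"
proof -
  define fx where "fx t y = 2 * (Gd d i (refl i t y) * cut d i t (pospart' e) y)" for t y
  let ?a = "(\<chi> k. - (5 / 2)) :: real ^ 'n" and ?b = "(\<chi> k. 5 / 2) :: real ^ 'n"
  have Zc: "continuous_on S (\<lambda>(t, y). Zd d i t y)" for S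
    unfolding Zd_def case_prod_beta'
    by (intro continuous_intros continuous_on_compose2[OF wd_continuous[OF d, of UNIV]]
        refl_nth_continuous[unfolded case_prod_beta']) auto
  have off: "cut d i t f y = 0" if "t \<in> {0..1 / 2}" "f 0 = 0" "y \<notin> Q" for t f y
    using that Zd_support[OF d _ _ e that(3), of t i] by (simp add: cut_def)
  \<comment> \<open>The Leibniz rule speaks of the gauge integral over a box, which agrees with the
    Lebesgue integral for integrable functions vanishing off Q.\<close>
  have HK: "integral (cbox ?a ?b) f = (\<integral>y. f y \<partial>lborel)"
    if "integrable lborel f" "\<And>y. y \<notin> Q \<Longrightarrow> f y = 0" for f :: "real ^ 'n \<Rightarrow> real"
  proof -
    have "integral (cbox ?a ?b) f = integral UNIV (\<lambda>y. if y \<in> cbox ?a ?b then f y else 0)"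
      by (simp add: integral_restrict_UNIV)
    also have "(\<lambda>y. if y \<in> cbox ?a ?b then f y else 0) = f"
      using that(2) by (auto simp: Q_cbox)
    also have "integral UNIV f = (\<integral>y. f y \<partial>lborel)"
      by (rule integral_unique[OF has_integral_integral_lborel[OF that(1)]])
    finally show ?thesis .
  qed
  have fxc: "continuous_on S (\<lambda>(t, y). fx t y)" for S
  proof -
    let ?A = "{x :: real \<times> (real ^ 'n). snd x $ i \<le> fst x}" and ?B = "{x :: real \<times> (real ^ 'n). snd x $ i \<ge> fst x}"
    let ?g = "\<lambda>x. 2 * (Gd d i (refl i (fst x) (snd x)) * pospart' e (Zd d i (fst x) (snd x)))"
    have p'c: "continuous_on UNIV (pospart' e)"
      by (intro continuous_at_imp_continuous_on ballI DERIV_isCont[OF pospart'_DERIV[OF e]])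
    have g: "continuous_on T ?g" for T
      by (intro continuous_intros continuous_on_compose2[OF Gd_continuous[OF d, of UNIV]]
          continuous_on_compose2[OF p'c] Zc[unfolded case_prod_beta'] refl_nth_continuous[unfolded case_prod_beta']) auto
    \<comment> \<open>On the hyperplane Z = 0 < e, so the two closed pieces agree there.\<close>
    have hyp: "pospart' e (Zd d i (y $ i) y) = 0" for y
    proof -
      have "refl i (y $ i) y = y" by (simp add: vec_eq_iff refl_nth)
      then show ?thesis using e by (simp add: Zd_def pospart_eq_0)
    qed
    have "continuous_on (?A \<union> ?B) (\<lambda>x. fx (fst x) (snd x))"
    proof (rule continuous_on_closed_Un)
      show "continuous_on ?A (\<lambda>x. fx (fst x) (snd x))"
      proof (rule continuous_on_eq[OF g])
        fix x assume "x \<in> ?A"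
        then show "?g x = fx (fst x) (snd x)"
          using hyp[of "snd x"] by (cases "snd x $ i = fst x") (auto simp: fx_def cut_def)
      qed
      show "continuous_on ?B (\<lambda>x. fx (fst x) (snd x))"
        by (rule continuous_on_eq[of _ "\<lambda>x. 0"]) (auto simp: fx_def cut_def)
    qed (auto intro!: closed_Collect_le continuous_intros)
    moreover have "?A \<union> ?B = UNIV" by auto
    ultimately have "continuous_on UNIV (\<lambda>x. fx (fst x) (snd x))" by simp
    then show ?thesis by (auto simp: case_prod_beta' intro: continuous_on_subset)
  qed
  have der: "((\<lambda>t. cut d i t (pospart e) y) has_real_derivative fx t y) (at t within U)" for t y U
  proof (rule has_field_derivative_at_within)
    have Zder: "((\<lambda>s. Zd d i s y) has_real_derivative 2 * Gd d i (refl i t y)) (at t)"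
    proof -
      let ?D = "frechet_derivative (wd d) (at (refl i t y))"
      have "((\<lambda>s. refl i s y) has_derivative (\<lambda>s. (2 * s) *\<^sub>R axis i 1)) (at t)"
      proof -
        have "(\<lambda>s. refl i s y) = (\<lambda>s. flip i y + (2 * s) *\<^sub>R axis i 1)"
          by (auto simp: refl_def axis_def vec_eq_iff)
        then show ?thesis by (auto intro!: derivative_eq_intros)
      qed
      from has_derivative_compose[OF this wd_has_derivative[OF d]]
      have "((\<lambda>s. wd d (refl i s y)) has_derivative (\<lambda>s. ?D ((2 * s) *\<^sub>R axis i 1))) (at t)" .
      then have "((\<lambda>s. wd d (refl i s y) - wd d y) has_derivative (\<lambda>s. ?D ((2 * s) *\<^sub>R axis i 1) - 0)) (at t)"
        by (intro has_derivative_diff has_derivative_const)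
      moreover have "?D ((2 * s) *\<^sub>R axis i 1) - 0 = 2 * Gd d i (refl i t y) * s" for s
        using linear_cmul[OF has_derivative_linear[OF wd_has_derivative[OF d]]] pd_wd[OF d] by simp
      ultimately show ?thesis by (simp add: has_field_derivative_def Zd_def)
    qed
    consider "y $ i < t" | "y $ i > t" | "y $ i = t" by linarith
    then show "((\<lambda>t. cut d i t (pospart e) y) has_real_derivative fx t y) (at t)"
    proof cases
      case 1
      have "((\<lambda>s. pospart e (Zd d i s y)) has_real_derivative pospart' e (Zd d i t y) * (2 * Gd d i (refl i t y))) (at t)"
        by (rule DERIV_chain2[OF pospart_DERIV[OF e] Zder])
      then have "((\<lambda>t. cut d i t (pospart e) y) has_real_derivative pospart' e (Zd d i t y) * (2 * Gd d i (refl i t y))) (at t)"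
        by (rule has_field_derivative_transform_within_open[where S = "{y $ i<..}"]) (use 1 in \<open>auto simp: cut_def\<close>)
      then show ?thesis using 1 by (simp add: fx_def cut_def mult_ac)
    next
      case 2
      have "((\<lambda>t. cut d i t (pospart e) y) has_real_derivative 0) (at t)"
        by (rule has_field_derivative_transform_within_open[where S = "{..<y $ i}" and f = "\<lambda>_. 0"]) (use 2 in \<open>auto simp: cut_def\<close>)
      then show ?thesis using 2 by (simp add: fx_def cut_def)
    next
      case 3
      \<comment> \<open>When t passes y_i, continuity of Z in t keeps it below e for nearby t, and
        the integrand is 0 on both sides of the cut.\<close>
      have cont: "continuous_on UNIV (\<lambda>s. Zd d i s y)"
        using continuous_on_compose2[OF Zc[of UNIV], of UNIV "\<lambda>s. (s, y)"] by (simp add: continuous_on_Pair continuous_on_id)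
      have "refl i t y = y" using 3 by (simp add: vec_eq_iff refl_nth)
      then have "Zd d i t y = 0" by (simp add: Zd_def)
      then have "t \<in> {s. Zd d i s y < e}" using e by simp
      moreover have "0 = cut d i s (pospart e) y" if "s \<in> {s. Zd d i s y < e}" for s
        using that pospart_eq_0(1)[OF e, of "Zd d i s y"] by (simp add: cut_def)
      ultimately have "((\<lambda>t. cut d i t (pospart e) y) has_real_derivative 0) (at t)"
        by (rule has_field_derivative_transform_within_open[OF DERIV_const open_Collect_less[OF cont continuous_on_const]])
      then show ?thesis using 3 by (simp add: fx_def cut_def)
    qed
  qed
  have M: "integral (cbox ?a ?b) (cut d i t (pospart e)) = (\<integral>y. cut d i t (pospart e) y \<partial>lborel)"
    if t: "t \<in> {0..1 / 2}" for t
  proof (rule HK)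
    show "integrable lborel (cut d i t (pospart e))"
      by (rule Cc_infinity_integrable[OF cut_pospart(1)[OF d _ _ e]]) (use t in auto)
    show "cut d i t (pospart e) y = 0" if "y \<notin> Q" for y
      using off[OF t _ that, of "pospart e"] pospart_eq_0(1)[OF e less_imp_le[OF e]] by simp
  qed
  have "((\<lambda>t. integral (cbox ?a ?b) (\<lambda>y. cut d i t (pospart e) y)) has_real_derivative integral (cbox ?a ?b) (fx t0)) (at t0 within {0..1 / 2})"
  proof (rule leibniz_rule_field_derivative[OF der _ fxc t0])
    fix t :: real assume t: "t \<in> {0..1 / 2}"
    show "(\<lambda>y. cut d i t (pospart e) y) integrable_on cbox ?a ?b"
      using t by (intro integrable_continuous Cc_infinity_continuous cut_pospart(1)[OF d _ _ e]) auto
  qed simp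
  moreover have "integral (cbox ?a ?b) (fx t0) = 2 * (\<integral>y. Gd d i (refl i t0 y) * cut d i t0 (pospart' e) y \<partial>lborel)"
  proof -
    have c: "continuous_on UNIV (fx t0)"
      using continuous_on_compose2[OF fxc[of UNIV], of UNIV "\<lambda>y. (t0, y)"] by (simp add: continuous_on_Pair continuous_on_id continuous_on_const)
    have z: "fx t0 y = 0" if "y \<notin> Q" for y
      using off[OF t0 _ that, of "pospart' e"] pospart_eq_0(2)[OF e, of 0] e by (simp add: fx_def)
    have "integral (cbox ?a ?b) (fx t0) = (\<integral>y. fx t0 y \<partial>lborel)"
      by (rule HK[OF continuous_bounded_support_integrable[OF c Q_bounded z] z])
    then show ?thesis unfolding fx_def by simp
  qed
  ultimately have D: "((\<lambda>t. integral (cbox ?a ?b) (\<lambda>y. cut d i t (pospart e) y)) has_real_derivative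
      2 * (\<integral>y. Gd d i (refl i t0 y) * cut d i t0 (pospart' e) y \<partial>lborel)) (at t0 within {0..1 / 2})" by simp
  show ?thesis
    unfolding has_field_derivative_def
    by (rule has_derivative_transform[OF t0 M[symmetric] D[unfolded has_field_derivative_def]])
qed

text \<open>For s between t and 1/2 the derivative of M is at least -B / (s a_i) >= -k, so M(s) + k
  s is nondecreasing there. The last term of B comes from 2 s <= 1.\<close>

lemma cut_mass_bound:
  fixes i :: 'n and d e c L t :: real
  assumes d: "0 < d" "d \<le> 1" and e: "e > 0" and good: "good c d" "c > 0"
    and L: "\<And>z. \<bar>z\<bar> \<le> 1 \<Longrightarrow> pospart'' e z \<le> L" and t: "0 < t" "t < 1 / 2"
  defines "B \<equiv> 4 * L * c * real CARD('n) + (\<Sum>j\<in>UNIV. a j) * (2 * e * measure lborel Q + 7 * c) + a i * c"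
  shows "(\<integral>y. cut d i t (pospart e) y \<partial>lborel) \<le> (\<integral>y. cut d i (1 / 2) (pospart e) y \<partial>lborel) + B / (t * a i)"
proof -
  let ?M = "\<lambda>t. \<integral>y. cut d i t (pospart e) y \<partial>lborel"
  define k where "k = B / (t * a i)"
  have L0: "L \<ge> 0" using L[of 0] pospart''_nonneg[OF e, of 0] by simp
  have B: "B \<ge> 0"
    unfolding B_def using L0 good(2) e a[of i] less_imp_le[OF a]
    by (intro add_nonneg_nonneg mult_nonneg_nonneg sum_nonneg) (auto simp: less_imp_le)
  have k: "k \<ge> 0" unfolding k_def using B t a[of i] by simp
  have "?M t + k * t \<le> ?M (1 / 2) + k * (1 / 2)"
  proof (rule DERIV_nonneg_imp_increasing_open[OF less_imp_le[OF t(2)]])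
    fix s assume s: "t < s" "s < 1 / 2"
    let ?S = "\<integral>y. Gd d i (refl i s y) * cut d i s (pospart' e) y \<partial>lborel"
    have "s \<in> interior {0..1 / 2}" using s t by (simp add: interior_atLeastAtMost_real)
    then have at: "at s within {0..1 / 2} = at s" by (rule at_within_interior)
    have "(?M has_real_derivative 2 * ?S) (at s)"
      using cut_mass_has_derivative[OF d e, of s i] s t unfolding at by simp
    then have D: "((\<lambda>t. ?M t + k * t) has_real_derivative 2 * ?S + k) (at s)"
      by (auto intro!: derivative_eq_intros)
    have "- B \<le> 2 * s * a i * ?S"
    proof -
      have "2 * s * a i * c \<le> 1 * a i * c"
        using s t a[of i] good(2) by (intro mult_right_mono) auto
      then show ?thesis
        using reflected_mass_derivative_bound[OF d _ _ e good L, of s i] s t by (simp add: B_def)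
    qed
    then have "- B / (s * a i) \<le> 2 * ?S"
      using s t a[of i] by (simp add: field_simps)
    moreover have "B / (s * a i) \<le> k"
      unfolding k_def using s t a[of i] B by (intro divide_left_mono mult_right_mono) auto
    ultimately have "0 \<le> 2 * ?S + k" by simp
    then show "\<exists>y. ((\<lambda>t. ?M t + k * t) has_real_derivative y) (at s) \<and> 0 \<le> y" using D by blast
  next
    have "continuous_on {0..1 / 2} ?M"
      by (rule DERIV_continuous_on[OF cut_mass_has_derivative[OF d e]])
    then show "continuous_on {t..1 / 2} (\<lambda>t. ?M t + k * t)"
      using t by (intro continuous_intros) (auto intro: continuous_on_subset)
  qed
  moreover have "0 \<le> k * t" "k * (1 / 2) \<le> k" using k t by auto
  ultimately show ?thesis unfolding k_def by linarith
qed

text \<open>For t >= 1/2 the reflected points of the half-space miss \<open>K1\<close>. For smaller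
  t the integral of the positive part of the reflected difference is bounded by M(t), hence by
  M(1/2), up to errors that are divided by the fixed t a_i.\<close>

lemma reflection_comparison:
  assumes t: "t > 0"
  shows "AE y in lborel. y $ i < t \<longrightarrow> w (refl i t y) \<le> w y"
proof (cases "t < 1 / 2")
  case False
  have "w (refl i t y) \<le> w y" if "y $ i < t" for y
  proof -
    have "\<bar>refl i t y $ i\<bar> > 1 / 2" using that False by (simp add: refl_nth)
    then have "refl i t y \<notin> K1" unfolding K1_def by (auto simp: not_le intro!: exI[of _ i])
    then show ?thesis using w_support w_bounds by simp
  qed
  then show ?thesis by simp
next
  case True
  define P where "P y = (if y $ i < t then max 0 (w (refl i t y) - w y) else 0)" for y
  have [measurable]: "P \<in> borel_measurable borel" unfolding P_def[abs_def] by measurable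
  have P0: "P y \<ge> 0" for y by (simp add: P_def)
  have wR: "integrable lborel (\<lambda>y. w (refl i t y))"
    using preserving_integrable[OF refl_preserving w_measurable, of i t] w_integrable by simp
  have Pint: "integrable lborel P"
    by (rule Bochner_Integration.integrable_bound[OF Bochner_Integration.integrable_add[OF wR w_integrable]])
      (use w_bounds in \<open>auto simp: P_def\<close>)
  define V where "V = measure lborel (Q :: (real ^ 'n) set)"
  define A where "A = (\<Sum>j\<in>UNIV. a j)"
  have VA: "V \<ge> 0" "A \<ge> 0" using less_imp_le[OF a] by (auto simp: V_def A_def intro!: sum_nonneg)
  have ta: "t * a i > 0" using t a by simp
  \<comment> \<open>The first group of errors vanishes with e alone; the second carries L, which
    depends on e, so c is chosen after e.\<close>
  have bound: "(\<integral>y. P y \<partial>lborel) \<le> e * (2 * V + 2 * A * V / (t * a i)) + c * (4 + (4 * L * real CARD('n) + 7 * A + a i) / (t * a i))"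
    if e: "e > 0" and L: "\<And>z. \<bar>z\<bar> \<le> 1 \<Longrightarrow> pospart'' e z \<le> L" and c: "c > 0" for e c L
  proof -
    obtain d where d: "0 < d" "d \<le> 1" and good: "good c d" using good_exists[OF c] by metis
    have t01: "0 \<le> t" "t \<le> 1 / 2" and h01: "(0 :: real) \<le> 1 / 2" "(1 / 2 :: real) \<le> 1 / 2" using t True by auto
    note Ew = Ew(1,2)[OF d t01 e good c] Ew(3,4)[OF d t01 e good c, of i]
      and Ewh = Ew(1,2)[OF d t01 e good c] Ew(3,4)[OF d h01 e good c, of i] and cut = cut_pospart(1)[OF d _ _ e]
    have QV: "integrable lborel (\<lambda>y. indicator Q y *\<^sub>R (2 * e))" "(\<integral>y. indicator Q y *\<^sub>R (2 * e) \<partial>lborel) = 2 * e * V"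
      unfolding V_def Q_cbox by (auto intro!: integrable_scaleR_left integrable_real_indicator simp: emeasure_lborel_cbox_eq)
    have i1: "integrable lborel (cut d i t (pospart e))"
      using t True by (intro Cc_infinity_integrable cut) auto
    have "(\<integral>y. P y \<partial>lborel) \<le> (\<integral>y. cut d i t (pospart e) y + indicator Q y *\<^sub>R (2 * e) + (Ew d (refl i t y) + Ew d y) \<partial>lborel)"
    proof (rule integral_mono[OF Pint])
      show "integrable lborel (\<lambda>y. cut d i t (pospart e) y + indicator Q y *\<^sub>R (2 * e) + (Ew d (refl i t y) + Ew d y))"
        using i1 QV Ew by auto
      fix y
      show "P y \<le> cut d i t (pospart e) y + indicator Q y *\<^sub>R (2 * e) + (Ew d (refl i t y) + Ew d y)"
      proof (cases "y $ i < t")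
        case yt: True
        have "max 0 (Zd d i t y) \<le> pospart e (Zd d i t y) + indicator Q y *\<^sub>R (2 * e)"
        proof (cases "y \<in> Q")
          case True
          then show ?thesis using pospart_ge[OF e, of "Zd d i t y"] pospart_nonneg[OF e, of "Zd d i t y"] e by simp
        next
          case False
          then have "Zd d i t y = 0" using Zd_support[OF d _ _ e False, of t i] t True by simp
          then show ?thesis using pospart_nonneg[OF e] e False by simp
        qed
        moreover have "w (refl i t y) - w y \<le> Zd d i t y + (Ew d (refl i t y) + Ew d y)"
          by (auto simp: Zd_def Ew_def)
        moreover have "0 \<le> Ew d (refl i t y) + Ew d y" by (simp add: Ew_def)
        ultimately show ?thesis using yt by (simp add: P_def cut_def)
      next
        case False
        then show ?thesis using e by (simp add: P_def cut_def Ew_def)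
      qed
    qed
    also have "\<dots> = (\<integral>y. cut d i t (pospart e) y \<partial>lborel) + 2 * e * V + ((\<integral>y. Ew d (refl i t y) \<partial>lborel) + (\<integral>y. Ew d y \<partial>lborel))"
      using i1 QV Ew e by (simp add: mult_ac)
    also have "\<dots> \<le> (\<integral>y. cut d i t (pospart e) y \<partial>lborel) + 2 * e * V + 2 * c"
      using Ew by simp
    also have "(\<integral>y. cut d i t (pospart e) y \<partial>lborel) \<le> (\<integral>y. cut d i (1 / 2) (pospart e) y \<partial>lborel)
        + (4 * L * c * real CARD('n) + A * (2 * e * V + 7 * c) + a i * c) / (t * a i)"
      unfolding A_def V_def by (rule cut_mass_bound[OF d e good c L t True])
    \<comment> \<open>At t = 1/2 the reflected solution is 0 on the half-space, so Z is positive
      only through mollification errors.\<close>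
    also have "(\<integral>y. cut d i (1 / 2) (pospart e) y \<partial>lborel) \<le> (\<integral>y. Ew d (refl i (1 / 2) y) + Ew d y \<partial>lborel)"
    proof (rule integral_mono)
      show "integrable lborel (cut d i (1 / 2) (pospart e))"
        by (intro Cc_infinity_integrable cut) auto
      show "integrable lborel (\<lambda>y. Ew d (refl i (1 / 2) y) + Ew d y)" using Ewh by auto
      fix y
      show "cut d i (1 / 2) (pospart e) y \<le> Ew d (refl i (1 / 2) y) + Ew d y"
      proof (cases "y $ i < 1 / 2")
        case yi: True
        have "\<bar>refl i (1 / 2) y $ i\<bar> > 1 / 2" using yi by (simp add: refl_nth)
        then have "refl i (1 / 2) y \<notin> K1" unfolding K1_def by (auto simp: not_le intro!: exI[of _ i])
        then have "w (refl i (1 / 2) y) = 0" by (rule w_support)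
        then have "max 0 (Zd d i (1 / 2) y) \<le> Ew d (refl i (1 / 2) y) + Ew d y"
          using w_bounds(1)[of y] by (auto simp: Zd_def Ew_def)
        from order.trans[OF pospart_le[OF e] this] show ?thesis using yi by (simp add: cut_def)
      qed (simp add: cut_def Ew_def)
    qed
    also have "\<dots> \<le> 2 * c" using Ewh by simp
    finally have "(\<integral>y. P y \<partial>lborel) \<le> 2 * c + (4 * L * c * real CARD('n) + A * (2 * e * V + 7 * c) + a i * c) / (t * a i) + 2 * e * V + 2 * c"
      by simp
    also have "\<dots> = e * (2 * V + 2 * A * V / (t * a i)) + c * (4 + (4 * L * real CARD('n) + 7 * A + a i) / (t * a i))"
      by (simp add: add_divide_distrib algebra_simps)
    finally show ?thesis .
  qed
  have "(\<integral>y. P y \<partial>lborel) \<le> 0"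
  proof (rule field_le_epsilon)
    fix s :: real assume s: "s > 0"
    define X where "X = 2 * V + 2 * A * V / (t * a i)"
    have X: "X \<ge> 0" unfolding X_def using VA ta by simp
    define e where "e = s / (2 * (X + 1))"
    have e: "e > 0" "e * X \<le> s / 2" using s X by (auto simp: e_def field_simps)
    obtain L where L: "L > 0" "\<And>z. \<bar>z\<bar> \<le> 1 \<Longrightarrow> pospart'' e z \<le> L" using pospart''_bounded[OF e(1)] by metis
    define Y where "Y = 4 + (4 * L * real CARD('n) + 7 * A + a i) / (t * a i)"
    have Y: "Y > 0" unfolding Y_def using VA ta L(1) a[of i] by (intro add_pos_nonneg divide_nonneg_pos add_nonneg_nonneg) auto
    have "s / (2 * Y) > 0" using s Y by simp
    from bound[OF e(1) L(2) this] have "(\<integral>y. P y \<partial>lborel) \<le> e * X + (s / (2 * Y)) * Y"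
      unfolding X_def Y_def by blast
    also have "\<dots> \<le> s / 2 + s / 2" using e(2) Y by (intro add_mono) auto
    finally show "(\<integral>y. P y \<partial>lborel) \<le> 0 + s" by simp
  qed
  moreover have "(\<integral>y. P y \<partial>lborel) \<ge> 0" by (simp add: P0)
  ultimately have "(\<integral>y. P y \<partial>lborel) = 0" by simp
  then have "AE y in lborel. P y = 0"
    using integral_nonneg_eq_0_iff_AE[OF Pint AE_I2[OF P0]] by simp
  then show ?thesis by eventually_elim (auto simp: P_def max_def split: if_splits)
qed

end

subsection \<open>Slices and Borel representatives\<close>

lemma AE_slice:
  fixes P :: "'a::euclidean_space \<times> 'b::euclidean_space \<Rightarrow> bool"
  assumes "AE z in lborel. P z"
  shows "AE s in lborel. AE y in lborel. P (y, s)"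
proof -
  obtain N where N: "{z. \<not> P z} \<subseteq> N" "emeasure lborel N = 0" and [measurable]: "N \<in> sets borel"
    using AE_E[OF assms] by auto
  have [measurable]: "N \<in> sets (borel \<Otimes>\<^sub>M borel)" unfolding borel_prod by fact
  have "(\<integral>\<^sup>+s. (\<integral>\<^sup>+y. indicator N (y, s) \<partial>(lborel :: 'a measure)) \<partial>(lborel :: 'b measure)) = (\<integral>\<^sup>+z. indicator N z \<partial>(lborel \<Otimes>\<^sub>M lborel))"
    by (rule lborel_pair.nn_integral_snd) measurable
  also have "\<dots> = 0" using N(2) by (simp add: lborel_prod)
  finally have "AE s in lborel. (\<integral>\<^sup>+y. indicator N (y, s) \<partial>(lborel :: 'a measure)) = 0"
    by (subst (asm) nn_integral_0_iff_AE) (auto intro: lborel.borel_measurable_nn_integral)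
  then show ?thesis
  proof eventually_elim
    case (elim s)
    then have "AE y in (lborel :: 'a measure). (indicator N (y, s) :: ennreal) = 0"
      by (subst (asm) nn_integral_0_iff_AE) auto
    then show ?case by eventually_elim (use N(1) in \<open>auto split: split_indicator_asm\<close>)
  qed
qed

text \<open>Tonelli for a Borel representative, which agrees with f almost everywhere on almost
  every slice.\<close>

lemma integrable_slice:
  fixes f :: "'a::euclidean_space \<times> 'b::euclidean_space \<Rightarrow> real"
  assumes "integrable lebesgue f"
  shows "AE s in lborel. (\<integral>\<^sup>+y. ennreal \<bar>f (y, s)\<bar> \<partial>lborel) < \<infinity>"
proof -
  obtain f' where [measurable]: "f' \<in> borel_measurable borel" and f': "AE z in lborel. f z = f' z"
    using completion_ex_borel_measurable_real[OF borel_measurable_integrable[OF assms]] by auto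
  have [measurable]: "f' \<in> borel_measurable (borel \<Otimes>\<^sub>M borel)" unfolding borel_prod by fact
  have "(\<integral>\<^sup>+s. (\<integral>\<^sup>+y. ennreal \<bar>f' (y, s)\<bar> \<partial>lborel) \<partial>lborel) = (\<integral>\<^sup>+z. ennreal \<bar>f' z\<bar> \<partial>(lborel \<Otimes>\<^sub>M lborel))"
    by (rule lborel_pair.nn_integral_snd) measurable
  also have "\<dots> = (\<integral>\<^sup>+z. ennreal \<bar>f z\<bar> \<partial>lborel)"
    unfolding lborel_prod using f' by (intro nn_integral_cong_AE) auto
  also have "\<dots> < \<infinity>"
    using assms by (simp add: integrable_iff_bounded nn_integral_completion)
  finally have "AE s in lborel. (\<integral>\<^sup>+y. ennreal \<bar>f' (y, s)\<bar> \<partial>lborel) \<noteq> \<infinity>"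
    by (intro nn_integral_noteq_infinite) (auto intro: lborel.borel_measurable_nn_integral)
  with AE_slice[OF f'] show ?thesis
  proof eventually_elim
    case (elim s)
    have "(\<integral>\<^sup>+y. ennreal \<bar>f (y, s)\<bar> \<partial>lborel) = (\<integral>\<^sup>+y. ennreal \<bar>f' (y, s)\<bar> \<partial>lborel)"
      by (intro nn_integral_cong_AE) (use elim(1) in auto)
    with elim(2) show ?case by (simp add: less_top)
  qed
qed

lemma lebesgue_integral_eq_lborel:
  fixes f g :: "'a::euclidean_space \<Rightarrow> real"
  assumes "AE x in lborel. f x = g x" and "g \<in> borel_measurable borel"
  shows "(\<integral>x. f x \<partial>lebesgue) = (\<integral>x. g x \<partial>lborel)"
proof -
  have g: "g \<in> borel_measurable lebesgue" using assms(2) by (simp add: measurable_completion)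
  have eq: "AE x in lebesgue. g x = f x" using AE_completion[OF assms(1)] by eventually_elim simp
  have "(\<integral>x. f x \<partial>lebesgue) = (\<integral>x. g x \<partial>lebesgue)"
    by (rule integral_cong_AE[OF borel_measurable_AE[OF g eq] g AE_completion[OF assms(1)]])
  then show ?thesis using assms(2) by (simp add: integral_completion)
qed

lemma Lp_loc_borel_version:
  fixes u :: "'a::euclidean_space \<Rightarrow> real"
  assumes "Lp_loc 1 UNIV u"
  obtains u' where "u' \<in> borel_measurable borel" and "AE x in lborel. u x = u' x"
    and "\<And>K. compact K \<Longrightarrow> set_integrable lborel K u'"
proof -
  have u: "u \<in> borel_measurable lebesgue"
    using assms by (simp add: Lp_loc_def set_borel_measurable_def)
  obtain u' where u': "u' \<in> borel_measurable borel" "AE x in lborel. u x = u' x"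
    using completion_ex_borel_measurable_real[OF u] by auto
  show ?thesis
  proof (rule that[OF u'])
    fix K :: "'a set" assume K: "compact K"
    then have [measurable]: "K \<in> sets borel" by (simp add: compact_imp_closed)
    have "integrable lebesgue (\<lambda>x. indicator K x *\<^sub>R \<bar>u x\<bar>)"
      using assms K by (simp add: Lp_loc_def set_integrable_def)
    then have "(\<integral>\<^sup>+x. ennreal (norm (indicator K x *\<^sub>R \<bar>u x\<bar>)) \<partial>lborel) < \<infinity>"
      by (simp add: integrable_iff_bounded nn_integral_completion)
    also have "(\<integral>\<^sup>+x. ennreal (norm (indicator K x *\<^sub>R \<bar>u x\<bar>)) \<partial>lborel) = (\<integral>\<^sup>+x. ennreal (norm (indicator K x *\<^sub>R u' x)) \<partial>lborel)"
      using u'(2) by (intro nn_integral_cong_AE) (auto simp: abs_mult)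
    finally show "set_integrable lborel K u'"
      unfolding set_integrable_def using u'(1) by (simp add: integrable_iff_bounded)
  qed
qed

lemma Cc_infinity_support_integrable:
  fixes h :: "'a::euclidean_space \<Rightarrow> real"
  assumes h: "h \<in> borel_measurable borel" "\<And>K. compact K \<Longrightarrow> set_integrable lborel K h" and \<phi>: "\<phi> \<in> Cc_infinity"
  shows "integrable lborel (\<lambda>x. h x * \<phi> x)"
proof -
  let ?K = "closure {x. \<phi> x \<noteq> 0}"
  have "compact ?K" using \<phi> by (simp add: Cc_infinity_def)
  from h(2)[OF this] have "integrable lborel (\<lambda>x. indicator ?K x *\<^sub>R h x)" by (simp add: set_integrable_def)
  from integrable_mult_Cc_infinity[OF this \<phi>] have "integrable lborel (\<lambda>x. indicator ?K x *\<^sub>R h x * \<phi> x)" .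
  also have "(\<lambda>x. indicator ?K x *\<^sub>R h x * \<phi> x) = (\<lambda>x. h x * \<phi> x)"
    using closure_subset[of "{x. \<phi> x \<noteq> 0}"] by (intro ext) (auto simp: indicator_def)
  finally show ?thesis .
qed

text \<open>Two weak derivatives differ by a locally integrable function orthogonal to all test
  functions. This makes the gradients on almost all time slices of a stationary solution
  coincide.\<close>

lemma weak_partial_unique:
  assumes "has_weak_partial i u g" and "has_weak_partial i u h"
  shows "AE y in lborel. g y = h y"
proof -
  have L: "Lp_loc 1 UNIV g" "Lp_loc 1 UNIV h" using assms by (auto simp: has_weak_partial_def)
  obtain g' where g': "g' \<in> borel_measurable borel" "AE x in lborel. g x = g' x" "\<And>K. compact K \<Longrightarrow> set_integrable lborel K g'"
    using Lp_loc_borel_version[OF L(1)] by blast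
  obtain h' where h': "h' \<in> borel_measurable borel" "AE x in lborel. h x = h' x" "\<And>K. compact K \<Longrightarrow> set_integrable lborel K h'"
    using Lp_loc_borel_version[OF L(2)] by blast
  have "AE x in lborel. x \<in> UNIV \<longrightarrow> g' x - h' x = 0"
  proof (rule weakly_zero_imp_AE_zero)
    show "set_integrable lborel K (\<lambda>x. g' x - h' x)" if "compact K" for K
      using g'(3)[OF that] h'(3)[OF that] by (rule set_integral_diff)
    fix \<phi> :: "real ^ 'a \<Rightarrow> real" assume \<phi>: "\<phi> \<in> Cc_infinity"
    have [measurable]: "\<phi> \<in> borel_measurable borel" by (rule Cc_infinity_measurable[OF \<phi>])
    have "(\<integral>x. g' x * \<phi> x \<partial>lborel) = (\<integral>x. g x * \<phi> x \<partial>lebesgue)"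
      by (rule lebesgue_integral_eq_lborel[symmetric]) (use g' in auto)
    also have "\<dots> = (\<integral>x. h x * \<phi> x \<partial>lebesgue)" using assms \<phi> by (simp add: has_weak_partial_def)
    also have "\<dots> = (\<integral>x. h' x * \<phi> x \<partial>lborel)"
      by (rule lebesgue_integral_eq_lborel) (use h' in auto)
    finally show "(\<integral>x. (g' x - h' x) * \<phi> x \<partial>lborel) = 0"
      using Cc_infinity_support_integrable[OF g'(1,3) \<phi>] Cc_infinity_support_integrable[OF h'(1,3) \<phi>]
      by (simp add: left_diff_distrib)
  qed (use g' h' in auto)
  with g'(2) h'(2) show ?thesis by eventually_elim simp
qed

text \<open>A test function supported in U sees only u = 0. Applied off \<open>K1\<close>, this
  confines the gradient of w.\<close>

lemma weak_partial_zero: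
  assumes "has_weak_partial i u g" and U: "open U" and u: "AE y in lborel. y \<in> U \<longrightarrow> u y = 0"
  shows "AE y in lborel. y \<in> U \<longrightarrow> g y = 0"
proof -
  have L: "Lp_loc 1 UNIV g" using assms by (auto simp: has_weak_partial_def)
  obtain g' where g': "g' \<in> borel_measurable borel" "AE x in lborel. g x = g' x" "\<And>K. compact K \<Longrightarrow> set_integrable lborel K g'"
    using Lp_loc_borel_version[OF L] by blast
  have "AE x in lborel. x \<in> U \<longrightarrow> g' x = 0"
  proof (rule weakly_zero_imp_AE_zero[OF g'(1,3) U])
    fix \<phi> :: "real ^ 'a \<Rightarrow> real" assume \<phi>: "\<phi> \<in> Cc_infinity" and sub: "closure {x. \<phi> x \<noteq> 0} \<subseteq> U"
    have [measurable]: "\<phi> \<in> borel_measurable borel" by (rule Cc_infinity_measurable[OF \<phi>])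
    have "(\<integral>x. g' x * \<phi> x \<partial>lborel) = (\<integral>x. g x * \<phi> x \<partial>lebesgue)"
      by (rule lebesgue_integral_eq_lborel[symmetric]) (use g' in auto)
    also have "\<dots> = - (\<integral>x. u x * pd \<phi> i x \<partial>lebesgue)" using assms \<phi> by (simp add: has_weak_partial_def)
    also have "(\<integral>x. u x * pd \<phi> i x \<partial>lebesgue) = (\<integral>x. 0 \<partial>(lborel :: (real ^ 'a) measure))"
    proof (rule lebesgue_integral_eq_lborel)
      show "AE x in lborel. u x * pd \<phi> i x = 0"
        using u
      proof eventually_elim
        case (elim x)
        have "pd \<phi> i x = 0" if "x \<notin> U"
        proof -
          have "x \<notin> closure {x. \<phi> x \<noteq> 0}" using that sub by blast
          from frechet_derivative_outside_support[OF this] show ?thesis by simp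
        qed
        with elim show ?case by (cases "x \<in> U") auto
      qed
    qed simp
    finally show "(\<integral>x. g' x * \<phi> x \<partial>lborel) = 0" by simp
  qed
  with g'(2) show ?thesis by eventually_elim simp
qed

text \<open>By Lindelof, countably many of the open sets in the definition already cover the
  complement of the support, so their exceptional null sets add up to a null set.\<close>

lemma AE_zero_outside_ess_support:
  "AE y in lborel. y \<notin> ess_support g \<longrightarrow> g y = 0"
proof -
  let ?F = "{U. open U \<and> (AE y in lebesgue. y \<in> U \<longrightarrow> g y = 0)}"
  obtain F where F: "F \<subseteq> ?F" "countable F" "\<Union>F = \<Union>?F"
    using Lindelof[of ?F] by (metis (no_types, lifting) mem_Collect_eq)
  have "AE y in lborel. \<forall>U\<in>F. y \<in> U \<longrightarrow> g y = 0"
    using F(1,2) by (subst AE_ball_countable) (auto simp: AE_completion_iff)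
  then show ?thesis by eventually_elim (use F(3) in \<open>auto simp: ess_support_def\<close>)
qed

subsection \<open>Monotonicity in the coordinates\<close>

lemma AE_component_neq: "AE y in (lborel :: (real ^ 'n::finite) measure). y $ i \<noteq> c"
proof -
  have "negligible {y :: real ^ 'n. y \<bullet> axis i 1 = c}"
    by (rule negligible_standard_hyperplane) simp
  then have "{y :: real ^ 'n. y $ i = c} \<in> null_sets lebesgue"
    by (simp add: negligible_iff_null_sets inner_axis)
  then have "AE y in (lebesgue :: (real ^ 'n) measure). y $ i \<noteq> c" by (rule AE_I') auto
  then show ?thesis by (simp add: AE_completion_iff)
qed

lemma mol_refl:
  fixes u :: "real ^ 'n::finite \<Rightarrow> real"
  assumes u: "u \<in> borel_measurable borel" and d: "d > 0"
  shows "mol (ker d) u (refl i t x) = mol (ker d) (\<lambda>y. u (refl i t y)) x"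
proof -
  have m: "(\<lambda>y. ker d (c - y)) \<in> borel_measurable borel" for c :: "real ^ 'n"
    by (rule Cc_infinity_measurable[OF Cc_infinity_reflect[OF ker_Cc_infinity[OF d]]])
  \<comment> \<open>Monotonicity in both directions gives equality: the kernel sees only the moduli
    of the coordinates.\<close>
  have k: "ker d (refl i t x - refl i t y) = ker d (x - y)" for y
    by (intro antisym ker_antimono d) (simp_all add: refl_nth abs_minus_commute)
  have "(\<integral>y. u (refl i t y) * ker d (refl i t x - refl i t y) \<partial>lborel) = mol (ker d) u (refl i t x)"
    unfolding mol_def using u by (intro preserving_integral[OF refl_preserving, of "\<lambda>y. u y * ker d (refl i t x - y)"] borel_measurable_times m)
  then show ?thesis by (simp add: mol_def k)
qed

text \<open>Folding the integral along the hyperplane leaves the integrand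
  \<open>(u y - u (R y)) * (k (x - y) - k (x - R y))\<close> over \<open>y\<^sub>i < t\<close>, and both factors are nonnegative.\<close>

lemma mol_reflection_mono:
  fixes u :: "real ^ 'n::finite \<Rightarrow> real"
  assumes u: "integrable lborel u" and d: "d > 0"
    and cmp: "AE y in lborel. y $ i < t \<longrightarrow> u (refl i t y) \<le> u y" and x: "x $ i < t"
  shows "mol (ker d) u (refl i t x) \<le> mol (ker d) u x"
proof -
  let ?R = "refl i t"
  note R = refl_preserving[of i t]
  have um [measurable]: "u \<in> borel_measurable borel" using u by simp
  have [measurable]: "(ker d :: real ^ 'n \<Rightarrow> real) \<in> borel_measurable borel"
    by (rule Cc_infinity_measurable[OF ker_Cc_infinity[OF d]])
  have uR: "integrable lborel (\<lambda>y. u (?R y))" using preserving_integrable[OF R um] u by simp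
  define f where "f y = (u y - u (?R y)) * ker d (x - y)" for y
  have f: "integrable lborel f"
    using mol_integrable[OF u ker_Cc_infinity[OF d], of x] mol_integrable[OF uR ker_Cc_infinity[OF d], of x]
    by (simp add: f_def[abs_def] left_diff_distrib)
  have [measurable]: "f \<in> borel_measurable borel" using f by simp
  have fR: "integrable lborel (\<lambda>y. f (?R y))" "(\<integral>y. f (?R y) \<partial>lborel) = (\<integral>y. f y \<partial>lborel)"
    using preserving_integrable[OF R, of f] preserving_integral[OF R, of f] f by simp_all
  have cmpR: "AE y in lborel. ?R y $ i < t \<longrightarrow> u y \<le> u (?R y)"
  proof -
    have "AE y in distr lborel borel ?R. y $ i < t \<longrightarrow> u (?R y) \<le> u y"
      using cmp R unfolding lborel_preserving_def by metis
    then show ?thesis by (subst (asm) AE_distr_iff) auto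
  qed
  have "0 \<le> (\<integral>y. f y + f (?R y) \<partial>lborel)"
  proof (rule integral_nonneg_AE)
    show "AE y in lborel. 0 \<le> f y + f (?R y)"
      using cmp cmpR AE_component_neq[of i t]
    proof eventually_elim
      case (elim y)
      have eq: "f y + f (?R y) = (u y - u (?R y)) * (ker d (x - y) - ker d (x - ?R y))"
        by (simp add: f_def algebra_simps)
      consider "y $ i < t" | "y $ i > t" using elim(3) by linarith
      then show ?case
      proof cases
        case 1
        \<comment> \<open>When x and y are on the same side, y is nearer to x in coordinate i than
          its mirror image, and the other coordinates agree.\<close>
        have "ker d (x - ?R y) \<le> ker d (x - y)"
          by (rule ker_antimono[OF d]) (use 1 x in \<open>auto simp: refl_nth abs_if\<close>)
        then show ?thesis unfolding eq using elim(1) 1 by simp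
      next
        case 2
        have "ker d (x - y) \<le> ker d (x - ?R y)"
          by (rule ker_antimono[OF d]) (use 2 x in \<open>auto simp: refl_nth abs_if\<close>)
        then show ?thesis unfolding eq using elim(2) 2 by (intro mult_nonpos_nonpos) (auto simp: refl_nth)
      qed
    qed
  qed
  also have "\<dots> = 2 * (\<integral>y. f y \<partial>lborel)" using f fR by simp
  also have "(\<integral>y. f y \<partial>lborel) = mol (ker d) u x - mol (ker d) (\<lambda>y. u (?R y)) x"
    using mol_integrable[OF u ker_Cc_infinity[OF d], of x] mol_integrable[OF uR ker_Cc_infinity[OF d], of x]
    by (simp add: f_def[abs_def] left_diff_distrib mol_def)
  finally show ?thesis by (simp add: mol_refl[OF um d])
qed

context stationary
begin

text \<open>Reflection in the hyperplane halfway between x_i and y_i exchanges x and y; |x_i| < y_i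
  makes its position positive.\<close>

lemma wd_mono_positive:
  assumes d: "d > 0" and "\<bar>x $ i\<bar> < y $ i" and "\<And>j. j \<noteq> i \<Longrightarrow> x $ j = y $ j"
  shows "wd d y \<le> wd d x"
proof -
  define t where "t = (x $ i + y $ i) / 2"
  have t: "t > 0" "x $ i < t" using assms(2) by (auto simp: t_def)
  have "y = refl i t x" using assms(3) by (auto simp: vec_eq_iff refl_nth t_def field_simps)
  then show ?thesis
    unfolding wd_def using mol_reflection_mono[OF w_integrable d reflection_comparison[OF t(1)] t(2)] by simp
qed

text \<open>For y_i < 0 the previous case is applied to the solution reflected at 0; the kernel is
  even, so mollification commutes with that reflection.\<close>

lemma wd_mono_coordinate:
  assumes d: "d > 0" and "\<bar>x $ i\<bar> < \<bar>y $ i\<bar>" and "\<And>j. j \<noteq> i \<Longrightarrow> x $ j = y $ j"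
  shows "wd d y \<le> wd d x"
proof (cases "y $ i > 0")
  case True
  then show ?thesis using assms by (intro wd_mono_positive) auto
next
  case False
  interpret flipped: stationary p a "\<lambda>y. w (refl i 0 y)" "\<lambda>j y. sg i j * G j (refl i 0 y)"
    by (rule stationary_flip)
  have "flipped.wd d (refl i 0 y) \<le> flipped.wd d (refl i 0 x)"
    using assms False by (intro flipped.wd_mono_positive[of d _ i]) (auto simp: refl_nth)
  then show ?thesis
    unfolding flipped.wd_def wd_def by (simp add: mol_refl[OF _ d, symmetric])
qed

text \<open>The coordinates of y are replaced by those of x one at a time, and no replacement lowers
  the value.\<close>

lemma wd_mono:
  assumes d: "d > 0" and "\<And>j. \<bar>x $ j\<bar> < \<bar>y $ j\<bar>"
  shows "wd d y \<le> wd d x"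
proof -
  have "wd d y \<le> wd d (\<chi> j. if j \<in> S then x $ j else y $ j)" for S
    using finite[of S]
  proof (induction S rule: finite_induct)
    case empty
    then show ?case by simp
  next
    case (insert i S)
    have "wd d (\<chi> j. if j \<in> S then x $ j else y $ j) \<le> wd d (\<chi> j. if j \<in> insert i S then x $ j else y $ j)"
      using insert.hyps assms(2)[of i] by (intro wd_mono_coordinate[OF d, of _ i]) auto
    with insert.IH show ?case by simp
  qed
  from this[of UNIV] show ?thesis by simp
qed

text \<open>Every point of the box |x_i| < r is closer to 0, in each coordinate, than every point of
  \<open>S r\<close>. Hence the mollification on the box is at least the average m / V of w over
  \<open>S r\<close>, up to c / V; letting c tend to 0 gives w >= m / V almost everywhere in the
  box.\<close>

lemma w_bounded_below_near_0:
  assumes nontrivial: "\<not> (AE y in lborel. w y = 0)"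
  shows "\<exists>\<eta>>0. AE y in lborel. (\<forall>i. \<bar>y $ i\<bar> < \<eta>) \<longrightarrow> w y \<ge> \<eta>"
proof -
  define S where "S r = {y \<in> Q. \<forall>i. r < \<bar>y $ i\<bar>}" for r
  have [measurable]: "S r \<in> sets borel" for r
    unfolding S_def Q_def by measurable
  have SQ: "S r \<subseteq> Q" for r by (auto simp: S_def)
  have Q [measurable]: "Q \<in> sets borel" unfolding Q_cbox by simp
  have Qf: "emeasure lborel (Q :: (real ^ 'n) set) < \<infinity>" unfolding Q_cbox by (simp add: emeasure_lborel_cbox_eq)
  have Sf: "emeasure lborel (S r) < \<infinity>" for r
    using le_less_trans[OF emeasure_mono[OF SQ] Qf] by simp
  have iS: "integrable lborel (\<lambda>y. indicator (S r) y * w y)" for r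
    using integrable_mult_indicator[OF _ w_integrable, of "S r"] by simp
  \<comment> \<open>If w had no mass on any \<open>S r\<close>, it would vanish almost everywhere
    off the coordinate hyperplanes, which are null sets.\<close>
  obtain r where r: "r > 0" "(\<integral>y. indicator (S r) y * w y \<partial>lborel) > 0"
  proof (rule ccontr)
    assume "\<not> thesis"
    with that have no: "\<And>r. r > 0 \<Longrightarrow> \<not> (\<integral>y. indicator (S r) y * w y \<partial>lborel) > 0" by blast
    have "AE y in lborel. indicator (S (1 / real (Suc n))) y * w y = 0" for n
    proof -
      have "(\<integral>y. indicator (S (1 / real (Suc n))) y * w y \<partial>lborel) \<ge> 0" using w_bounds by simp
      with no[of "1 / real (Suc n)"] have "(\<integral>y. indicator (S (1 / real (Suc n))) y * w y \<partial>lborel) = 0" by simp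
      then show ?thesis by (subst (asm) integral_nonneg_eq_0_iff_AE[OF iS]) (use w_bounds in auto)
    qed
    then have "AE y in lborel. \<forall>n. indicator (S (1 / real (Suc n))) y * w y = 0"
      by (subst AE_all_countable) blast
    moreover have "AE y in (lborel :: (real ^ 'n) measure). \<forall>i. y $ i \<noteq> 0"
      by (subst AE_all_countable) (auto intro: AE_component_neq)
    ultimately have "AE y in lborel. w y = 0"
    proof eventually_elim
      case (elim y)
      show "w y = 0"
      proof (cases "y \<in> Q")
        case True
        have "Min (range (\<lambda>i. \<bar>y $ i\<bar>)) > 0" using elim(2) by (subst Min_gr_iff) auto
        then obtain n where n: "1 / real (Suc n) < Min (range (\<lambda>i. \<bar>y $ i\<bar>))"
          using reals_Archimedean unfolding inverse_eq_divide by blast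
        have "1 / real (Suc n) < \<bar>y $ i\<bar>" for i
          using less_le_trans[OF n Min_le[of "range (\<lambda>i. \<bar>y $ i\<bar>)" "\<bar>y $ i\<bar>"]] by simp
        then have "y \<in> S (1 / real (Suc n))" using True by (simp add: S_def)
        with elim(1)[rule_format, of n] show ?thesis by simp
      next
        case False
        moreover have "K1 \<subseteq> Q"
        proof
          fix z :: "real ^ 'n" assume "z \<in> K1"
          then have "\<bar>z $ k\<bar> \<le> 5 / 2" for k unfolding K1_def mem_Collect_eq by (elim allE[of _ k]) simp
          then show "z \<in> Q" by (simp add: Q_def)
        qed
        ultimately show ?thesis using w_support by blast
      qed
    qed
    with nontrivial show False ..
  qed
  define V where "V = measure lborel (S r)"
  define m where "m = (\<integral>y. indicator (S r) y * w y \<partial>lborel)"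
  have m: "m > 0" using r by (simp add: m_def)
  have V: "V > 0"
  proof (rule ccontr)
    assume "\<not> V > 0"
    then have "V = 0" using measure_nonneg[of lborel "S r"] by (simp add: V_def)
    then have "emeasure lborel (S r) = 0" using Sf[of r] by (auto simp: V_def measure_def enn2real_eq_0_iff)
    then have "S r \<in> null_sets lborel" by (simp add: null_sets_def)
    then have "AE y in lborel. indicator (S r) y * w y = 0" by (rule AE_I') (auto simp: indicator_def)
    then have "m = 0" unfolding m_def by (intro integral_eq_zero_AE)
    with m show False by simp
  qed
  \<comment> \<open>The shortfall of w below m / V on the box; its integral turns out to be at most
    a fixed multiple of every c > 0.\<close>
  define P where "P y = (if \<forall>i. \<bar>y $ i\<bar> < r then max 0 (m / V - w y) else 0)" for y
  have [measurable]: "P \<in> borel_measurable borel" unfolding P_def[abs_def] by measurable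
  have rQ: "y \<in> Q" if y: "\<And>i. \<bar>y $ i\<bar> < r" for y :: "real ^ 'n"
  proof -
    \<comment> \<open>A point of \<open>S r\<close> lies in Q, which forces r <= 5/2 and puts the
      box inside Q.\<close>
    have "S r \<noteq> {}" using m by (auto simp: m_def)
    then obtain z where z: "z \<in> S r" by blast
    have "r \<le> 5 / 2"
      using z less_le_trans[of r "\<bar>z $ i\<bar>" "5 / 2" for i] by (auto simp: S_def Q_def intro: less_imp_le)
    then have "\<bar>y $ k\<bar> \<le> 5 / 2" for k using y[of k] by linarith
    then show ?thesis by (simp add: Q_def)
  qed
  have P0: "P y \<ge> 0" for y by (simp add: P_def)
  have Pint: "integrable lborel P"
  proof (rule bounded_support_integrable[OF _ _ Q_bounded])
    show "\<bar>P y\<bar> \<le> m / V" for y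
      using w_bounds(1)[of y] m V by (simp add: P_def)
    show "P y = 0" if "y \<notin> Q" for y
      using that rQ[of y] by (auto simp: P_def)
  qed simp
  define q where "q = measure lborel (Q :: (real ^ 'n) set)"
  have bound: "(\<integral>y. P y \<partial>lborel) \<le> 0 + c * (q / V + 1)" if c: "c > 0" for c
  proof -
    obtain d where d: "0 < d" "d \<le> 1" and good: "good c d" using good_exists[OF c] by metis
    have h: "(0 :: real) \<le> 1 / 2" by simp
    note Ew = Ew(1,2)[OF d order.refl h zero_less_one good c]
    have iQ: "integrable lborel (\<lambda>y. indicator Q y * (c / V))"
      using Qf by (intro integrable_mult_left integrable_real_indicator) auto
    have le: "m / V - c / V \<le> wd d x" if x: "\<And>i. \<bar>x $ i\<bar> < r" for x
    proof -
      have "m = (\<integral>y. indicator (S r) y * w y \<partial>lborel)" by (simp add: m_def)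
      also have "\<dots> \<le> (\<integral>y. indicator (S r) y * wd d x + Ew d y \<partial>lborel)"
      proof (rule integral_mono[OF iS])
        show "integrable lborel (\<lambda>y. indicator (S r) y * wd d x + Ew d y)"
          using Sf Ew by (intro Bochner_Integration.integrable_add integrable_mult_left integrable_real_indicator) auto
        fix y
        show "indicator (S r) y * w y \<le> indicator (S r) y * wd d x + Ew d y"
        proof (cases "y \<in> S r")
          case True
          then have "wd d y \<le> wd d x" using x by (intro wd_mono[OF d(1)]) (auto simp: S_def intro: less_trans)
          then show ?thesis using True by (auto simp: Ew_def)
        qed (simp add: Ew_def)
      qed
      also have "\<dots> = V * wd d x + (\<integral>y. Ew d y \<partial>lborel)"
        using Sf Ew by (subst Bochner_Integration.integral_add)
          (auto simp: V_def intro!: integrable_mult_left integrable_real_indicator)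
      also have "\<dots> \<le> V * wd d x + c" using Ew by simp
      finally show ?thesis using V by (simp add: field_simps)
    qed
    have "(\<integral>y. P y \<partial>lborel) \<le> (\<integral>y. indicator Q y * (c / V) + Ew d y \<partial>lborel)"
    proof (rule integral_mono[OF Pint])
      show "integrable lborel (\<lambda>y. indicator Q y * (c / V) + Ew d y)" using iQ Ew by simp
      fix y
      show "P y \<le> indicator Q y * (c / V) + Ew d y"
      proof (cases "\<forall>i. \<bar>y $ i\<bar> < r")
        case True
        then have "y \<in> Q" "m / V - c / V \<le> wd d y" using rQ le by auto
        moreover have "c / V \<ge> 0" using c V by simp
        ultimately show ?thesis using True by (auto simp: P_def Ew_def)
      next
        case False
        then have "P y = 0" by (simp only: P_def if_False)
        then show ?thesis using c V by (simp add: Ew_def)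
      qed
    qed
    also have "\<dots> = q * (c / V) + (\<integral>y. Ew d y \<partial>lborel)" using iQ Ew by (simp add: q_def)
    also have "\<dots> \<le> q * (c / V) + c" using Ew by simp
    finally show ?thesis by (simp add: algebra_simps)
  qed
  have "(\<integral>y. P y \<partial>lborel) \<le> 0"
  proof (rule field_le_epsilon)
    fix e :: real assume e: "e > 0"
    have "q / V + 1 > 0" using V by (simp add: q_def add_nonneg_pos)
    then show "(\<integral>y. P y \<partial>lborel) \<le> 0 + e" using bound[of "e / (q / V + 1)"] e by simp
  qed
  moreover have "(\<integral>y. P y \<partial>lborel) \<ge> 0" by (simp add: P0)
  ultimately have "AE y in lborel. P y = 0"
    using integral_nonneg_eq_0_iff_AE[OF Pint AE_I2[OF P0]] by simp
  then have "AE y in lborel. (\<forall>i. \<bar>y $ i\<bar> < min r (m / V)) \<longrightarrow> w y \<ge> min r (m / V)"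
    by eventually_elim (auto simp: P_def max_def split: if_splits)
  then show ?thesis using r(1) m V by (intro exI[of _ "min r (m / V)"]) auto
qed
end

subsection \<open>From local weak solutions to the elliptic problem\<close>

text \<open>Since all p_i exceed 2, so does their harmonic mean, which makes sigma positive. The
  upper bound on p_i says exactly that the numerator N (pbar - p_i) + pbar is positive.\<close>

lemma fp_alpha_i_pos:
  fixes p :: "real ^ 'n::finite"
  assumes p: "\<forall>i. 2 < p $ i \<and> p $ i < pbar p * (1 + 1 / real CARD('n))"
  shows "fp_alpha_i p i > 0"
proof -
  have N: "real CARD('n) > 0" by simp
  define s where "s = (1 / real CARD('n)) * (\<Sum>i\<in>UNIV. 1 / p $ i)"
  have "(\<Sum>i\<in>UNIV. 1 / p $ i) < (\<Sum>i\<in>(UNIV :: 'n set). 1 / 2)"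
  proof (rule sum_strict_mono)
    fix i show "1 / p $ i < 1 / 2" using p[rule_format, of i] by (simp add: field_simps)
  qed auto
  then have "s < 1 / 2" unfolding s_def using N by (simp add: field_simps)
  moreover have "s > 0"
    unfolding s_def using p by (intro mult_pos_pos sum_pos) (auto intro: less_trans[of 0 2])
  ultimately have pb: "pbar p > 2"
    unfolding pbar_def s_def[symmetric] by (simp add: field_simps)
  have "fp_sigma p > 0" unfolding fp_sigma_def using pb by (intro add_nonneg_pos mult_nonneg_nonneg) auto
  moreover have "real CARD('n) * p $ i < real CARD('n) * (pbar p * (1 + 1 / real CARD('n)))"
    using p N by (intro mult_strict_left_mono) auto
  moreover have "real CARD('n) * (pbar p * (1 + 1 / real CARD('n))) = real CARD('n) * pbar p + pbar p"
    using N by (simp add: field_simps)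
  ultimately have "fp_sigma p > 0" "real CARD('n) * (pbar p - p $ i) + pbar p > 0"
    by (simp_all add: right_diff_distrib)
  moreover have "p $ i > 0" using p less_trans[of 0 2 "p $ i"] by auto
  ultimately show ?thesis unfolding fp_alpha_i_def by simp
qed

text \<open>Selects a time slice, or a pair of times, from an almost-everywhere statement: the box
  has positive measure.\<close>

lemma AE_imp_ex_in_cbox:
  assumes "\<And>i. i \<in> Basis \<Longrightarrow> a \<bullet> i < b \<bullet> i" and "AE x in lborel. P x"
  shows "\<exists>x\<in>cbox a b. P x"
proof (rule ccontr)
  assume no: "\<not> ?thesis"
  have "AE x in lborel. x \<notin> cbox a b" using assms(2) by eventually_elim (use no in blast)
  then have "emeasure lborel (cbox a b) = 0" by (simp add: AE_iff_null_sets[symmetric] null_sets_def)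
  then show False
    using assms(1) by (simp add: emeasure_lborel_cbox_eq less_imp_le prod_pos inner_diff_left split: if_splits)
      (metis (mono_tags, lifting) diff_gt_0_iff_gt inner_diff_left less_irrefl prod_pos)
qed

lemma Cc_infinity_fst_test_function:
  assumes \<phi>: "\<phi> \<in> Cc_infinity"
  shows "(\<lambda>(y, s). \<phi> y) \<in> test_functions UNIV"
    and "frechet_derivative (\<lambda>(y, s :: real). \<phi> y) (at (y, s)) v = frechet_derivative \<phi> (at y) (fst v)"
proof -
  have eq: "(\<lambda>(y, s :: real). \<phi> y) = (\<lambda>z. \<phi> (fst z + 0))" by auto
  have "Ck_on k UNIV (\<lambda>(y, s :: real). \<phi> y)" for k
    unfolding eq by (rule Ck_affine_comp[OF bounded_linear_fst Cc_infinity_Ck[OF \<phi>]])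
  moreover have "\<exists>K. compact K \<and> (\<forall>s\<in>{a..b::real}. \<forall>y. y \<notin> K \<longrightarrow> (case (y, s) of (y, s) \<Rightarrow> \<phi> y) = 0)" for a b
    using \<phi> closure_subset[of "{x. \<phi> x \<noteq> 0}"]
    by (intro exI[of _ "closure {x. \<phi> x \<noteq> 0}"]) (auto simp: Cc_infinity_def)
  ultimately show "(\<lambda>(y, s). \<phi> y) \<in> test_functions UNIV"
    by (simp add: test_functions_def smooth_on_def)
  have "((\<lambda>z. \<phi> (fst z + 0)) has_derivative (\<lambda>v. frechet_derivative \<phi> (at y) (fst v))) (at (y, s :: real))"
    using has_derivative_compose[OF bounded_linear_imp_has_derivative[OF bounded_linear_fst] Cc_infinity_has_derivative[OF \<phi>], of "(y, s)" UNIV]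
    by simp
  from frechet_derivative_at[OF this, symmetric]
  show "frechet_derivative (\<lambda>(y, s :: real). \<phi> y) (at (y, s)) v = frechet_derivative \<phi> (at y) (fst v)"
    unfolding eq by simp
qed

text \<open>With a test function independent of time the boundary terms cancel, since w is the same
  at both times, and the time integral is t2 - t1 times the elliptic form. For the latter the
  gradients g(., s) must agree for almost all s, which is uniqueness of weak derivatives.\<close>

lemma fp_stationary_solution_imp_stationary:
  fixes p :: "real ^ 'n::finite"
  assumes p: "\<And>i. p $ i > 1" and a: "\<And>i. fp_alpha_i p i > 0" and w: "w \<in> X11" and sol: "fp_stationary_solution p w"
  obtains w' G where "stationary p (fp_alpha_i p) w' G" and "AE y in lborel. w y = w' y"
proof -
  let ?K = "K1 :: (real ^ 'n) set"
  have Kcbox: "?K = cbox (\<chi> i. - (1 / 2)) (\<chi> i. 1 / 2)"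
  proof -
    have *: "\<bar>r\<bar> \<le> 1 / 2 \<longleftrightarrow> - (1 / 2) \<le> r \<and> r \<le> 1 / 2" for r :: real by linarith
    show ?thesis unfolding K1_def * cbox_def by (auto simp: Basis_vec_def inner_axis)
  qed
  have K: "compact ?K" unfolding Kcbox by (rule compact_cbox)
  have [measurable]: "?K \<in> sets borel" using K by (simp add: compact_imp_closed)
  have wm: "w \<in> borel_measurable lebesgue" using w by (simp add: X11_def)
  obtain w0 where [measurable]: "w0 \<in> borel_measurable borel" and w0: "AE y in lborel. w y = w0 y"
    using completion_ex_borel_measurable_real[OF wm] by auto
  \<comment> \<open>Clipping to [0, 1] and to \<open>K1\<close> changes w0 on a null set only and
    makes the bounds hold everywhere.\<close>
  define w' where "w' y = indicator ?K y * max 0 (min 1 (w0 y))" for y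
  have [measurable]: "w' \<in> borel_measurable borel" unfolding w'_def[abs_def] by measurable
  have wK: "AE y in lborel. y \<in> - ?K \<longrightarrow> w y = 0"
    using AE_zero_outside_ess_support[of w] by eventually_elim (use w in \<open>auto simp: X11_def\<close>)
  have "AE y in lborel. 0 \<le> w y \<and> w y \<le> 1" using w by (simp add: X11_def AE_completion_iff)
  with w0 wK have ww': "AE y in lborel. w y = w' y"
    by eventually_elim (auto simp: w'_def indicator_def)
  define E where "E g t1 t2 \<longleftrightarrow> (\<forall>\<phi>\<in>test_functions UNIV.
      (LINT y|lebesgue. w y * \<phi> (y, t2)) - (LINT y|lebesgue. w y * \<phi> (y, t1))
      + (LINT s:{t1..t2}|lebesgue. (LINT y|lebesgue.
           - w y * frechet_derivative \<phi> (at (y, s)) (0, 1)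
           + (\<Sum>i\<in>UNIV. (\<bar>g i (y, s)\<bar> powr (p $ i - 2) * g i (y, s) + fp_alpha_i p i * y $ i * w y)
                * frechet_derivative \<phi> (at (y, s)) (axis i 1, 0)))) = 0)" for g and t1 t2 :: real
  from sol obtain g where g: "L1_loc_W11_loc UNIV (\<lambda>(y, s). w y) g" and gp: "\<And>i. Lp_loc (p $ i) (UNIV \<times> UNIV) (g i)"
    and "AE (t1, t2) in lebesgue. t1 \<in> UNIV \<and> t2 \<in> UNIV \<and> t1 < t2 \<longrightarrow> E g t1 t2"
    unfolding fp_stationary_solution_def fp_local_weak_solution_def E_def prod.case by blast
  then have eq: "AE z in lborel. fst z < snd z \<longrightarrow> E g (fst z) (snd z)"
    by (simp add: AE_completion_iff case_prod_unfold)
  have weak: "AE s in lborel. \<forall>i. has_weak_partial i w (\<lambda>y. g i (y, s))"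
    using g by (simp add: L1_loc_W11_loc_def AE_completion_iff)
  have fin: "AE s in lborel. \<forall>i. (\<integral>\<^sup>+y. ennreal \<bar>indicator (?K \<times> {0..1::real}) (y, s) *\<^sub>R \<bar>g i (y, s)\<bar> powr p $ i\<bar> \<partial>lborel) < \<infinity>"
  proof (subst AE_all_countable, rule allI)
    fix i
    have "compact (?K \<times> {0..1::real})" using K by (intro compact_Times) auto
    then have "integrable lebesgue (\<lambda>x. indicator (?K \<times> {0..1::real}) x *\<^sub>R \<bar>g i x\<bar> powr p $ i)"
      using gp[of i] by (simp add: Lp_loc_def set_integrable_def)
    from integrable_slice[OF this]
    show "AE s in lborel. (\<integral>\<^sup>+y. ennreal \<bar>indicator (?K \<times> {0..1::real}) (y, s) *\<^sub>R \<bar>g i (y, s)\<bar> powr p $ i\<bar> \<partial>lborel) < \<infinity>" .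
  qed
  \<comment> \<open>A single slice with weak derivatives whose p-th powers are integrable on
    \<open>K1\<close> will provide G.\<close>
  have "\<exists>s\<in>cbox (0 :: real) 1. (\<forall>i. has_weak_partial i w (\<lambda>y. g i (y, s)))
      \<and> (\<forall>i. (\<integral>\<^sup>+y. ennreal \<bar>indicator (?K \<times> {0..1::real}) (y, s) *\<^sub>R \<bar>g i (y, s)\<bar> powr p $ i\<bar> \<partial>lborel) < \<infinity>)"
    by (rule AE_imp_ex_in_cbox[OF _ AE_conjI[OF weak fin]]) simp
  then obtain s0 :: real where s0: "s0 \<in> cbox 0 1" and weak0: "\<And>i. has_weak_partial i w (\<lambda>y. g i (y, s0))"
    and fin0: "\<And>i. (\<integral>\<^sup>+y. ennreal \<bar>indicator (?K \<times> {0..1::real}) (y, s0) *\<^sub>R \<bar>g i (y, s0)\<bar> powr p $ i\<bar> \<partial>lborel) < \<infinity>"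
    by blast
  define gb where "gb i g' \<longleftrightarrow> g' \<in> borel_measurable borel \<and> (AE y in lborel. g i (y, s0) = g' y) \<and>
    (\<forall>K. compact K \<longrightarrow> set_integrable lborel K g')" for i g'
  have "\<exists>g'. gb i g'" for i
  proof -
    have L: "Lp_loc 1 UNIV (\<lambda>y. g i (y, s0))" using weak0[of i] by (simp add: has_weak_partial_def)
    from Lp_loc_borel_version[OF L] show ?thesis unfolding gb_def by blast
  qed
  then obtain g' where gb: "\<And>i. gb i (g' i)" by metis
  then have g' [measurable]: "g' i \<in> borel_measurable borel" and gg': "AE y in lborel. g i (y, s0) = g' i y"
    and g'K: "compact K \<Longrightarrow> set_integrable lborel K (g' i)" for i K
    unfolding gb_def by blast+
  \<comment> \<open>The gradient vanishes almost everywhere off \<open>K1\<close>, so the cut alters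
    it on a null set only, and local integrability becomes global.\<close>
  define G where "G i y = indicator ?K y * g' i y" for i y
  have [measurable]: "G i \<in> borel_measurable borel" for i unfolding G_def[abs_def] by measurable
  have G0: "AE y in lborel. g i (y, s0) = G i y" for i
  proof -
    have "AE y in lborel. y \<in> - ?K \<longrightarrow> g i (y, s0) = 0"
      by (rule weak_partial_zero[OF weak0 _ wK]) (use K in \<open>simp add: compact_imp_closed open_Compl\<close>)
    with gg'[of i] show ?thesis by eventually_elim (auto simp: G_def indicator_def)
  qed
  have G: "AE s in lborel. \<forall>i. AE y in lborel. g i (y, s) = G i y"
    using weak
  proof eventually_elim
    case (elim s)
    show ?case
    proof
      fix i
      from weak_partial_unique[OF elim[rule_format, of i] weak0[of i]] G0[of i]
      show "AE y in lborel. g i (y, s) = G i y" by eventually_elim simp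
    qed
  qed
  have "stationary p (fp_alpha_i p) w' G"
  proof
    show "0 \<le> w' y" "w' y \<le> 1" "y \<notin> K1 \<Longrightarrow> w' y = 0" for y
      by (auto simp: w'_def indicator_def)
    show "integrable lborel (G i)" for i
      using g'K[OF K, of i] by (simp add: set_integrable_def G_def[abs_def])
    show "integrable lborel (\<lambda>y. \<bar>G i y\<bar> powr p $ i)" for i
    proof (rule integrableI_bounded)
      have "(\<integral>\<^sup>+y. ennreal (norm (\<bar>G i y\<bar> powr p $ i)) \<partial>lborel)
          = (\<integral>\<^sup>+y. ennreal \<bar>indicator (?K \<times> {0..1::real}) (y, s0) *\<^sub>R \<bar>g i (y, s0)\<bar> powr p $ i\<bar> \<partial>lborel)"
      proof (rule nn_integral_cong_AE)
        show "AE y in lborel. ennreal (norm (\<bar>G i y\<bar> powr p $ i))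
            = ennreal \<bar>indicator (?K \<times> {0..1::real}) (y, s0) *\<^sub>R \<bar>g i (y, s0)\<bar> powr p $ i\<bar>"
          using G0[of i] by eventually_elim (use s0 in \<open>auto simp: G_def indicator_def\<close>)
      qed
      then show "(\<integral>\<^sup>+y. ennreal (norm (\<bar>G i y\<bar> powr p $ i)) \<partial>lborel) < \<infinity>" using fin0[of i] by simp
    qed measurable
  next
    fix i :: 'n and \<phi> :: "real ^ 'n \<Rightarrow> real" assume \<phi>: "\<phi> \<in> Cc_infinity"
    have [measurable]: "\<phi> \<in> borel_measurable borel" "pd \<phi> i \<in> borel_measurable borel"
      using Cc_infinity_measurable \<phi> Cc_infinity_derivative by blast+
    have "(\<integral>y. w' y * pd \<phi> i y \<partial>lborel) = (\<integral>y. w y * pd \<phi> i y \<partial>lebesgue)"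
      by (rule lebesgue_integral_eq_lborel[symmetric]) (use ww' in auto)
    also have "\<dots> = - (\<integral>y. g i (y, s0) * \<phi> y \<partial>lebesgue)" using weak0[of i] \<phi> by (simp add: has_weak_partial_def)
    also have "(\<integral>y. g i (y, s0) * \<phi> y \<partial>lebesgue) = (\<integral>y. G i y * \<phi> y \<partial>lborel)"
      by (rule lebesgue_integral_eq_lborel) (use G0[of i] in auto)
    finally show "(\<integral>y. w' y * pd \<phi> i y \<partial>lborel) = - (\<integral>y. G i y * \<phi> y \<partial>lborel)" .
  next
    fix \<phi> :: "real ^ 'n \<Rightarrow> real" assume \<phi>: "\<phi> \<in> Cc_infinity"
    have [measurable]: "pd \<phi> i \<in> borel_measurable borel" for i
      using Cc_infinity_measurable \<phi> Cc_infinity_derivative by blast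
    define C where "C = (\<integral>y. (\<Sum>i\<in>UNIV. (flux (p $ i) (G i y) + fp_alpha_i p i * y $ i * w' y) * pd \<phi> i y) \<partial>lborel)"
    \<comment> \<open>The ranges [0, 1] for t1 and [2, 3] for t2 force t1 < t2.\<close>
    have "\<exists>z\<in>cbox (0 :: real, 2 :: real) (1, 3). fst z < snd z \<longrightarrow> E g (fst z) (snd z)"
      by (rule AE_imp_ex_in_cbox[OF _ eq]) (auto simp: Basis_prod_def)
    then obtain z :: "real \<times> real" where "z \<in> cbox (0, 2) (1, 3)" and z: "fst z < snd z \<longrightarrow> E g (fst z) (snd z)" by blast
    then have "fst z < snd z" by (auto simp: cbox_Pair_eq)
    with z obtain t1 t2 where t: "t1 < t2" and E: "E g t1 t2" by blast
    have inner: "AE s in lborel. (LINT y|lebesgue.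
        - w y * frechet_derivative \<phi> (at y) 0
        + (\<Sum>i\<in>UNIV. (\<bar>g i (y, s)\<bar> powr (p $ i - 2) * g i (y, s) + fp_alpha_i p i * y $ i * w y) * pd \<phi> i y)) = C"
      using G
    proof eventually_elim
      case (elim s)
      then have "AE y in lborel. \<forall>i. g i (y, s) = G i y" by (simp add: AE_all_countable)
      then have "AE y in lborel. - w y * frechet_derivative \<phi> (at y) 0
          + (\<Sum>i\<in>UNIV. (\<bar>g i (y, s)\<bar> powr (p $ i - 2) * g i (y, s) + fp_alpha_i p i * y $ i * w y) * pd \<phi> i y)
          = (\<Sum>i\<in>UNIV. (flux (p $ i) (G i y) + fp_alpha_i p i * y $ i * w' y) * pd \<phi> i y)"
        using ww'
      proof eventually_elim
        case (elim y)
        have "frechet_derivative \<phi> (at y) 0 = 0"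
          by (rule linear_0[OF has_derivative_linear[OF Cc_infinity_has_derivative[OF \<phi>]]])
        then show ?case using elim by (simp add: flux_def)
      qed
      then show ?case unfolding C_def by (rule lebesgue_integral_eq_lborel) measurable
    qed
    have "0 = (LINT s:{t1..t2}|lebesgue. (LINT y|lebesgue.
        - w y * frechet_derivative \<phi> (at y) 0
        + (\<Sum>i\<in>UNIV. (\<bar>g i (y, s)\<bar> powr (p $ i - 2) * g i (y, s) + fp_alpha_i p i * y $ i * w y) * pd \<phi> i y)))"
      using E[unfolded E_def, rule_format, OF Cc_infinity_fst_test_function(1)[OF \<phi>]] by (simp add: Cc_infinity_fst_test_function(2)[OF \<phi>])
    also have "\<dots> = (\<integral>s. indicator {t1..t2} s *\<^sub>R C \<partial>lborel)"
      unfolding set_lebesgue_integral_def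
      by (rule lebesgue_integral_eq_lborel) (use inner in auto)
    also have "\<dots> = (t2 - t1) * C" using t by simp
    finally have "C = 0" using t by simp
    then show "(\<integral>y. (\<Sum>i\<in>UNIV. (flux (p $ i) (G i y) + fp_alpha_i p i * y $ i * w' y) * pd \<phi> i y) \<partial>lborel) = 0"
      by (simp add: C_def)
  qed (use p a in auto)
  then show ?thesis using that ww' by blast
qed

text \<open>The exceptional set lies in the image of a null set under the inverse diagonal map, and
  a linear map of the space into itself sends null sets to null sets.\<close>

lemma AE_diagonal_scaling:
  fixes c :: "'n::finite \<Rightarrow> real"
  assumes P: "AE y in lborel. P y" and c: "\<And>i. c i > 0"
  shows "AE x in lebesgue. P (\<chi> i. c i * x $ i)"
proof -
  obtain N where N: "{y. \<not> P y} \<subseteq> N" "emeasure lborel N = 0" "N \<in> sets lborel"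
    using AE_E[OF P] by auto
  let ?T = "\<lambda>y :: real ^ 'n. \<chi> i. y $ i / c i"
  have "negligible N" using N(2,3) by (simp add: negligible_iff_null_sets null_sets_completionI null_setsI)
  moreover have "linear ?T" by (rule linearI) (auto simp: vec_eq_iff add_divide_distrib)
  ultimately have "negligible (?T ` N)"
    by (intro negligible_differentiable_image_negligible linear_imp_differentiable_on) auto
  then have "?T ` N \<in> null_sets lebesgue" by (simp add: negligible_iff_null_sets)
  then show ?thesis
  proof (rule AE_I')
    show "{x \<in> space lebesgue. \<not> P (\<chi> i. c i * x $ i)} \<subseteq> ?T ` N"
    proof
      fix x assume "x \<in> {x \<in> space lebesgue. \<not> P (\<chi> i. c i * x $ i)}"
      then have "(\<chi> i. c i * x $ i) \<in> N" using N(1) by auto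
      moreover have "x = ?T (\<chi> i. c i * x $ i)" using c by (simp add: vec_eq_iff less_imp_neq[THEN not_sym])
      ultimately show "x \<in> ?T ` N" by (rule rev_image_eqI)
    qed
  qed
qed

theorem theorem3p3:
  fixes p :: "real ^ 'n::finite" and w :: "real ^ 'n \<Rightarrow> real"
  assumes "\<forall>i. 2 < p $ i \<and> p $ i < pbar p * (1 + 1 / real CARD('n))"
    and "pbar p < real CARD('n)"
    and "w \<in> X11"
    and "fp_stationary_solution p w"
    and "\<not> (AE y in lebesgue. w y = 0)"
  shows "\<exists>\<eta>>0. \<forall>t>0. AE x in lebesgue.
           (\<forall>i. \<bar>x $ i\<bar> < \<eta> * t powr fp_alpha_i p i) \<longrightarrow>
           barenblatt p w x t \<ge> \<eta> * t powr (- fp_alpha p)"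
proof -
  have p1: "p $ i > 1" for i using assms(1) less_trans[of 1 2 "p $ i"] by auto
  obtain w' G where st: "stationary p (fp_alpha_i p) w' G" and ww': "AE y in lborel. w y = w' y"
    by (rule fp_stationary_solution_imp_stationary[OF p1 fp_alpha_i_pos[OF assms(1)] assms(3,4)])
  have "\<not> (AE y in lborel. w' y = 0)"
  proof
    assume "AE y in lborel. w' y = 0"
    with ww' have "AE y in lborel. w y = 0" by eventually_elim simp
    with assms(5) show False by (simp add: AE_completion_iff)
  qed
  from stationary.w_bounded_below_near_0[OF st this]
  obtain \<eta> where \<eta>: "\<eta> > 0" and "AE y in lborel. (\<forall>i. \<bar>y $ i\<bar> < \<eta>) \<longrightarrow> w' y \<ge> \<eta>" by blast
  from this(2) ww' have bd: "AE y in lborel. (\<forall>i. \<bar>y $ i\<bar> < \<eta>) \<longrightarrow> w y \<ge> \<eta>" by eventually_elim simp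
  \<comment> \<open>eta is fixed before t, because every B(., t) is a rescaling of the same w; the
    scaling of the argument turns |y_i| < eta into |x_i| < eta t^alpha_i.\<close>
  show ?thesis
  proof (intro exI[of _ \<eta>] conjI allI impI \<eta>)
    fix t :: real assume t: "t > 0"
    have "AE x in lebesgue. (\<forall>i. \<bar>(\<chi> i. t powr (- fp_alpha_i p i) * x $ i) $ i\<bar> < \<eta>)
        \<longrightarrow> w (\<chi> i. t powr (- fp_alpha_i p i) * x $ i) \<ge> \<eta>"
      by (rule AE_diagonal_scaling[OF bd]) (use t in simp)
    then show "AE x in lebesgue. (\<forall>i. \<bar>x $ i\<bar> < \<eta> * t powr fp_alpha_i p i) \<longrightarrow>
        barenblatt p w x t \<ge> \<eta> * t powr (- fp_alpha p)"
    proof eventually_elim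
      case (elim x)
      have "\<bar>t powr (- fp_alpha_i p i) * x $ i\<bar> < \<eta> \<longleftrightarrow> \<bar>x $ i\<bar> < \<eta> * t powr fp_alpha_i p i" for i
        using t by (simp add: powr_minus_divide abs_mult pos_divide_less_eq)
      with elim mult_left_mono[OF _ powr_ge_zero[of t "- fp_alpha p"], of \<eta> "w (\<chi> i. t powr (- fp_alpha_i p i) * x $ i)"]
      show ?case unfolding barenblatt_def by (simp add: mult.commute)
    qed
  qed
qed

end
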